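(* Let $w_0\in\mathbb R$. Assume $\mathscr S^{*}\neq\varnothing$, that $U$ satisfies the utility assumption, and that we are in the whole-line setting. If $U(+\infty):=\lim_{x\to+\infty}U(x)<+\infty$, then there exists $\hat\phi\in\mathscr L$ such that $$u(w_0)=\inf_{S\in\mathscr S}\mathbb E_{\mathbb P}\big[U(W_T^S(w_0,\hat\phi))\big]<+\infty.$$
   Context: Fix $d,T\in\mathbb N$ and a filtered probability space $(\Omega,\mathcal F,\mathbb F=(\mathcal F_t)_{t=0}^T,\mathbb P)$ whose $\sigma$-algebras all contain the $\mathbb P$-null sets; random variables equal a.s. are identified. For $\mathcal G\subseteq\mathcal F$, $L^0(\mathcal G;\mathbb R^n)$ is the space of $\mathcal G$-measurable $\mathbb R^n$-valued random variables with the topology of convergence in probability. Let $\mathscr S$ be a nonempty family of $\mathbb F$-adapted $\mathbb R^d$-valued processes $S=(S_t)_{t=0}^T$, and write $\Delta S_t=S_t-S_{t-1}$. Let $\mathscr L=\prod_{t=1}^T L^0(\mathcal F_{t-1};\mathbb R^d)$. For $w\in\mathbb R$, $\phi\in\mathscr L$, $S\in\mathscr S$, set $W_t^S(w,\phi)=w+\sum_{s=1}^t\langle\phi_s,\Delta S_s\rangle$. For $S\in\mathscr S$ and $t\ge1$, $D_t^S(\omega)$ is the smallest affine subspace of $\mathbb R^d$ containing the support of the regular conditional distribution of $\Delta S_t$ given $\mathcal F_{t-1}$ at $\omega$. NA($S$) means: for every $\phi\in\mathscr L$, $W_T^S(0,\phi)\ge0$ a.s. implies $W_T^S(0,\phi)=0$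 a.s. $\mathscr S^{*}$ denotes the set of $S^*\in\mathscr S$ such that NA($S^*$) holds and, for every $S\in\mathscr S$ and $t$, $D_t^S\subseteq D_t^{S^*}$ a.s. Utility assumption: $U:\mathbb R\to\mathbb R\cup\{-\infty\}$ is non-decreasing, concave and upper semicontinuous. Whole-line setting: $U(x)>-\infty$ for all $x\in\mathbb R$, and every $\phi\in\mathscr L$ is admissible (i.e. $\mathscr L(w_0,S)=\mathscr L$ for all $S$). Value $u(w_0)=\sup_{\varphi\in\mathscr L}\inf_{S\in\mathscr S}\mathbb E_{\mathbb P}[U(W_T^S(w_0,\varphi))]$, with the convention that the expectation of a random variable whose positive and negative parts both have infinite expectation is $-\infty$. *)

theory Defs
  imports "HOL-Probability.Probability"
begin

(* Support of a (Borel) measure on a metric space: the points all of whose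
   open balls have positive mass (= smallest closed set of full measure). *)
definition measure_support :: "'v::metric_space measure \<Rightarrow> 'v set" where
  "measure_support \<mu> = {x. \<forall>e>0. 0 < emeasure \<mu> (ball x e)}"

definition is_rcd :: "'w measure \<Rightarrow> 'w measure \<Rightarrow> ('w \<Rightarrow> 'v::topological_space)
    \<Rightarrow> ('w \<Rightarrow> 'v measure) \<Rightarrow> bool" where
  "is_rcd M G X \<kappa> \<longleftrightarrow>
     (\<forall>\<omega>\<in>space M. prob_space (\<kappa> \<omega>) \<and> sets (\<kappa> \<omega>) = sets borel) \<and>
     (\<forall>B\<in>sets borel. (\<lambda>\<omega>. emeasure (\<kappa> \<omega>) B) \<in> borel_measurable G) \<and>
     (\<forall>A\<in>sets G. \<forall>B\<in>sets borel.
        emeasure M (A \<inter> (X -` B \<inter> space M)) =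
        (\<integral>\<^sup>+\<omega>. emeasure (\<kappa> \<omega>) B * indicator A \<omega> \<partial>M))"

(* "the" regular conditional distribution (a chosen version; it exists for
   R^d-valued X and is unique up to a null set) *)
definition rcd :: "'w measure \<Rightarrow> 'w measure \<Rightarrow> ('w \<Rightarrow> 'v::topological_space)
    \<Rightarrow> ('w \<Rightarrow> 'v measure)" where
  "rcd M G X = (SOME \<kappa>. is_rcd M G X \<kappa>)"

definition incr :: "(nat \<Rightarrow> 'w \<Rightarrow> real^'d) \<Rightarrow> nat \<Rightarrow> 'w \<Rightarrow> real^'d" where
  "incr S t \<omega> = S t \<omega> - S (t - 1) \<omega>"

definition Dset :: "'w measure \<Rightarrow> (nat \<Rightarrow> 'w measure) \<Rightarrow> (nat \<Rightarrow> 'w \<Rightarrow> real^'d)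
    \<Rightarrow> nat \<Rightarrow> 'w \<Rightarrow> (real^'d) set" where
  "Dset M F S t \<omega> = affine hull (measure_support (rcd M (F (t - 1)) (incr S t) \<omega>))"

definition wealth :: "nat \<Rightarrow> (nat \<Rightarrow> 'w \<Rightarrow> real^'d) \<Rightarrow> real
    \<Rightarrow> (nat \<Rightarrow> 'w \<Rightarrow> real^'d) \<Rightarrow> 'w \<Rightarrow> real" where
  "wealth t S w \<phi> \<omega> = w + (\<Sum>s\<in>{1..t}. \<phi> s \<omega> \<bullet> incr S s \<omega>)"

definition strategies :: "(nat \<Rightarrow> 'w measure) \<Rightarrow> nat \<Rightarrow> (nat \<Rightarrow> 'w \<Rightarrow> real^'d) set" where
  "strategies F T = {\<phi>. \<forall>t\<in>{1..T}. \<phi> t \<in> borel_measurable (F (t - 1))}"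

definition NA :: "'w measure \<Rightarrow> (nat \<Rightarrow> 'w measure) \<Rightarrow> nat \<Rightarrow> (nat \<Rightarrow> 'w \<Rightarrow> real^'d) \<Rightarrow> bool" where
  "NA M F T S \<longleftrightarrow> (\<forall>\<phi>\<in>strategies F T.
      (AE \<omega> in M. 0 \<le> wealth T S 0 \<phi> \<omega>) \<longrightarrow> (AE \<omega> in M. wealth T S 0 \<phi> \<omega> = 0))"

definition Sstar :: "'w measure \<Rightarrow> (nat \<Rightarrow> 'w measure) \<Rightarrow> nat \<Rightarrow> (nat \<Rightarrow> 'w \<Rightarrow> real^'d) set
    \<Rightarrow> (nat \<Rightarrow> 'w \<Rightarrow> real^'d) set" where
  "Sstar M F T SS = {S'\<in>SS. NA M F T S' \<and>
      (\<forall>S\<in>SS. \<forall>t\<in>{1..T}. AE \<omega> in M. Dset M F S t \<omega> \<subseteq> Dset M F S' t \<omega>)}"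

definition ext_expectation :: "'w measure \<Rightarrow> ('w \<Rightarrow> real) \<Rightarrow> ereal" where
  "ext_expectation M X =
     (let p = (\<integral>\<^sup>+\<omega>. ennreal (max 0 (X \<omega>)) \<partial>M);
          n = (\<integral>\<^sup>+\<omega>. ennreal (max 0 (- X \<omega>)) \<partial>M)
      in if p = \<infinity> \<and> n = \<infinity> then - \<infinity> else enn2ereal p - enn2ereal n)"

definition value_fn :: "'w measure \<Rightarrow> (nat \<Rightarrow> 'w measure) \<Rightarrow> nat \<Rightarrow> (nat \<Rightarrow> 'w \<Rightarrow> real^'d) set
    \<Rightarrow> (real \<Rightarrow> real) \<Rightarrow> real \<Rightarrow> ereal" where
  "value_fn M F T SS U w0 =
     (SUP \<phi>\<in>strategies F T. INF S\<in>SS. ext_expectation M (\<lambda>\<omega>. U (wealth T S w0 \<phi> \<omega>)))"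

end

theory Submission
  imports Defs
begin

text \<open>
  Write \<open>l = C - U \<ge> 0\<close>, a finite convex loss. A strategy is optimal iff it minimises the worst
  case expected loss over all price processes. If \<open>U\<close> is not constant, a bound on the loss under
  the reference process \<open>S\<^sup>*\<close> bounds the expected shortfall of its terminal wealth, and no
  arbitrage turns this into weighted \<open>L\<^sup>1\<close> bounds on the wealth \<open>W\<^sub>t\<close> at every date, uniformly
  over strategies. Among strategies of almost optimal loss choose near-minimisers of the strictly
  convex functional \<open>\<Sum>\<^sub>t E[\<eta>\<^sub>t \<surd>(1 + W\<^sub>t\<^sup>2)]\<close>: since the constraint sets are convex, their
  midpoint defects vanish, so along a subsequence the wealths \<open>W\<^sub>t\<close> converge almost surely.
  The vectors along which the holdings converge form a linear space, which therefore contains the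
  conditional support of \<open>\<Delta>S\<^sup>*\<^sub>t\<close>, hence that of the increments of every other price process. This
  yields a limit strategy for all price processes at once, and Fatou's lemma shows that it is
  optimal.
\<close>

section \<open>Measurable selection and sublinear functionals\<close>

text \<open>A bound on the loss controls wealth, never holdings: with redundant assets the holdings
  may explode in directions that do not move the wealth. Compactness is therefore sought for the
  wealth of the single process \<open>S\<close>, whose market is free of arbitrage; the other
  processes may admit arbitrage and give no bounds at all. They enter through \<open>Dset\<close>,
  once convergence has been secured. A limit strategy must be right for almost every possible
  increment, not merely for the realised one, which is why the argument works with conditional
  distributions. Since \<open>rcd\<close> is a choice, existence has to be proved before
  \<open>Dset\<close> means anything; and since facts found pointwise in a kernel must come back as
  predictable strategies, measurable selection is needed throughout. No moments of the increments
  are assumed, hence the many strictly positive weights. The limit is taken along an ordinary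
  subsequence: the strictly convex penalty replaces the usual passage to convex combinations of the
  tail.\<close>

lemma dense_sequence_exists:
  obtains d :: "nat \<Rightarrow> 'a::{metric_space, second_countable_topology}"
  where "\<And>X. open X \<Longrightarrow> X \<noteq> {} \<Longrightarrow> \<exists>i. d i \<in> X"
proof -
  obtain D :: "'a set" where D: "countable D" "\<And>X. open X \<Longrightarrow> X \<noteq> {} \<Longrightarrow> \<exists>d\<in>D. d \<in> X"
    using countable_dense_setE by blast
  have "D \<noteq> {}" using D(2)[of UNIV] by auto
  then have "range (from_nat_into D) = D" using D(1) by (simp add: range_from_nat_into)
  then show thesis using D(2) that[of "from_nat_into D"] by (metis imageE)
qed

text \<open>A zero has to be searched among uncountably many points. Small values along a dense
  sequence are enough: inside a slightly smaller closed ball they force the minimum, attained by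
  compactness, to be zero. The slack \<open>1 / Suc k\<close> shrinks the open ball to a compact one
  that still has the given zero in its interior.\<close>

lemma pred_zero_in_ball:
  fixes Q :: "'w \<Rightarrow> 'a::euclidean_space \<Rightarrow> real"
  assumes Qm[measurable]: "\<And>v. (\<lambda>\<omega>. Q \<omega> v) \<in> borel_measurable G"
    and Qc: "\<And>\<omega>. \<omega> \<in> space G \<Longrightarrow> continuous_on UNIV (Q \<omega>)"
    and Qn: "\<And>\<omega> v. \<omega> \<in> space G \<Longrightarrow> 0 \<le> Q \<omega> v"
  shows "Measurable.pred G (\<lambda>\<omega>. \<exists>z. Q \<omega> z = 0 \<and> dist v z < r)"
proof -
  obtain d :: "nat \<Rightarrow> 'a" where d: "\<And>X. open X \<Longrightarrow> X \<noteq> {} \<Longrightarrow> \<exists>i. d i \<in> X"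
    using dense_sequence_exists by blast
  have "(\<exists>z. Q \<omega> z = 0 \<and> dist v z < r) \<longleftrightarrow>
    (\<exists>k::nat. \<forall>n::nat. \<exists>j. dist v (d j) < r - 1 / Suc k \<and> Q \<omega> (d j) < 1 / Suc n)"
    if w: "\<omega> \<in> space G" for \<omega>
  proof
    assume "\<exists>z. Q \<omega> z = 0 \<and> dist v z < r"
    then obtain z where z: "Q \<omega> z = 0" "dist v z < r" by blast
    obtain k :: nat where k: "1 / Suc k < r - dist v z"
      using z(2) by (metis diff_gt_0_iff_gt nat_approx_posE)
    have "\<exists>j. dist v (d j) < r - 1 / Suc k \<and> Q \<omega> (d j) < 1 / Suc n" for n
    proof -
      let ?X = "ball v (r - 1 / Suc k) \<inter> {x. Q \<omega> x < 1 / Suc n}"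
      have "open ?X"
        by (intro open_Int open_ball open_Collect_less Qc w continuous_on_const)
      moreover have "z \<in> ?X" using z k by auto
      ultimately obtain j where "d j \<in> ?X" using d by blast
      then show ?thesis by auto
    qed
    then show "\<exists>k::nat. \<forall>n::nat. \<exists>j. dist v (d j) < r - 1 / Suc k \<and> Q \<omega> (d j) < 1 / Suc n"
      by blast
  next
    assume "\<exists>k::nat. \<forall>n::nat. \<exists>j. dist v (d j) < r - 1 / Suc k \<and> Q \<omega> (d j) < 1 / Suc n"
    then obtain k :: nat
      where k: "\<And>n::nat. \<exists>j. dist v (d j) < r - 1 / Suc k \<and> Q \<omega> (d j) < 1 / Suc n" by blast
    let ?K = "cball v (r - 1 / Suc k)"
    obtain j0 where "dist v (d j0) < r - 1 / Suc k" using k[of 0] by blast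
    then have "d j0 \<in> ?K" unfolding mem_cball by (rule less_imp_le)
    then have "?K \<noteq> {}" by blast
    then obtain z where z: "z \<in> ?K" "\<And>y. y \<in> ?K \<Longrightarrow> Q \<omega> z \<le> Q \<omega> y"
      using continuous_attains_inf[of ?K "Q \<omega>"] continuous_on_subset[OF Qc[OF w] subset_UNIV] compact_cball
      by blast
    have "Q \<omega> z = 0"
    proof (rule ccontr)
      assume "Q \<omega> z \<noteq> 0"
      then have "0 < Q \<omega> z" using Qn[OF w, of z] by simp
      then obtain n :: nat where n: "1 / Suc n < Q \<omega> z" by (metis nat_approx_posE)
      obtain j where "dist v (d j) < r - 1 / Suc k" "Q \<omega> (d j) < 1 / Suc n" using k by blast
      then show False using z(2)[of "d j"] n by auto
    qed
    moreover have "dist v z < r"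
    proof -
      have "0 < 1 / real (Suc k)" by simp
      then show ?thesis using z(1) unfolding mem_cball by linarith
    qed
    ultimately show "\<exists>z. Q \<omega> z = 0 \<and> dist v z < r" by blast
  qed
  then show ?thesis
    by (subst measurable_cong) measurable
qed

text \<open>The Kuratowski--Ryll-Nardzewski selection scheme, applied to the zero sets of a
  Caratheodory function.\<close>

lemma measurable_zero_selection:
  fixes Q :: "'w \<Rightarrow> 'a::euclidean_space \<Rightarrow> real"
  assumes Qm[measurable]: "\<And>v. (\<lambda>\<omega>. Q \<omega> v) \<in> borel_measurable G"
    and Qc: "\<And>\<omega>. \<omega> \<in> space G \<Longrightarrow> continuous_on UNIV (Q \<omega>)"
    and Qn: "\<And>\<omega> v. \<omega> \<in> space G \<Longrightarrow> 0 \<le> Q \<omega> v"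
  obtains s where "s \<in> borel_measurable G"
    and "\<And>\<omega> v. \<omega> \<in> space G \<Longrightarrow> Q \<omega> v = 0 \<Longrightarrow> Q \<omega> (s \<omega>) = 0"
proof -
  obtain d :: "nat \<Rightarrow> 'a" where d: "\<And>X. open X \<Longrightarrow> X \<noteq> {} \<Longrightarrow> \<exists>i. d i \<in> X"
    using dense_sequence_exists by blast
  define near where "near \<omega> v r \<longleftrightarrow> (\<exists>z. Q \<omega> z = 0 \<and> dist v z < r)" for \<omega> v r
  have near_meas[measurable]: "Measurable.pred G (\<lambda>\<omega>. near \<omega> v r)" for v r
    unfolding near_def by (rule pred_zero_in_ball[OF Qm Qc Qn])
  \<comment> \<open>\<open>I m\<close> indexes a dense point within \<open>(1/2)^m\<close> of a
    zero. Restricting the next search to points near the previous one makes the centres Cauchy; the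
    factor 2 covers the sum \<open>(1/2)^Suc m + (1/2)^m\<close> from the triangle inequality. Least
    indices keep the choice measurable.\<close>
  define I where "I = rec_nat (\<lambda>\<omega>. LEAST i. near \<omega> (d i) 1)
    (\<lambda>m J \<omega>. LEAST i. near \<omega> (d i) ((1/2)^Suc m) \<and> dist (d i) (d (J \<omega>)) < 2 * (1/2)^m)"
  have I0: "I 0 = (\<lambda>\<omega>. LEAST i. near \<omega> (d i) 1)"
    and IS: "I (Suc m) = (\<lambda>\<omega>. LEAST i. near \<omega> (d i) ((1/2)^Suc m) \<and>
      dist (d i) (d (I m \<omega>)) < 2 * (1/2)^m)" for m
    by (simp_all add: I_def)
  have I_meas[measurable]: "I m \<in> measurable G (count_space UNIV)" for m
  proof (induction m)
    case 0 then show ?case unfolding I0 by measurable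
  next
    case (Suc m)
    note Suc[measurable]
    show ?case unfolding IS by measurable
  qed
  \<comment> \<open>\<open>lim\<close> is a total and measurable operation; where
    \<open>Q \<omega>\<close> has no zero its value is arbitrary, and nothing is claimed
    there.\<close>
  define s where "s \<omega> = lim (\<lambda>m. d (I m \<omega>))" for \<omega>
  show thesis
  proof
    show "s \<in> borel_measurable G" unfolding s_def by measurable
    fix \<omega> v assume w: "\<omega> \<in> space G" and v: "Q \<omega> v = 0"
    have approx: "\<exists>i. near \<omega> (d i) e \<and> dist (d i) x < e + e'"
      if nr: "near \<omega> x e'" and "e > 0" for x e e'
    proof -
      obtain z where z: "Q \<omega> z = 0" "dist x z < e'" using nr unfolding near_def by blast
      obtain i where i: "d i \<in> ball z e" using d[of "ball z e"] \<open>e > 0\<close> by auto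
      have "near \<omega> (d i) e" unfolding near_def using z(1) i by (auto simp: dist_commute)
      moreover have "dist (d i) x < e + e'"
        using i z(2) dist_triangle[of "d i" x z] by (auto simp: dist_commute)
      ultimately show ?thesis by blast
    qed
    have near_I: "near \<omega> (d (I m \<omega>)) ((1/2)^m)" for m
    proof (induction m)
      case 0
      have "near \<omega> v 1" unfolding near_def using v by auto
      from approx[OF this, of 1] have "\<exists>i. near \<omega> (d i) 1" by auto
      then show ?case unfolding I0 by (auto intro: LeastI_ex)
    next
      case (Suc m)
      have "\<exists>i. near \<omega> (d i) ((1/2)^Suc m) \<and> dist (d i) (d (I m \<omega>)) < (1/2)^Suc m + (1/2)^m"
        by (rule approx[OF Suc]) simp
      moreover have "(1/2::real)^Suc m + (1/2)^m \<le> 2 * (1/2)^m" by simp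
      ultimately have "\<exists>i. near \<omega> (d i) ((1/2)^Suc m) \<and> dist (d i) (d (I m \<omega>)) < 2 * (1/2)^m"
        by (meson order_less_le_trans)
      from LeastI_ex[OF this] show ?case unfolding IS by blast
    qed
    have step: "dist (d (I (Suc m) \<omega>)) (d (I m \<omega>)) < 2 * (1/2)^m" for m
    proof -
      have "\<exists>i. near \<omega> (d i) ((1/2)^Suc m) \<and> dist (d i) (d (I m \<omega>)) < (1/2)^Suc m + (1/2)^m"
        by (rule approx[OF near_I]) simp
      moreover have "(1/2::real)^Suc m + (1/2)^m \<le> 2 * (1/2)^m" by simp
      ultimately have "\<exists>i. near \<omega> (d i) ((1/2)^Suc m) \<and> dist (d i) (d (I m \<omega>)) < 2 * (1/2)^m"
        by (meson order_less_le_trans)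
      from LeastI_ex[OF this] show ?thesis unfolding IS by blast
    qed
    have "summable (\<lambda>m. d (I (Suc m) \<omega>) - d (I m \<omega>))"
      by (rule summable_comparison_test'[where g="\<lambda>m. 2 * (1/2::real)^m" and N=0])
         (use step in \<open>auto simp: dist_norm less_imp_le intro!: summable_mult summable_geometric\<close>)
    then have "convergent (\<lambda>n. d (I n \<omega>) - d (I 0 \<omega>))"
      using sum_lessThan_telescope[of "\<lambda>m. d (I m \<omega>)"] by (simp add: summable_iff_convergent)
    from convergent_add[OF this convergent_const[of "d (I 0 \<omega>)"]]
    have "convergent (\<lambda>m. d (I m \<omega>))" by simp
    then have lim: "(\<lambda>m. d (I m \<omega>)) \<longlonglongrightarrow> s \<omega>" unfolding s_def by (simp add: convergent_LIMSEQ_iff)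
    obtain z where z: "\<And>m. Q \<omega> (z m) = 0" "\<And>m. dist (d (I m \<omega>)) (z m) < (1/2)^m"
      using near_I unfolding near_def by metis
    have "(\<lambda>m. dist (d (I m \<omega>)) (z m)) \<longlonglongrightarrow> 0"
    proof (rule tendsto_sandwich[OF _ _ tendsto_const])
      show "(\<lambda>m. (1/2::real)^m) \<longlonglongrightarrow> 0" by (intro LIMSEQ_realpow_zero) auto
    qed (use z(2) in \<open>auto intro!: always_eventually simp: less_imp_le\<close>)
    then have "z \<longlonglongrightarrow> s \<omega>"
      by (intro Lim_transform2[OF lim]) (simp add: dist_norm tendsto_norm_zero_iff)
    then have "(\<lambda>m. Q \<omega> (z m)) \<longlonglongrightarrow> Q \<omega> (s \<omega>)"
      by (rule continuous_on_tendsto_compose[OF Qc[OF w]]) auto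
    then show "Q \<omega> (s \<omega>) = 0" using z(1) by (simp add: LIMSEQ_const_iff)
  qed
qed

text \<open>Interchanges quantifiers: an almost sure statement for each measurable \<open>h\<close>,
  with an exceptional set depending on \<open>h\<close>, becomes one for all vectors outside a
  single null set. If it failed, a measurable selection of counterexamples would itself be an
  admissible \<open>h\<close>.\<close>

lemma AE_zero_implies_zero:
  fixes Q1 Q2 :: "'w \<Rightarrow> 'a::euclidean_space \<Rightarrow> real"
  assumes sub: "subalgebra M G"
    and Q1m[measurable]: "\<And>v. (\<lambda>\<omega>. Q1 \<omega> v) \<in> borel_measurable G"
    and Q1c: "\<And>\<omega>. \<omega> \<in> space G \<Longrightarrow> continuous_on UNIV (Q1 \<omega>)"
    and Q1n: "\<And>\<omega> v. \<omega> \<in> space G \<Longrightarrow> 0 \<le> Q1 \<omega> v"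
    and Q10: "\<And>\<omega>. \<omega> \<in> space G \<Longrightarrow> Q1 \<omega> 0 = 0"
    and Q2m[measurable]: "\<And>v. (\<lambda>\<omega>. Q2 \<omega> v) \<in> borel_measurable G"
    and Q2c: "\<And>\<omega>. \<omega> \<in> space G \<Longrightarrow> continuous_on UNIV (Q2 \<omega>)"
    and Q2n: "\<And>\<omega> v. \<omega> \<in> space G \<Longrightarrow> 0 \<le> Q2 \<omega> v"
    and imp: "\<And>h. h \<in> borel_measurable G \<Longrightarrow> (\<forall>\<omega>\<in>space G. Q1 \<omega> (h \<omega>) = 0)
      \<Longrightarrow> AE \<omega> in M. Q2 \<omega> (h \<omega>) = 0"
  shows "AE \<omega> in M. \<forall>v. Q1 \<omega> v = 0 \<longrightarrow> Q2 \<omega> v = 0"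
proof -
  have spG: "space G = space M" using sub by (simp add: subalgebra_def)
  have "AE \<omega> in M. \<forall>v. Q1 \<omega> v = 0 \<longrightarrow> Q2 \<omega> v < 1 / Suc k" for k :: nat
  proof -
    \<comment> \<open>The zeros of \<open>Q \<omega>\<close> are exactly the counterexamples at
      level \<open>1 / Suc k\<close>: both summands are nonnegative, so both must vanish. Countably
      many levels exhaust the condition \<open>Q2 \<omega> v > 0\<close>.\<close>
    define Q where "Q \<omega> v = Q1 \<omega> v + max 0 (1 / Suc k - Q2 \<omega> v)" for \<omega> v
    have Qm: "(\<lambda>\<omega>. Q \<omega> v) \<in> borel_measurable G" for v unfolding Q_def by measurable
    have Qc: "continuous_on UNIV (Q \<omega>)" if "\<omega> \<in> space G" for \<omega>
      unfolding Q_def by (intro continuous_intros Q1c Q2c that)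
    have Qn: "0 \<le> Q \<omega> v" if "\<omega> \<in> space G" for \<omega> v
      unfolding Q_def using Q1n[OF that, of v] by simp
    obtain s where s[measurable]: "s \<in> borel_measurable G"
      and s0: "\<And>\<omega> v. \<omega> \<in> space G \<Longrightarrow> Q \<omega> v = 0 \<Longrightarrow> Q \<omega> (s \<omega>) = 0"
      using measurable_zero_selection[OF Qm Qc Qn] by blast
    have ball: "Measurable.pred G (\<lambda>\<omega>. \<exists>z. Q \<omega> z = 0 \<and> dist 0 z < real r)" for r :: nat
      by (rule pred_zero_in_ball[OF Qm Qc Qn])
    have ex_eq: "(\<exists>z. Q \<omega> z = 0) \<longleftrightarrow> (\<exists>r::nat. \<exists>z. Q \<omega> z = 0 \<and> dist 0 z < real r)" for \<omega>
      using reals_Archimedean2 by blast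
    have ex[measurable]: "Measurable.pred G (\<lambda>\<omega>. \<exists>z. Q \<omega> z = 0)"
      unfolding ex_eq using ball by measurable
    \<comment> \<open>Where there is no counterexample, the fallback 0 keeps \<open>h\<close> in the
      zero set of \<open>Q1\<close>, as \<open>imp\<close> demands at every point.\<close>
    define h where "h \<omega> = (if \<exists>z. Q \<omega> z = 0 then s \<omega> else 0)" for \<omega>
    have hm: "h \<in> borel_measurable G" unfolding h_def by measurable
    have split: "Q1 \<omega> v = 0 \<and> 1 / Suc k \<le> Q2 \<omega> v" if "\<omega> \<in> space G" "Q \<omega> v = 0" for \<omega> v
      using that(2) Q1n[OF that(1), of v] unfolding Q_def by (auto simp: max_def split: if_splits)
    have "Q1 \<omega> (h \<omega>) = 0" if w: "\<omega> \<in> space G" for \<omega>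
    proof (cases "\<exists>z. Q \<omega> z = 0")
      case True
      then have "Q \<omega> (s \<omega>) = 0" using s0[OF w] by blast
      then show ?thesis using split[OF w] True by (simp add: h_def)
    next
      case False
      then show ?thesis using Q10[OF w] by (simp add: h_def)
    qed
    then have "\<forall>\<omega>\<in>space G. Q1 \<omega> (h \<omega>) = 0" by blast
    from imp[OF hm this] have "AE \<omega> in M. Q2 \<omega> (h \<omega>) = 0" .
    with AE_space[of M] show ?thesis
    proof eventually_elim
      case (elim \<omega>)
      show ?case
      proof safe
        fix v assume v: "Q1 \<omega> v = 0"
        show "Q2 \<omega> v < 1 / Suc k"
        proof (rule ccontr)
          assume "\<not> Q2 \<omega> v < 1 / Suc k"
          then have "Q \<omega> v = 0" unfolding Q_def using v by simp
          then have "Q \<omega> (s \<omega>) = 0" "h \<omega> = s \<omega>" using s0 elim spG unfolding h_def by auto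
          then have "1 / real (Suc k) \<le> 0" using split[of \<omega> "s \<omega>"] elim spG by simp
          moreover have "0 < 1 / real (Suc k)" by simp
          ultimately show False by linarith
        qed
      qed
    qed
  qed
  then have "AE \<omega> in M. \<forall>k. \<forall>v. Q1 \<omega> v = 0 \<longrightarrow> Q2 \<omega> v < 1 / Suc k"
    by (simp add: AE_all_countable)
  with AE_space[of M] show ?thesis
  proof eventually_elim
    case (elim \<omega>)
    show ?case
    proof safe
      fix v assume "Q1 \<omega> v = 0"
      then have "\<And>k. Q2 \<omega> v < 1 / Suc k" using elim by blast
      then show "Q2 \<omega> v = 0" using Q2n[of \<omega> v] elim spG
        by (metis less_eq_real_def nat_approx_posE order_less_asym)
    qed
  qed
qed

text \<open>Both functionals vanish on the null space \<open>L\<close> of \<open>q2\<close>: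
  \<open>le\<close> gives this for \<open>q1\<close>, and the symmetry of \<open>q2\<close> makes
  \<open>L\<close> linear although \<open>q1\<close> is only positively homogeneous. Passing to the
  component orthogonal to \<open>L\<close> neither raises \<open>q1\<close> nor lowers
  \<open>q2\<close>, so the comparison reduces to a compact unit sphere on which \<open>q1\<close>
  is positive.\<close>

lemma sublinear_dominates_seminorm:
  fixes q1 q2 :: "'a::euclidean_space \<Rightarrow> real"
  assumes c1: "continuous_on UNIV q1" and c2: "continuous_on UNIV q2"
    and n1: "\<And>v. 0 \<le> q1 v"
    and h1: "\<And>r v. 0 \<le> r \<Longrightarrow> q1 (r *\<^sub>R v) = r * q1 v"
    and s1: "\<And>u v. q1 (u + v) \<le> q1 u + q1 v"
    and h2: "\<And>r v. q2 (r *\<^sub>R v) = \<bar>r\<bar> * q2 v"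
    and s2: "\<And>u v. q2 (u + v) \<le> q2 u + q2 v"
    and le: "\<And>v. q1 v \<le> 2 * q2 v"
    and zero: "\<And>v. q1 v = 0 \<Longrightarrow> q2 v = 0"
  obtains c where "0 < c" "\<And>v. c * q2 v \<le> q1 v"
proof -
  have n2: "0 \<le> q2 v" for v using n1[of v] le[of v] by linarith
  have q1_0_iff: "q1 v = 0 \<longleftrightarrow> q2 v = 0" for v using zero[of v] le[of v] n1[of v] by auto
  define L where "L = {v. q2 v = 0}"
  have L: "subspace L"
    unfolding subspace_def L_def
    using h2[of 0 0] h2 s2 n2 by (auto intro: antisym) (metis add.right_neutral antisym)
  define K where "K = {v. norm v = 1 \<and> (\<forall>x\<in>L. orthogonal v x)}"
  have "K = sphere 0 1 \<inter> {y. \<forall>x\<in>L. orthogonal x y}" by (auto simp: K_def orthogonal_commute)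
  then have "compact K"
    by (simp add: compact_Int_closed closed_subspace subspace_orthogonal_to_vectors)
  show thesis
  proof (cases "K = {}")
    case True
    have "q2 v = 0" for v
    proof (rule ccontr)
      assume v: "q2 v \<noteq> 0"
      obtain x y where xy: "x \<in> span L" "\<And>w. w \<in> span L \<Longrightarrow> orthogonal y w" "v = x + y"
        using orthogonal_subspace_decomp_exists[of L v] by blast
      have "y \<noteq> 0"
        using v xy L by (auto simp: L_def span_eq_iff[THEN iffD2, OF L])
           (metis (mono_tags) L L_def mem_Collect_eq span_eq_iff)
      then have "y /\<^sub>R norm y \<in> K"
        unfolding K_def using xy(2) by (auto simp: orthogonal_clauses span_base)
      then show False using True by blast
    qed
    then show thesis using that[of 1] n1 by simp
  next
    case False
    obtain a where a: "a \<in> K" "\<And>v. v \<in> K \<Longrightarrow> q1 a \<le> q1 v"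
      using continuous_attains_inf[OF \<open>compact K\<close> False] continuous_on_subset[OF c1] by blast
    obtain b where b: "b \<in> K" "\<And>v. v \<in> K \<Longrightarrow> q2 v \<le> q2 b"
      using continuous_attains_sup[OF \<open>compact K\<close> False] continuous_on_subset[OF c2] by blast
    have KL: "v \<notin> L" if "v \<in> K" for v
      using that unfolding K_def by (metis (mono_tags, lifting) mem_Collect_eq norm_zero orthogonal_self zero_neq_one)
    have pa: "q1 a > 0" using KL[OF a(1)] n1[of a] unfolding L_def q1_0_iff[symmetric] by auto
    have pb: "q2 b > 0" using KL[OF b(1)] n2[of b] unfolding L_def by auto
    have "q1 a / q2 b * q2 v \<le> q1 v" for v
    proof -
      obtain x y where xy: "x \<in> span L" "\<And>w. w \<in> span L \<Longrightarrow> orthogonal y w" "v = x + y"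
        using orthogonal_subspace_decomp_exists[of L v] by blast
      have x: "x \<in> L" using xy(1) L by (metis span_eq_iff)
      then have "q2 x = 0" "q2 (-x) = 0" using h2[of "-1" x] by (auto simp: L_def)
      then have x0: "q2 x = 0" "q1 (-x) = 0" by (simp_all add: q1_0_iff)
      have "q2 v \<le> q2 y" using s2[of x y] x0 xy(3) by simp
      moreover have "q1 y \<le> q1 v" using s1[of v "-x"] x0 xy(3) by simp
      moreover have "q1 a / q2 b * q2 y \<le> q1 y"
      proof (cases "y = 0")
        case True
        then show ?thesis using h2[of 0 0] n1[of 0] by simp
      next
        case False
        let ?u = "y /\<^sub>R norm y"
        have u: "?u \<in> K" unfolding K_def using xy(2) False by (auto simp: orthogonal_clauses span_base)
        have y: "y = norm y *\<^sub>R ?u" using False by simp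
        have "q2 y = norm y * q2 ?u" "q1 y = norm y * q1 ?u"
          using h2[of "norm y" ?u] h1[of "norm y" ?u] y by auto
        moreover have "q1 a / q2 b * q2 ?u \<le> q1 ?u"
        proof -
          have "q1 a / q2 b * q2 ?u \<le> q1 a / q2 b * q2 b"
            using b(2)[OF u] pa pb by (intro mult_left_mono) auto
          then show ?thesis using a(2)[OF u] pb by simp
        qed
        ultimately show ?thesis
          by (metis mult.left_commute mult_left_mono norm_ge_zero)
      qed
      ultimately show ?thesis
        using pa pb by (meson divide_nonneg_pos less_imp_le mult_left_mono order_trans)
    qed
    then show thesis using that[of "q1 a / q2 b"] pa pb by simp
  qed
qed

section \<open>Regular conditional distributions\<close>

lemma is_rcd_kernel:
  assumes "subalgebra M G" "is_rcd M G X \<kappa>"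
  shows "\<kappa> \<in> measurable G (subprob_algebra borel)"
  using assms unfolding is_rcd_def subalgebra_def
  by (intro measurable_subprob_algebra) (auto intro: prob_space_imp_subprob_space)

text \<open>The defining identity of \<open>is_rcd\<close> says that the joint law of the identity
  and \<open>X\<close> agrees on rectangles with the law built from \<open>M\<close> and the kernel,
  and rectangles form an intersection-stable generator. The first factor carries \<open>G\<close>
  rather than \<open>M\<close>, because the identity covers only \<open>A\<close> in
  \<open>sets G\<close>.\<close>

lemma is_rcd_nn_integral:
  fixes X :: "'w \<Rightarrow> 'v::topological_space"
  assumes "finite_measure M" and sub: "subalgebra M G" and ne: "space M \<noteq> {}"
    and X[measurable]: "X \<in> borel_measurable M"
    and rcd: "is_rcd M G X \<kappa>"
    and g[measurable]: "g \<in> borel_measurable (G \<Otimes>\<^sub>M borel)"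
  shows "(\<integral>\<^sup>+\<omega>. g (\<omega>, X \<omega>) \<partial>M) = (\<integral>\<^sup>+\<omega>. (\<integral>\<^sup>+x. g (\<omega>, x) \<partial>\<kappa> \<omega>) \<partial>M)"
proof -
  interpret finite_measure M by fact
  have spG: "space G = space M" and stG: "sets G \<subseteq> sets M" using sub by (auto simp: subalgebra_def)
  have idm[measurable]: "(\<lambda>\<omega>. \<omega>) \<in> measurable M G"
    using spG stG by (auto simp: measurable_def intro: sets.Int_space_eq2)
  note k[measurable] = is_rcd_kernel[OF sub rcd]
  have ps: "prob_space (\<kappa> \<omega>)" and sk: "sets (\<kappa> \<omega>) = sets borel" if "\<omega> \<in> space M" for \<omega>
    using rcd that by (auto simp: is_rcd_def)
  let ?N = "G \<Otimes>\<^sub>M (borel :: 'v measure)"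
  define \<nu>1 where "\<nu>1 = distr M ?N (\<lambda>\<omega>. (\<omega>, X \<omega>))"
  define K where "K \<omega> = distr (\<kappa> \<omega>) ?N (Pair \<omega>)" for \<omega>
  have KG: "K \<in> measurable G (subprob_algebra ?N)"
    unfolding K_def by (rule measurable_distr2[where f=Pair and M=borel]) measurable
  then have K: "K \<in> measurable M (subprob_algebra ?N)"
    by (rule measurable_compose[OF idm])
  define \<nu>2 where "\<nu>2 = M \<bind> K"
  have "\<nu>1 = \<nu>2"
  proof (rule measure_eqI_generator_eq[OF Int_stable_pair_measure_generator[of G "borel::'v measure"],
        where \<Omega>="space ?N" and A="\<lambda>i. space G \<times> UNIV"])
    show "{a \<times> b |a b. a \<in> sets G \<and> b \<in> sets (borel::'v measure)} \<subseteq> Pow (space ?N)"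
      using sets.sets_into_space by (auto simp: space_pair_measure)
    show "sets \<nu>1 = sigma_sets (space ?N) {a \<times> b |a b. a \<in> sets G \<and> b \<in> sets (borel::'v measure)}"
      by (simp add: \<nu>1_def sets_pair_measure space_pair_measure)
    show "sets \<nu>2 = sigma_sets (space ?N) {a \<times> b |a b. a \<in> sets G \<and> b \<in> sets (borel::'v measure)}"
      unfolding \<nu>2_def sets_bind_measurable[OF K ne] by (simp add: sets_pair_measure space_pair_measure)
    show "range (\<lambda>i. space G \<times> UNIV) \<subseteq> {a \<times> b |a b. a \<in> sets G \<and> b \<in> sets (borel::'v measure)}"
      by (force intro: exI[of _ "space G"])
    show "(\<Union>i. space G \<times> UNIV) = space ?N" by (simp add: space_pair_measure)
    show "emeasure \<nu>1 (space G \<times> UNIV) \<noteq> \<infinity>" for i :: nat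
      unfolding \<nu>1_def by (subst emeasure_distr) auto
    fix E :: "('w \<times> 'v) set" assume "E \<in> {a \<times> b |a b. a \<in> sets G \<and> b \<in> sets borel}"
    then obtain A B where E: "E = A \<times> B" and A[measurable]: "A \<in> sets G" and B[measurable]: "B \<in> sets borel"
      by blast
    have "emeasure \<nu>1 E = emeasure M (A \<inter> (X -` B \<inter> space M))"
      unfolding \<nu>1_def E by (subst emeasure_distr) (auto intro!: arg_cong[where f="emeasure M"])
    also have "\<dots> = (\<integral>\<^sup>+\<omega>. emeasure (\<kappa> \<omega>) B * indicator A \<omega> \<partial>M)"
      using rcd A B unfolding is_rcd_def by blast
    also have "\<dots> = (\<integral>\<^sup>+\<omega>. emeasure (K \<omega>) E \<partial>M)"
    proof (rule nn_integral_cong)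
      fix \<omega> assume w: "\<omega> \<in> space M"
      have "Pair \<omega> \<in> measurable (\<kappa> \<omega>) ?N"
        using w spG by (subst measurable_cong_sets[OF sk[OF w] refl]) simp
      then have "emeasure (K \<omega>) E = emeasure (\<kappa> \<omega>) (Pair \<omega> -` E \<inter> space (\<kappa> \<omega>))"
        unfolding K_def E by (subst emeasure_distr) auto
      also have "Pair \<omega> -` E \<inter> space (\<kappa> \<omega>) = (if \<omega> \<in> A then B else {})"
        using sets_eq_imp_space_eq[OF sk[OF w]] by (auto simp: E)
      finally show "emeasure (\<kappa> \<omega>) B * indicator A \<omega> = emeasure (K \<omega>) E" by simp
    qed
    also have "\<dots> = emeasure \<nu>2 E"
      unfolding \<nu>2_def by (rule emeasure_bind[OF ne K, symmetric]) (simp add: E)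
    finally show "emeasure \<nu>1 E = emeasure \<nu>2 E" .
  qed
  have "(\<integral>\<^sup>+\<omega>. g (\<omega>, X \<omega>) \<partial>M) = (\<integral>\<^sup>+z. g z \<partial>\<nu>1)"
    unfolding \<nu>1_def by (subst nn_integral_distr) auto
  also have "\<dots> = (\<integral>\<^sup>+z. g z \<partial>\<nu>2)" by (simp add: \<open>\<nu>1 = \<nu>2\<close>)
  also have "\<dots> = (\<integral>\<^sup>+\<omega>. \<integral>\<^sup>+z. g z \<partial>K \<omega> \<partial>M)"
    unfolding \<nu>2_def by (rule nn_integral_bind[OF g K])
  also have "\<dots> = (\<integral>\<^sup>+\<omega>. (\<integral>\<^sup>+x. g (\<omega>, x) \<partial>\<kappa> \<omega>) \<partial>M)"
  proof (rule nn_integral_cong)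
    fix \<omega> assume w: "\<omega> \<in> space M"
    have "Pair \<omega> \<in> measurable (\<kappa> \<omega>) ?N"
      using w spG by (subst measurable_cong_sets[OF sk[OF w] refl]) simp
    then show "(\<integral>\<^sup>+z. g z \<partial>K \<omega>) = (\<integral>\<^sup>+x. g (\<omega>, x) \<partial>\<kappa> \<omega>)"
      unfolding K_def by (subst nn_integral_distr) auto
  qed
  finally show ?thesis .
qed

text \<open>Integrates the indicator of the failure of \<open>P\<close> in two ways. It is the
  bridge, used in both directions, between almost sure statements on the realised \<open>X\<close>
  and statements on almost every point of the conditional distribution.\<close>

lemma is_rcd_AE_iff:
  fixes X :: "'w \<Rightarrow> 'v::topological_space"
  assumes "finite_measure M" and sub: "subalgebra M G" and ne: "space M \<noteq> {}"
    and X[measurable]: "X \<in> borel_measurable M"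
    and rcd: "is_rcd M G X \<kappa>"
    and P[measurable]: "Measurable.pred (G \<Otimes>\<^sub>M borel) P"
  shows "(AE \<omega> in M. P (\<omega>, X \<omega>)) \<longleftrightarrow> (AE \<omega> in M. AE x in \<kappa> \<omega>. P (\<omega>, x))"
proof -
  have spG: "space G = space M" and stG: "sets G \<subseteq> sets M" using sub by (auto simp: subalgebra_def)
  have idm[measurable]: "(\<lambda>\<omega>. \<omega>) \<in> measurable M G"
    using spG stG by (auto simp: measurable_def intro: sets.Int_space_eq2)
  note kG = is_rcd_kernel[OF sub rcd]
  have k[measurable]: "\<kappa> \<in> measurable M (subprob_algebra borel)"
    using measurable_compose[OF idm kG] by simp
  have sk: "sets (\<kappa> \<omega>) = sets borel" if "\<omega> \<in> space M" for \<omega>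
    using rcd that by (auto simp: is_rcd_def)
  let ?g = "\<lambda>z. indicator {z. \<not> P z} z :: ennreal"
  have gm[measurable]: "?g \<in> borel_measurable (G \<Otimes>\<^sub>M borel)" by measurable
  have gm1: "(\<lambda>\<omega>. ?g (\<omega>, X \<omega>)) \<in> borel_measurable M"
    by (rule measurable_compose[OF _ gm]) measurable
  have gm2: "(\<lambda>\<omega>. \<integral>\<^sup>+x. ?g (\<omega>, x) \<partial>\<kappa> \<omega>) \<in> borel_measurable M"
  proof (rule measurable_compose[OF idm])
    show "(\<lambda>\<omega>. \<integral>\<^sup>+x. ?g (\<omega>, x) \<partial>\<kappa> \<omega>) \<in> borel_measurable G"
      by (rule nn_integral_measurable_subprob_algebra2[OF _ kG]) (simp add: case_prod_beta')
  qed
  have "(AE \<omega> in M. P (\<omega>, X \<omega>)) \<longleftrightarrow> (AE \<omega> in M. ?g (\<omega>, X \<omega>) = 0)"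
    by (intro AE_cong) (simp add: indicator_def)
  also have "\<dots> \<longleftrightarrow> (\<integral>\<^sup>+\<omega>. ?g (\<omega>, X \<omega>) \<partial>M) = 0"
    using nn_integral_0_iff_AE[OF gm1] by simp
  also have "\<dots> \<longleftrightarrow> (\<integral>\<^sup>+\<omega>. (\<integral>\<^sup>+x. ?g (\<omega>, x) \<partial>\<kappa> \<omega>) \<partial>M) = 0"
    using is_rcd_nn_integral[OF assms(1) sub ne X rcd gm] by simp
  also have "\<dots> \<longleftrightarrow> (AE \<omega> in M. (\<integral>\<^sup>+x. ?g (\<omega>, x) \<partial>\<kappa> \<omega>) = 0)"
    using nn_integral_0_iff_AE[OF gm2] by simp
  also have "\<dots> \<longleftrightarrow> (AE \<omega> in M. AE x in \<kappa> \<omega>. P (\<omega>, x))"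
  proof (rule AE_cong)
    fix \<omega> assume w: "\<omega> \<in> space M"
    have "(\<lambda>x. ?g (\<omega>, x)) \<in> borel_measurable (\<kappa> \<omega>)"
      using w spG by (subst measurable_cong_sets[OF sk[OF w] refl]) (rule measurable_compose[OF _ gm], simp)
    then show "(\<integral>\<^sup>+x. ?g (\<omega>, x) \<partial>\<kappa> \<omega>) = 0 \<longleftrightarrow> (AE x in \<kappa> \<omega>. P (\<omega>, x))"
      by (subst nn_integral_0_iff_AE) (auto intro!: AE_cong simp: indicator_def)
  qed
  finally show ?thesis .
qed

section \<open>Existence of regular conditional distributions\<close>

lemma is_rcdI_generator:
  fixes X :: "'w \<Rightarrow> 'v::topological_space"
  assumes fin: "finite_measure M" and sub: "subalgebra M G" and ne: "space M \<noteq> {}"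
    and X[measurable]: "X \<in> borel_measurable M"
    and gen: "sets (borel :: 'v measure) = sigma_sets UNIV E" "Int_stable E"
    and A: "range A \<subseteq> E" "(\<Union>i::nat. A i) = UNIV"
    and ps: "\<And>\<omega>. \<omega> \<in> space M \<Longrightarrow> prob_space (\<kappa> \<omega>)"
    and sk: "\<And>\<omega>. \<omega> \<in> space M \<Longrightarrow> sets (\<kappa> \<omega>) = sets borel"
    and km: "\<And>B. B \<in> E \<Longrightarrow> (\<lambda>\<omega>. emeasure (\<kappa> \<omega>) B) \<in> borel_measurable G"
    and eq: "\<And>C B. C \<in> sets G \<Longrightarrow> B \<in> E \<Longrightarrow>
        emeasure M (C \<inter> (X -` B \<inter> space M)) = (\<integral>\<^sup>+\<omega>. emeasure (\<kappa> \<omega>) B * indicator C \<omega> \<partial>M)"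
  shows "is_rcd M G X \<kappa>"
proof -
  interpret finite_measure M by fact
  have spG: "space G = space M" and stG: "sets G \<subseteq> sets M" using sub by (auto simp: subalgebra_def)
  have idm[measurable]: "(\<lambda>\<omega>. \<omega>) \<in> measurable M G"
    using spG stG by (auto simp: measurable_def intro: sets.Int_space_eq2)
  have spk: "space (\<kappa> \<omega>) = UNIV" if "\<omega> \<in> space M" for \<omega>
    using sets_eq_imp_space_eq[OF sk[OF that]] by simp
  have kG: "\<kappa> \<in> measurable G (subprob_algebra borel)"
  proof (rule measurable_subprob_algebra_generated[OF gen(1,2)])
    show "(\<lambda>\<omega>. emeasure (\<kappa> \<omega>) UNIV) \<in> borel_measurable G"
      using prob_space.emeasure_space_1[OF ps] spk spG by (subst measurable_cong[where g="\<lambda>_. 1"]) auto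
  qed (use ps sk spG km in \<open>auto intro: prob_space_imp_subprob_space\<close>)
  have k: "\<kappa> \<in> measurable M (subprob_algebra borel)"
    using measurable_compose[OF idm kG] by simp
  have "emeasure M (C \<inter> (X -` B \<inter> space M)) = (\<integral>\<^sup>+\<omega>. emeasure (\<kappa> \<omega>) B * indicator C \<omega> \<partial>M)"
    if C: "C \<in> sets G" and B: "B \<in> sets borel" for C B
  proof -
    have CM[measurable]: "C \<in> sets M" using C stG by blast
    \<comment> \<open>For fixed \<open>C\<close>, restricting \<open>M\<close> to \<open>C\<close>
      turns both sides of the required identity into finite measures of the variable
      \<open>B\<close>, so uniqueness on a generator applies.\<close>
    let ?D = "density M (indicator C)"
    have kD: "\<kappa> \<in> measurable ?D (subprob_algebra borel)" using k by simp
    have neD: "space ?D \<noteq> {}" using ne by simp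
    have e1: "emeasure (distr ?D borel X) B = emeasure M (C \<inter> (X -` B \<inter> space M))"
      if B[measurable]: "B \<in> sets borel" for B
    proof -
      have "emeasure (distr ?D borel X) B = emeasure ?D (X -` B \<inter> space M)"
        by (subst emeasure_distr) auto
      also have "\<dots> = (\<integral>\<^sup>+\<omega>. indicator C \<omega> * indicator (X -` B \<inter> space M) \<omega> \<partial>M)"
        by (subst emeasure_density) auto
      also have "\<dots> = (\<integral>\<^sup>+\<omega>. indicator (C \<inter> (X -` B \<inter> space M)) \<omega> \<partial>M)"
        by (simp add: indicator_inter_arith)
      also have "\<dots> = emeasure M (C \<inter> (X -` B \<inter> space M))"
        by (rule nn_integral_indicator) measurable
      finally show ?thesis .
    qed
    have e2: "emeasure (?D \<bind> \<kappa>) B = (\<integral>\<^sup>+\<omega>. emeasure (\<kappa> \<omega>) B * indicator C \<omega> \<partial>M)"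
      if B[measurable]: "B \<in> sets borel" for B
    proof -
      have [measurable]: "(\<lambda>\<omega>. emeasure (\<kappa> \<omega>) B) \<in> borel_measurable M"
        using measurable_compose[OF k measurable_emeasure_subprob_algebra[OF B]] by simp
      show ?thesis
        by (subst emeasure_bind[OF neD kD B]) (simp add: nn_integral_density mult.commute)
    qed
    have Eb: "B \<in> sets borel" if "B \<in> E" for B using that gen(1) by auto
    have "distr ?D borel X = ?D \<bind> \<kappa>"
    proof (rule measure_eqI_generator_eq[OF gen(2), where \<Omega>=UNIV and A=A])
      show "emeasure (distr ?D borel X) B = emeasure (?D \<bind> \<kappa>) B" if "B \<in> E" for B
        using e1[OF Eb[OF that]] e2[OF Eb[OF that]] eq[OF C that] by simp
      show "emeasure (distr ?D borel X) (A i) \<noteq> \<infinity>" for i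
        using e1[OF Eb[OF subsetD[OF A(1) rangeI]], of i] emeasure_finite by simp
      show "sets (?D \<bind> \<kappa>) = sigma_sets UNIV E"
        unfolding sets_bind_measurable[OF kD neD] by (rule gen(1))
    qed (use A gen in auto)
    then show ?thesis using e1[OF B] e2[OF B] by simp
  qed
  moreover have "(\<lambda>\<omega>. emeasure (\<kappa> \<omega>) B) \<in> borel_measurable G" if "B \<in> sets borel" for B
    using measurable_compose[OF kG measurable_emeasure_subprob_algebra[OF that]] by simp
  ultimately show ?thesis unfolding is_rcd_def using ps sk by auto
qed

text \<open>Builds the conditional distribution function. Versions of conditional probabilities are
  monotone and right-continuous only almost surely; the repairs below make every path a distribution
  function, since \<open>is_rcd\<close> asks for a probability at every \<open>\<omega>\<close> of
  the space.\<close>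

lemma is_rcd_exists_unit_interval:
  fixes Y :: "'w \<Rightarrow> real"
  assumes fin: "finite_measure M" and sub: "subalgebra M G" and ne: "space M \<noteq> {}"
    and Y[measurable]: "Y \<in> borel_measurable M"
    and Y01: "\<And>\<omega>. \<omega> \<in> space M \<Longrightarrow> 0 \<le> Y \<omega> \<and> Y \<omega> \<le> 1"
  shows "\<exists>\<kappa>. is_rcd M G Y \<kappa>"
proof -
  interpret finite_measure M by fact
  interpret finite_measure_subalgebra M G by unfold_locales (rule sub)
  have spG: "space G = space M" and stG: "sets G \<subseteq> sets M" using sub by (auto simp: subalgebra_def)
  define I where "I q \<omega> = (indicator {\<omega>. Y \<omega> \<le> q} \<omega> :: real)" for q \<omega>
  have Im[measurable]: "I q \<in> borel_measurable M" for q unfolding I_def by measurable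
  have Ii: "integrable M (I q)" for q
    by (rule integrable_const_bound[where B=1]) (auto simp: I_def indicator_def)
  define C where "C q = real_cond_exp M G (I q)" for q
  \<comment> \<open>Clamping to [0, 1] and fixing the values beyond the range of \<open>Y\<close> by
    hand changes \<open>C q\<close> on a null set only, and yields the limits at both infinities for
    every \<open>\<omega>\<close>.\<close>
  define D where "D q \<omega> = (if q < 0 then 0 else if 1 \<le> q then 1 else max 0 (min 1 (C q \<omega>)))"
    for q \<omega>
  have Cm[measurable]: "C q \<in> borel_measurable G" for q unfolding C_def by measurable
  have Dm[measurable]: "D q \<in> borel_measurable G" for q unfolding D_def by measurable
  have D01: "0 \<le> D q \<omega>" "D q \<omega> \<le> 1" for q \<omega> unfolding D_def by auto
  have DC: "AE \<omega> in M. D q \<omega> = C q \<omega>" for q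
  proof -
    have "AE \<omega> in M. 0 \<le> C q \<omega>"
      unfolding C_def by (rule real_cond_exp_ge_c[OF Ii]) (auto simp: I_def)
    moreover have "AE \<omega> in M. C q \<omega> \<le> 1"
      unfolding C_def by (rule real_cond_exp_le_c[OF Ii]) (auto simp: I_def indicator_def)
    moreover have "AE \<omega> in M. q < 0 \<longrightarrow> C q \<omega> \<le> 0"
    proof (cases "q < 0")
      case True
      then have "AE \<omega> in M. C q \<omega> \<le> 0"
        unfolding C_def by (intro real_cond_exp_le_c[OF Ii]) (use Y01 in \<open>force simp: I_def indicator_def\<close>)
      then show ?thesis by auto
    qed simp
    moreover have "AE \<omega> in M. 1 \<le> q \<longrightarrow> 1 \<le> C q \<omega>"
    proof (cases "1 \<le> q")
      case True
      then have "AE \<omega> in M. 1 \<le> C q \<omega>"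
        unfolding C_def by (intro real_cond_exp_ge_c[OF Ii]) (use Y01 in \<open>force simp: I_def indicator_def\<close>)
      then show ?thesis by auto
    qed simp
    ultimately show ?thesis by eventually_elim (auto simp: D_def)
  qed
  \<comment> \<open>The infimum over rationals strictly above \<open>x\<close> forces monotonicity
    and right-continuity at every \<open>\<omega>\<close>, whether or not
    \<open>D q \<omega>\<close> is monotone in \<open>q\<close>.\<close>
  define H where "H \<omega> x = (INF q\<in>{q\<in>\<rat>. x < q}. D q \<omega>)" for \<omega> x
  have ne_q: "{q\<in>\<rat>. x < q} \<noteq> {}" for x :: real using Rats_dense_in_real[of x "x+1"] by auto
  have bdd: "bdd_below ((\<lambda>q. D q \<omega>) ` A)" for \<omega> A by (rule bdd_belowI[of _ 0]) (auto simp: D01)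
  have H_le: "H \<omega> x \<le> D q \<omega>" if "q \<in> \<rat>" "x < q" for \<omega> x q
    unfolding H_def by (rule cINF_lower[OF bdd]) (use that in auto)
  have H_ge: "c \<le> H \<omega> x" if "\<And>q. q \<in> \<rat> \<Longrightarrow> x < q \<Longrightarrow> c \<le> D q \<omega>" for \<omega> x c
    unfolding H_def by (rule cINF_greatest[OF ne_q]) (use that in auto)
  have Hm[measurable]: "(\<lambda>\<omega>. H \<omega> x) \<in> borel_measurable G" for x
    unfolding H_def by (rule borel_measurable_cINF_real) (auto intro: countable_subset[OF _ countable_rat])
  have H0: "0 \<le> H \<omega> x" for \<omega> x by (rule H_ge) (rule D01)
  have H1: "H \<omega> x \<le> 1" for \<omega> x using ne_q[of x] H_le D01(2) by (meson Rats_dense_in_real gt_ex order_trans)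
  have mono: "H \<omega> x \<le> H \<omega> y" if "x \<le> y" for \<omega> x y
    by (rule H_ge) (use that in \<open>auto intro!: H_le\<close>)
  have rc: "continuous (at_right a) (H \<omega>)" for \<omega> a
  proof (subst continuous_at_right_real_increasing[of "H \<omega>"], rule mono, assumption, safe)
    fix e :: real assume "0 < e"
    then have "\<exists>q\<in>{q\<in>\<rat>. a < q}. D q \<omega> < H \<omega> a + e"
      using cINF_less_iff[OF ne_q[of a] bdd, of \<omega> "H \<omega> a + e"] unfolding H_def by auto
    then obtain q where q: "q \<in> \<rat>" "a < q" "D q \<omega> < H \<omega> a + e" by blast
    have "H \<omega> (a + (q - a) / 2) \<le> D q \<omega>" by (rule H_le) (use q in \<open>auto simp: field_simps\<close>)
    then show "\<exists>d>0. H \<omega> (a + d) - H \<omega> a < e"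
      using q by (intro exI[of _ "(q - a) / 2"]) auto
  qed
  have bot0: "H \<omega> x = 0" if neg: "x < 0" for \<omega> x
  proof -
    obtain q where "q \<in> \<rat>" "x < q" "q < 0" using Rats_dense_in_real[OF neg] by blast
    then have "H \<omega> x \<le> 0" using H_le[of q x \<omega>] by (simp add: D_def)
    then show ?thesis using H0[of \<omega> x] by simp
  qed
  have top1: "H \<omega> x = 1" if "1 \<le> x" for \<omega> x
    by (rule antisym[OF H1]) (rule H_ge, use that in \<open>auto simp: D_def\<close>)
  have bot: "(H \<omega> \<longlongrightarrow> 0) at_bot" for \<omega>
    by (rule tendsto_eventually) (auto simp: eventually_at_bot_dense intro!: exI[of _ 0] bot0)
  have top: "(H \<omega> \<longlongrightarrow> 1) at_top" for \<omega>
    by (rule tendsto_eventually) (auto simp: eventually_at_top_linorder intro!: exI[of _ 1] top1)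
  define \<kappa> where "\<kappa> \<omega> = interval_measure (H \<omega>)" for \<omega>
  have rd: "real_distribution (\<kappa> \<omega>)" for \<omega>
    unfolding \<kappa>_def by (rule real_distribution_interval_measure[OF mono rc bot top])
  have k_Iic: "emeasure (\<kappa> \<omega>) {..x} = H \<omega> x" for \<omega> x
    unfolding \<kappa>_def by (rule emeasure_interval_measure_Iic[OF mono rc bot])
  have HI: "integrable M (\<lambda>\<omega>. H \<omega> x)" for x
    by (rule integrable_const_bound[where B=1])
       (use H0 H1 measurable_from_subalg[OF sub Hm] in auto)
  \<comment> \<open>\<open>H\<close> is squeezed between the conditional probability at
    \<open>x\<close> and those at rationals above \<open>x\<close>; the gap closes by continuity of
    the measure from above along \<open>x + 1 / Suc n\<close>.\<close>
  have "(\<integral>\<omega>\<in>A. H \<omega> x \<partial>M) = measure M (A \<inter> (Y -` {..x} \<inter> space M))" if A: "A \<in> sets G" for A x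
  proof -
    have AM[measurable]: "A \<in> sets M" using A stG by blast
    have Cint: "(\<integral>\<omega>\<in>A. C q \<omega> \<partial>M) = measure M (A \<inter> (Y -` {..q} \<inter> space M))" for q
    proof -
      have "(\<integral>\<omega>\<in>A. C q \<omega> \<partial>M) = (\<integral>\<omega>\<in>A. I q \<omega> \<partial>M)"
        unfolding C_def using real_cond_exp_intA[OF Ii A, of q] by simp
      also have "\<dots> = (\<integral>\<omega>. indicator (A \<inter> (Y -` {..q} \<inter> space M)) \<omega> \<partial>M)"
        unfolding set_lebesgue_integral_def I_def
        by (intro Bochner_Integration.integral_cong) (auto simp: indicator_def)
      also have "\<dots> = measure M (A \<inter> (Y -` {..q} \<inter> space M))"
        by (subst Bochner_Integration.integral_indicator) (auto intro!: arg_cong[where f="measure M"])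
      finally show ?thesis .
    qed
    have Ci: "integrable M (C q)" for q unfolding C_def by (rule real_cond_exp_int[OF Ii])
    have si: "set_integrable M A f" if "integrable M f" for f :: "'w \<Rightarrow> real"
      unfolding set_integrable_def using integrable_mult_indicator[OF AM that] by simp
    have "AE \<omega> in M. \<forall>q\<in>\<rat>. x < q \<longrightarrow> C x \<omega> \<le> D q \<omega>"
    proof (subst AE_ball_countable[OF countable_rat], rule ballI)
      fix q :: real
      show "AE \<omega> in M. x < q \<longrightarrow> C x \<omega> \<le> D q \<omega>"
      proof (cases "x < q")
        case True
        have "AE \<omega> in M. C x \<omega> \<le> C q \<omega>"
          unfolding C_def by (rule real_cond_exp_mono[OF _ Ii Ii]) (use True in \<open>auto simp: I_def indicator_def\<close>)
        with DC[of q] show ?thesis by eventually_elim simp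
      qed simp
    qed
    then have "AE \<omega> in M. C x \<omega> \<le> H \<omega> x" by eventually_elim (rule H_ge, auto)
    then have lower: "measure M (A \<inter> (Y -` {..x} \<inter> space M)) \<le> (\<integral>\<omega>\<in>A. H \<omega> x \<partial>M)"
      unfolding Cint[symmetric] by (intro set_integral_mono_AE si Ci HI) auto
    have upper: "(\<integral>\<omega>\<in>A. H \<omega> x \<partial>M) \<le> measure M (A \<inter> (Y -` {..y} \<inter> space M))" if xy: "x < y" for y
    proof -
      obtain q where q: "q \<in> \<rat>" "x < q" "q < y" using Rats_dense_in_real[OF xy] by blast
      have "AE \<omega> in M. H \<omega> x \<le> C q \<omega>" using DC[of q] by eventually_elim (use H_le[OF q(1,2)] in metis)
      then have "(\<integral>\<omega>\<in>A. H \<omega> x \<partial>M) \<le> measure M (A \<inter> (Y -` {..q} \<inter> space M))"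
        unfolding Cint[symmetric] by (intro set_integral_mono_AE si Ci HI) auto
      also have "\<dots> \<le> measure M (A \<inter> (Y -` {..y} \<inter> space M))"
        using q(3) by (intro finite_measure_mono) auto
      finally show ?thesis .
    qed
    let ?B = "\<lambda>n::nat. A \<inter> (Y -` {..x + 1 / Suc n} \<inter> space M)"
    have "(\<lambda>n. measure M (?B n)) \<longlonglongrightarrow> measure M (\<Inter>n. ?B n)"
    proof (rule finite_Lim_measure_decseq)
      show "range ?B \<subseteq> sets M" by auto
      show "decseq ?B"
      proof (rule decseq_SucI)
        fix n
        have "1 / real (Suc (Suc n)) \<le> 1 / real (Suc n)" by (intro divide_left_mono) auto
        then show "?B (Suc n) \<subseteq> ?B n"
          by (auto simp del: of_nat_Suc intro: order_trans[OF _ add_left_mono])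
      qed
    qed
    moreover have "(\<Inter>n. ?B n) = A \<inter> (Y -` {..x} \<inter> space M)"
    proof -
      have "Y \<omega> \<le> x" if "\<And>n::nat. Y \<omega> \<le> x + 1 / Suc n" for \<omega>
      proof (rule field_le_epsilon)
        fix e :: real assume "0 < e"
        then obtain n :: nat where "1 / Suc n < e" by (rule nat_approx_posE)
        then show "Y \<omega> \<le> x + e" using that[of n] by linarith
      qed
      moreover have "Y \<omega> \<le> x + 1 / Suc n" if "Y \<omega> \<le> x" for \<omega> n
        using that by (rule order_trans) simp
      ultimately show ?thesis by (auto simp del: of_nat_Suc)
    qed
    ultimately have "(\<lambda>n. measure M (?B n)) \<longlonglongrightarrow> measure M (A \<inter> (Y -` {..x} \<inter> space M))" by simp
    then have "(\<integral>\<omega>\<in>A. H \<omega> x \<partial>M) \<le> measure M (A \<inter> (Y -` {..x} \<inter> space M))"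
      by (rule LIMSEQ_le_const) (auto intro!: upper)
    with lower show ?thesis by simp
  qed note key = this
  have "is_rcd M G Y \<kappa>"
  proof (rule is_rcdI_generator[OF fin sub ne Y, where E="range (\<lambda>a::real. {..a})" and A="\<lambda>i. {..real i}"])
    show "sets (borel::real measure) = sigma_sets UNIV (range (\<lambda>a. {..a}))"
      by (simp add: borel_eq_atMost)
    show "Int_stable (range (\<lambda>a::real. {..a}))" by (auto simp: Int_stable_def)
    show "(\<Union>i::nat. {..real i}) = UNIV" by (auto simp: real_arch_simple)
    show "prob_space (\<kappa> \<omega>)" "sets (\<kappa> \<omega>) = sets borel" for \<omega>
      using rd[of \<omega>] by (auto simp: real_distribution_def real_distribution_axioms_def)
    fix B assume "B \<in> range (\<lambda>a::real. {..a})"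
    then obtain x where B: "B = {..x}" by auto
    show "(\<lambda>\<omega>. emeasure (\<kappa> \<omega>) B) \<in> borel_measurable G" unfolding B k_Iic by measurable
    fix A assume A: "A \<in> sets G"
    have AM[measurable]: "A \<in> sets M" using A stG by blast
    have "(\<integral>\<^sup>+\<omega>. emeasure (\<kappa> \<omega>) B * indicator A \<omega> \<partial>M) = (\<integral>\<^sup>+\<omega>. ennreal (indicator A \<omega> *\<^sub>R H \<omega> x) \<partial>M)"
      unfolding B k_Iic by (intro nn_integral_cong) (auto simp: indicator_def)
    also have "\<dots> = ennreal (\<integral>\<omega>\<in>A. H \<omega> x \<partial>M)"
      unfolding set_lebesgue_integral_def
      by (rule nn_integral_eq_integral[OF integrable_mult_indicator[OF AM HI]]) (simp add: H0)
    also have "\<dots> = emeasure M (A \<inter> (Y -` B \<inter> space M))"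
      unfolding key[OF A] B by (simp add: emeasure_eq_measure)
    finally show "emeasure M (A \<inter> (Y -` B \<inter> space M)) = (\<integral>\<^sup>+\<omega>. emeasure (\<kappa> \<omega>) B * indicator A \<omega> \<partial>M)" by simp
  qed auto
  then show ?thesis by blast
qed

text \<open>Digits 0 and 1 in base 3 leave tails of at most 1/2, strictly below 1, so the floor of
  \<open>3 ^ n * y\<close> reads off the first \<open>n\<close> digits. In base 2 a tail can equal 1
  and the expansion would be ambiguous.\<close>

lemma ternary_digit_recovery:
  fixes c :: "nat \<Rightarrow> real"
  assumes c: "\<And>n. c n = 0 \<or> c n = 1"
  defines "y \<equiv> \<Sum>n. c n / 3 ^ Suc n"
  shows "0 \<le> y" "y \<le> 1"
    and "real_of_int (\<lfloor>3 ^ Suc n * y\<rfloor> - 3 * \<lfloor>3 ^ n * y\<rfloor>) = c n"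
proof -
  define t where "t n = (\<Sum>j. c (n + j) / 3 ^ Suc j)" for n
  have c01: "0 \<le> c n" "c n \<le> 1" for n using c[of n] by auto
  have geo: "(\<lambda>j. 1 / 3 ^ Suc j) sums (1/2 :: real)"
    using sums_mult[OF geometric_sums[of "1/3::real"], of "1/3"] by (simp add: power_one_over)
  have summ: "summable (\<lambda>j. c (n + j) / 3 ^ Suc j)" for n
    by (rule summable_comparison_test'[OF sums_summable[OF geo], of 0])
       (use c01 in \<open>auto simp: divide_right_mono\<close>)
  have t0: "0 \<le> t n" for n unfolding t_def by (rule suminf_nonneg[OF summ]) (simp add: c01)
  have t1: "t n \<le> 1/2" for n
    unfolding t_def sums_unique[OF geo]
    by (rule suminf_le[OF _ summ sums_summable[OF geo]]) (simp add: c01 divide_right_mono)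
  have rec: "3 * t n = c n + t (Suc n)" for n
  proof -
    have "t n = c n / 3 + (\<Sum>j. c (n + Suc j) / 3 ^ Suc (Suc j))"
      unfolding t_def using suminf_split_head[OF summ[of n]] by simp
    also have "(\<Sum>j. c (n + Suc j) / 3 ^ Suc (Suc j)) = (\<Sum>j. 1/3 * (c (Suc n + j) / 3 ^ Suc j))"
      by simp
    also have "\<dots> = 1/3 * t (Suc n)" unfolding t_def by (rule suminf_mult[OF summ])
    finally show ?thesis by simp
  qed
  \<comment> \<open>\<open>N n\<close> is the integer whose ternary digits are the first
    \<open>n\<close> values of \<open>c\<close>.\<close>
  define N :: "nat \<Rightarrow> int" where "N = rec_nat 0 (\<lambda>n k. 3 * k + \<lfloor>c n\<rfloor>)"
  have fc: "real_of_int \<lfloor>c n\<rfloor> = c n" for n using c[of n] by auto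
  have exp: "3 ^ n * y = N n + t n" for n
  proof (induction n)
    case 0 show ?case by (simp add: N_def y_def t_def)
  next
    case (Suc n)
    have "3 ^ Suc n * y = 3 * (N n + t n)" using Suc by simp
    also have "\<dots> = N (Suc n) + t (Suc n)" using rec[of n] by (simp add: N_def fc del: of_int_floor)
    finally show ?case .
  qed
  have fl: "\<lfloor>3 ^ n * y\<rfloor> = N n" for n
    unfolding exp using t0[of n] t1[of n] by (intro floor_unique) auto
  show "real_of_int (\<lfloor>3 ^ Suc n * y\<rfloor> - 3 * \<lfloor>3 ^ n * y\<rfloor>) = c n"
    unfolding fl by (simp add: N_def fc del: of_int_floor)
  show "0 \<le> y" "y \<le> 1" using t0[of 0] t1[of 0] by (simp_all add: y_def t_def)
qed

text \<open>The code of a point lists, as ternary digits, which of countably many small balls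
  contain it; a point is recovered as the limit of centres of such balls.\<close>

lemma borel_coding_unit_interval:
  obtains f :: "'a::euclidean_space \<Rightarrow> real" and g :: "real \<Rightarrow> 'a"
  where "f \<in> borel_measurable borel" "g \<in> borel_measurable borel"
    "\<And>x. g (f x) = x" "\<And>x. 0 \<le> f x \<and> f x \<le> 1"
proof -
  obtain d :: "nat \<Rightarrow> 'a" where d: "\<And>X. open X \<Longrightarrow> X \<noteq> {} \<Longrightarrow> \<exists>i. d i \<in> X"
    using dense_sequence_exists by blast
  \<comment> \<open>One index \<open>n\<close> encodes a centre and the exponent of its radius, so
    that a single digit sequence records membership in all the balls.\<close>
  define b :: "nat \<Rightarrow> 'a \<Rightarrow> real"
    where "b n x = (if dist x (d (fst (prod_decode n))) < (1/2) ^ snd (prod_decode n) then 1 else 0)" for n x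
  define f where "f x = (\<Sum>n. b n x / 3 ^ Suc n)" for x
  define dig where "dig n y = real_of_int (\<lfloor>3 ^ Suc n * y\<rfloor> - 3 * \<lfloor>3 ^ n * y\<rfloor>)" for n and y :: real
  \<comment> \<open>Recovers a centre for the radius \<open>(1/2) ^ m\<close> from the digits alone.
    On codes of points such an index exists by density; elsewhere the value is immaterial.\<close>
  define ix where "ix m y = (LEAST k. dig (prod_encode (k, m)) y = 1)" for m y
  define g where "g y = lim (\<lambda>m. d (ix m y))" for y
  have [measurable]: "b n \<in> borel_measurable borel" for n unfolding b_def by measurable
  have b01: "b n x = 0 \<or> b n x = 1" for n x by (simp add: b_def)
  have f01: "0 \<le> f x" "f x \<le> 1" for x
    unfolding f_def using ternary_digit_recovery(1,2)[of "\<lambda>n. b n x", OF b01] by auto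
  have dig_f: "dig n (f x) = b n x" for n x
    unfolding f_def dig_def using ternary_digit_recovery(3)[of "\<lambda>n. b n x", OF b01] by auto
  have [measurable]: "dig n \<in> borel_measurable borel" for n unfolding dig_def by measurable
  have [measurable]: "ix m \<in> measurable borel (count_space UNIV)" for m unfolding ix_def by measurable
  show thesis
  proof
    show "f \<in> borel_measurable borel" unfolding f_def by measurable
    show "g \<in> borel_measurable borel" unfolding g_def by measurable
    show "0 \<le> f x \<and> f x \<le> 1" for x using f01 by simp
    fix x
    have "dist x (d (ix m (f x))) < (1/2) ^ m" for m
    proof -
      obtain k where "d k \<in> ball x ((1/2)^m)" using d[of "ball x ((1/2)^m)"] by (auto simp: not_le)
      then have "dig (prod_encode (k, m)) (f x) = 1" by (simp add: dig_f b_def)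
      then have "dig (prod_encode (ix m (f x), m)) (f x) = 1" unfolding ix_def by (rule LeastI)
      then show ?thesis by (simp add: dig_f b_def split: if_splits)
    qed
    then have near: "dist (d (ix m (f x))) x \<le> (1/2) ^ m" for m by (simp add: dist_commute less_imp_le)
    have "(\<lambda>m. dist (d (ix m (f x))) x) \<longlonglongrightarrow> 0"
    proof (rule tendsto_sandwich[OF _ _ tendsto_const])
      show "(\<lambda>m. (1/2::real)^m) \<longlonglongrightarrow> 0" by (intro LIMSEQ_realpow_zero) auto
    qed (use near in auto)
    then have "(\<lambda>m. d (ix m (f x))) \<longlonglongrightarrow> x" by (subst tendsto_dist_iff)
    then show "g (f x) = x" unfolding g_def by (rule limI)
  qed
qed

text \<open>The code \<open>f\<close> need not be onto. Conditioning \<open>f (X \<omega>)\<close>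
  and pushing the kernel forward along \<open>g\<close> is enough, since \<open>g (f x) = x\<close>
  makes the event that the code of \<open>X\<close> lies in the preimage of \<open>B\<close> under
  \<open>g\<close> equal to the event that \<open>X\<close> lies in \<open>B\<close>.\<close>

theorem is_rcd_exists:
  fixes X :: "'w \<Rightarrow> 'v::euclidean_space"
  assumes fin: "finite_measure M" and sub: "subalgebra M G" and ne: "space M \<noteq> {}"
    and X[measurable]: "X \<in> borel_measurable M"
  shows "\<exists>\<kappa>. is_rcd M G X \<kappa>"
proof -
  obtain f :: "'v \<Rightarrow> real" and g where f[measurable]: "f \<in> borel_measurable borel"
    and g[measurable]: "g \<in> borel_measurable borel"
    and gf: "\<And>x. g (f x) = x" and f01: "\<And>x. 0 \<le> f x \<and> f x \<le> 1"
    using borel_coding_unit_interval by metis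
  obtain \<kappa> where k: "is_rcd M G (\<lambda>\<omega>. f (X \<omega>)) \<kappa>"
    using is_rcd_exists_unit_interval[OF fin sub ne, of "\<lambda>\<omega>. f (X \<omega>)"] f01 by auto
  have spk: "space (\<kappa> \<omega>) = UNIV" if "\<omega> \<in> space M" for \<omega>
    using k that sets_eq_imp_space_eq[of "\<kappa> \<omega>" borel] by (auto simp: is_rcd_def)
  have gm: "g \<in> measurable (\<kappa> \<omega>) borel" if "\<omega> \<in> space M" for \<omega>
    using k that by (subst measurable_cong_sets[of _ borel _ borel]) (auto simp: is_rcd_def)
  have ek: "emeasure (distr (\<kappa> \<omega>) borel g) B = emeasure (\<kappa> \<omega>) (g -` B)"
    if "\<omega> \<in> space M" "B \<in> sets borel" for \<omega> B
    using emeasure_distr[OF gm that(2)] spk that by simp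
  have gB: "g -` B \<in> sets borel" if "B \<in> sets borel" for B
    using measurable_sets[OF g that] by simp
  have spG: "space G = space M" using sub by (simp add: subalgebra_def)
  have "is_rcd M G X (\<lambda>\<omega>. distr (\<kappa> \<omega>) borel g)"
    unfolding is_rcd_def
  proof (intro conjI ballI)
    fix \<omega> assume w: "\<omega> \<in> space M"
    show "prob_space (distr (\<kappa> \<omega>) borel g)"
      using k w gm[OF w] by (auto simp: is_rcd_def intro: prob_space.prob_space_distr)
  next
    fix B :: "'v set" assume B: "B \<in> sets borel"
    show "(\<lambda>\<omega>. emeasure (distr (\<kappa> \<omega>) borel g) B) \<in> borel_measurable G"
      using k gB[OF B] ek B spG by (subst measurable_cong[where g="\<lambda>\<omega>. emeasure (\<kappa> \<omega>) (g -` B)"])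
         (auto simp: is_rcd_def)
    fix A assume A: "A \<in> sets G"
    have "(\<lambda>\<omega>. f (X \<omega>)) -` (g -` B) = X -` B" by (auto simp: gf)
    then have "emeasure M (A \<inter> (X -` B \<inter> space M)) =
        (\<integral>\<^sup>+\<omega>. emeasure (\<kappa> \<omega>) (g -` B) * indicator A \<omega> \<partial>M)"
      using k A gB[OF B] unfolding is_rcd_def by metis
    also have "\<dots> = (\<integral>\<^sup>+\<omega>. emeasure (distr (\<kappa> \<omega>) borel g) B * indicator A \<omega> \<partial>M)"
      by (intro nn_integral_cong) (simp add: ek B)
    finally show "emeasure M (A \<inter> (X -` B \<inter> space M)) =
        (\<integral>\<^sup>+\<omega>. emeasure (distr (\<kappa> \<omega>) borel g) B * indicator A \<omega> \<partial>M)" .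
  qed simp
  then show ?thesis by blast
qed

text \<open>Turns the choice in \<open>rcd\<close> into a genuine conditional distribution, which
  gives \<open>Dset\<close> its intended meaning.\<close>

lemma is_rcd_rcd:
  fixes X :: "'w \<Rightarrow> 'v::euclidean_space"
  assumes "finite_measure M" "subalgebra M G" "space M \<noteq> {}" "X \<in> borel_measurable M"
  shows "is_rcd M G X (rcd M G X)"
  unfolding rcd_def by (rule someI_ex[OF is_rcd_exists[OF assms]])

section \<open>A quantitative one-period form of no arbitrage\<close>

lemma continuous_on_sublinear:
  fixes q :: "'a::real_normed_vector \<Rightarrow> real"
  assumes sub: "\<And>u v. q (u + v) \<le> q u + q v" and bd: "\<And>v. q v \<le> C * norm v" and "0 \<le> C"
  shows "continuous_on UNIV q"
proof -
  have *: "q u - q v \<le> C * norm (u - v)" for u v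
    using sub[of v "u - v"] bd[of "u - v"] by simp
  have "C-lipschitz_on UNIV q"
  proof (rule lipschitz_onI)
    fix u v show "dist (q u) (q v) \<le> C * dist u v"
      using *[of u v] *[of v u] by (simp add: dist_norm norm_minus_commute abs_le_iff)
  qed fact
  then show ?thesis by (rule lipschitz_on_continuous_on)
qed

lemma abs_inner_div_one_plus_norm_le:
  fixes x h :: "'v::real_inner"
  shows "\<bar>h \<bullet> x\<bar> / (1 + norm x) \<le> norm h"
proof -
  have "\<bar>h \<bullet> x\<bar> \<le> norm h * norm x" by (rule Cauchy_Schwarz_ineq2)
  also have "\<dots> \<le> norm h * (1 + norm x)" by (intro mult_left_mono) auto
  finally show ?thesis by (subst pos_divide_le_eq) (auto intro: add_pos_nonneg)
qed

text \<open>Scaling by \<open>1 + norm x\<close> makes the one-period shortfall integrable without any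
  assumption on the increments. The term \<open>max 0 w\<close> turns the shortfall into a functional
  whose zero set is a linear subspace, which is what the compactness argument needs.\<close>

lemma one_period_bound:
  fixes X :: "'w \<Rightarrow> 'v::euclidean_space"
  assumes fin: "finite_measure M" and sub: "subalgebra M G" and ne: "space M \<noteq> {}"
    and X[measurable]: "X \<in> borel_measurable M"
    and na: "\<And>h. h \<in> borel_measurable G \<Longrightarrow> AE \<omega> in M. 0 \<le> h \<omega> \<bullet> X \<omega>
      \<Longrightarrow> AE \<omega> in M. h \<omega> \<bullet> X \<omega> = 0"
  obtains \<rho> :: "'w \<Rightarrow> real" where "\<rho> \<in> borel_measurable G" "\<And>\<omega>. 0 < \<rho> \<omega> \<and> \<rho> \<omega> \<le> 1"
    "\<And>w h. w \<in> borel_measurable G \<Longrightarrow> h \<in> borel_measurable G \<Longrightarrow>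
      (\<integral>\<^sup>+\<omega>. ennreal (\<rho> \<omega> * (\<bar>w \<omega>\<bar> + \<bar>h \<omega> \<bullet> X \<omega>\<bar> / (1 + norm (X \<omega>)))) \<partial>M)
      \<le> (\<integral>\<^sup>+\<omega>. ennreal (max 0 (- (w \<omega> + h \<omega> \<bullet> X \<omega>)) + max 0 (w \<omega>)) \<partial>M)"
proof -
  have spG: "space G = space M" and stG: "sets G \<subseteq> sets M" using sub by (auto simp: subalgebra_def)
  obtain \<kappa> where rcd: "is_rcd M G X \<kappa>" using is_rcd_exists[OF fin sub ne X] by blast
  note kG[measurable] = is_rcd_kernel[OF sub rcd]
  have ps: "prob_space (\<kappa> \<omega>)" and sk: "sets (\<kappa> \<omega>) = sets borel" if "\<omega> \<in> space M" for \<omega>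
    using rcd that by (auto simp: is_rcd_def)
  \<comment> \<open>The pair \<open>v\<close> collects cash and holding, so that no arbitrage
    becomes a comparison of two functionals on one finite-dimensional space. After the scaling both
    integrands are bounded by a multiple of \<open>norm v\<close>, hence integrable under every
    kernel.\<close>
  define a :: "real \<times> 'v \<Rightarrow> 'v \<Rightarrow> real"
    where "a v x = max 0 (- (fst v + snd v \<bullet> x)) / (1 + norm x)" for v x
  define b :: "real \<times> 'v \<Rightarrow> 'v \<Rightarrow> real"
    where "b v x = \<bar>snd v \<bullet> x\<bar> / (1 + norm x)" for v x
  have pos: "0 < 1 + norm x" for x :: 'v by (simp add: add_pos_nonneg)
  have am[measurable]: "a v \<in> borel_measurable borel" for v unfolding a_def by measurable
  have bm[measurable]: "b v \<in> borel_measurable borel" for v unfolding b_def by measurable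
  have a0: "0 \<le> a v x" for v x unfolding a_def by (simp add: pos less_imp_le)
  have b0: "0 \<le> b v x" for v x unfolding b_def by (simp add: pos less_imp_le)
  have b1: "b v x \<le> norm v" for v x
    unfolding b_def using abs_inner_div_one_plus_norm_le[of "snd v" x] norm_snd_le[where x="fst v" and y="snd v"]
    by simp
  have ab: "a v x \<le> \<bar>fst v\<bar> + b v x" for v x
  proof -
    have "max 0 (- (fst v + snd v \<bullet> x)) \<le> \<bar>fst v\<bar> + \<bar>snd v \<bullet> x\<bar>" by auto
    then have "a v x \<le> (\<bar>fst v\<bar> + \<bar>snd v \<bullet> x\<bar>) / (1 + norm x)"
      unfolding a_def by (rule divide_right_mono) (simp add: pos less_imp_le)
    also have "\<dots> \<le> \<bar>fst v\<bar> + b v x"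
      unfolding b_def add_divide_distrib
      by (intro add_right_mono) (simp add: divide_le_eq pos mult_le_cancel_left1)
    finally show ?thesis .
  qed
  have a1: "a v x \<le> 2 * norm v" for v x
    using ab[of v x] b1[of v x] norm_fst_le[of "fst v" "snd v"] by simp
  have asub: "a (u + v) x \<le> a u x + a v x" for u v x
    unfolding a_def add_divide_distrib[symmetric]
    by (intro divide_right_mono) (auto simp: inner_add_left pos less_imp_le)
  have bsub: "b (u + v) x \<le> b u x + b v x" for u v x
    unfolding b_def add_divide_distrib[symmetric]
    by (intro divide_right_mono) (auto simp: inner_add_left pos less_imp_le)
  have ahom: "a (r *\<^sub>R v) x = r * a v x" if "0 \<le> r" for r v x
  proof -
    have "max 0 (- (r * fst v + r * (snd v \<bullet> x))) = r * max 0 (- (fst v + snd v \<bullet> x))"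
      using that by (simp add: max_mult_distrib_left algebra_simps)
    then show ?thesis by (simp add: a_def)
  qed
  have bhom: "b (r *\<^sub>R v) x = \<bar>r\<bar> * b v x" for r v x by (simp add: b_def abs_mult)
  define q1 where "q1 \<omega> v = max 0 (fst v) + (\<integral>x. a v x \<partial>\<kappa> \<omega>)" for \<omega> v
  define q2 where "q2 \<omega> v = \<bar>fst v\<bar> + (\<integral>x. b v x \<partial>\<kappa> \<omega>)" for \<omega> v
  have ai: "integrable (\<kappa> \<omega>) (a v)" and bi: "integrable (\<kappa> \<omega>) (b v)" if w: "\<omega> \<in> space M" for \<omega> v
  proof -
    interpret prob_space "\<kappa> \<omega>" by (rule ps[OF w])
    have m: "f \<in> borel_measurable (\<kappa> \<omega>)" if "f \<in> borel_measurable borel" for f :: "'v \<Rightarrow> real"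
      using that by (subst measurable_cong_sets[OF sk[OF w] refl])
    show "integrable (\<kappa> \<omega>) (a v)"
      by (rule integrable_const_bound[where B="2 * norm v"]) (auto simp: a0 a1 m)
    show "integrable (\<kappa> \<omega>) (b v)"
      by (rule integrable_const_bound[where B="norm v"]) (auto simp: b0 b1 m)
  qed
  have q1m[measurable]: "(\<lambda>\<omega>. q1 \<omega> v) \<in> borel_measurable G" for v
  proof -
    have "(\<lambda>\<omega>. \<integral>x. a v x \<partial>\<kappa> \<omega>) \<in> borel_measurable G"
      by (rule measurable_compose[OF kG integral_measurable_subprob_algebra]) simp
    then show ?thesis unfolding q1_def by measurable
  qed
  have q2m[measurable]: "(\<lambda>\<omega>. q2 \<omega> v) \<in> borel_measurable G" for v
  proof -
    have "(\<lambda>\<omega>. \<integral>x. b v x \<partial>\<kappa> \<omega>) \<in> borel_measurable G"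
      by (rule measurable_compose[OF kG integral_measurable_subprob_algebra]) simp
    then show ?thesis unfolding q2_def by measurable
  qed
  have q1n: "0 \<le> q1 \<omega> v" and q2n: "0 \<le> q2 \<omega> v" for \<omega> v
    unfolding q1_def q2_def by (auto intro!: add_nonneg_nonneg integral_nonneg simp: a0 b0)
  have q1sub: "q1 \<omega> (u + v) \<le> q1 \<omega> u + q1 \<omega> v" if w: "\<omega> \<in> space M" for \<omega> u v
  proof -
    have "(\<integral>x. a (u + v) x \<partial>\<kappa> \<omega>) \<le> (\<integral>x. a u x + a v x \<partial>\<kappa> \<omega>)"
      by (intro integral_mono Bochner_Integration.integrable_add ai[OF w] asub)
    then show ?thesis unfolding q1_def using ai[OF w] by simp
  qed
  have q2sub: "q2 \<omega> (u + v) \<le> q2 \<omega> u + q2 \<omega> v" if w: "\<omega> \<in> space M" for \<omega> u v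
  proof -
    have "(\<integral>x. b (u + v) x \<partial>\<kappa> \<omega>) \<le> (\<integral>x. b u x + b v x \<partial>\<kappa> \<omega>)"
      by (intro integral_mono Bochner_Integration.integrable_add bi[OF w] bsub)
    then show ?thesis unfolding q2_def using bi[OF w] by simp
  qed
  have q12: "q1 \<omega> v \<le> 2 * q2 \<omega> v" if w: "\<omega> \<in> space M" for \<omega> v
  proof -
    interpret prob_space "\<kappa> \<omega>" by (rule ps[OF w])
    have "(\<integral>x. a v x \<partial>\<kappa> \<omega>) \<le> (\<integral>x. \<bar>fst v\<bar> + b v x \<partial>\<kappa> \<omega>)"
      by (intro integral_mono Bochner_Integration.integrable_add ai[OF w] bi[OF w] ab) auto
    also have "\<dots> = \<bar>fst v\<bar> + (\<integral>x. b v x \<partial>\<kappa> \<omega>)"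
      using bi[OF w] by (simp add: prob_space)
    finally have "(\<integral>x. a v x \<partial>\<kappa> \<omega>) \<le> \<bar>fst v\<bar> + (\<integral>x. b v x \<partial>\<kappa> \<omega>)" .
    moreover have "0 \<le> (\<integral>x. b v x \<partial>\<kappa> \<omega>)" by (simp add: b0)
    ultimately show ?thesis unfolding q1_def q2_def by auto
  qed
  have q2b: "q2 \<omega> v \<le> 2 * norm v" if w: "\<omega> \<in> space M" for \<omega> v
  proof -
    interpret prob_space "\<kappa> \<omega>" by (rule ps[OF w])
    have "(\<integral>x. b v x \<partial>\<kappa> \<omega>) \<le> (\<integral>x. norm v \<partial>\<kappa> \<omega>)"
      by (intro integral_mono bi[OF w] b1) auto
    then show ?thesis
      unfolding q2_def using norm_fst_le[of "fst v" "snd v"] by (simp add: prob_space)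
  qed
  have q1b: "q1 \<omega> v \<le> 4 * norm v" if "\<omega> \<in> space M" for \<omega> v
    using q12[OF that, of v] q2b[OF that, of v] by simp
  have q1c: "continuous_on UNIV (q1 \<omega>)" if "\<omega> \<in> space M" for \<omega>
    by (rule continuous_on_sublinear[OF q1sub[OF that] q1b[OF that]]) simp
  have q2c: "continuous_on UNIV (q2 \<omega>)" if "\<omega> \<in> space M" for \<omega>
    by (rule continuous_on_sublinear[OF q2sub[OF that] q2b[OF that]]) simp
  have q1hom: "q1 \<omega> (r *\<^sub>R v) = r * q1 \<omega> v" if "0 \<le> r" for \<omega> r v
    using that by (simp add: q1_def ahom max_mult_distrib_left distrib_left)
  have q2hom: "q2 \<omega> (r *\<^sub>R v) = \<bar>r\<bar> * q2 \<omega> v" for \<omega> r v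
    by (simp add: q2_def bhom abs_mult distrib_left)
  have a_iff: "a v x = 0 \<longleftrightarrow> 0 \<le> fst v + snd v \<bullet> x" for v x
    using pos[of x] by (auto simp: a_def max_def split: if_splits)
  have b_iff: "b v x = 0 \<longleftrightarrow> snd v \<bullet> x = 0" for v x
    using pos[of x] by (auto simp: b_def)
  \<comment> \<open>If \<open>q1\<close> vanishes, the cash is nonpositive and cash plus gain is
    nonnegative. So the gain is nonnegative, hence zero by no arbitrage, and then the cash is zero
    as well. As \<open>na\<close> speaks of measurable strategies only, the interchange of
    quantifiers is needed to reach all vectors.\<close>
  have "AE \<omega> in M. \<forall>v. q1 \<omega> v = 0 \<longrightarrow> q2 \<omega> v = 0"
  proof (rule AE_zero_implies_zero[OF sub])
    fix v :: "'w \<Rightarrow> real \<times> 'v"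
    assume v[measurable]: "v \<in> borel_measurable G" and z: "\<forall>\<omega>\<in>space G. q1 \<omega> (v \<omega>) = 0"
    have [measurable]: "(\<lambda>\<omega>. fst (v \<omega>)) \<in> borel_measurable G" "(\<lambda>\<omega>. snd (v \<omega>)) \<in> borel_measurable G"
      by (rule measurable_compose[OF v]; intro borel_measurable_continuous_onI continuous_intros)+
    have fst0: "fst (v \<omega>) \<le> 0" and azero: "(\<integral>x. a (v \<omega>) x \<partial>\<kappa> \<omega>) = 0" if "\<omega> \<in> space M" for \<omega>
    proof -
      have "max 0 (fst (v \<omega>)) + (\<integral>x. a (v \<omega>) x \<partial>\<kappa> \<omega>) = 0" using z that spG by (simp add: q1_def)
      moreover have "0 \<le> (\<integral>x. a (v \<omega>) x \<partial>\<kappa> \<omega>)" by (simp add: a0)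
      ultimately show "fst (v \<omega>) \<le> 0" "(\<integral>x. a (v \<omega>) x \<partial>\<kappa> \<omega>) = 0" by (auto simp: max_def split: if_splits)
    qed
    have "AE x in \<kappa> \<omega>. 0 \<le> fst (v \<omega>) + snd (v \<omega>) \<bullet> x" if w: "\<omega> \<in> space M" for \<omega>
      using azero[OF w] integral_nonneg_eq_0_iff_AE[OF ai[OF w]] by (simp add: a0 a_iff)
    then have "AE \<omega> in M. AE x in \<kappa> \<omega>. 0 \<le> fst (v \<omega>) + snd (v \<omega>) \<bullet> x" by (rule AE_I2)
    then have AE1: "AE \<omega> in M. 0 \<le> fst (v \<omega>) + snd (v \<omega>) \<bullet> X \<omega>"
      using is_rcd_AE_iff[OF fin sub ne X rcd, of "\<lambda>(\<omega>, x). 0 \<le> fst (v \<omega>) + snd (v \<omega>) \<bullet> x"] by simp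
    then have "AE \<omega> in M. 0 \<le> snd (v \<omega>) \<bullet> X \<omega>"
      using AE_space[of M] by eventually_elim (use fst0 in fastforce)
    then have AE2: "AE \<omega> in M. snd (v \<omega>) \<bullet> X \<omega> = 0" by (intro na) auto
    then have "AE \<omega> in M. AE x in \<kappa> \<omega>. snd (v \<omega>) \<bullet> x = 0"
      using is_rcd_AE_iff[OF fin sub ne X rcd, of "\<lambda>(\<omega>, x). snd (v \<omega>) \<bullet> x = 0"] by simp
    with AE1 AE2 AE_space[of M] show "AE \<omega> in M. q2 \<omega> (v \<omega>) = 0"
    proof eventually_elim
      case (elim \<omega>)
      have "fst (v \<omega>) = 0" using elim fst0[of \<omega>] by auto
      moreover have "(\<integral>x. b (v \<omega>) x \<partial>\<kappa> \<omega>) = 0"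
        using elim integral_nonneg_eq_0_iff_AE[OF bi] by (simp add: b0 b_iff)
      ultimately show ?case by (simp add: q2_def)
    qed
  qed (use q1c q2c q1n q2n spG in \<open>auto simp: q1_def a_def\<close>)
  then have dom: "AE \<omega> in M. \<exists>c>0. \<forall>v. c * q2 \<omega> v \<le> q1 \<omega> v"
    using AE_space
  proof eventually_elim
    case (elim \<omega>)
    obtain c where "0 < c" "\<And>v. c * q2 \<omega> v \<le> q1 \<omega> v"
      using sublinear_dominates_seminorm[of "q1 \<omega>" "q2 \<omega>", OF q1c q2c q1n q1hom q1sub q2hom q2sub q12] elim
      by blast
    then show ?case by blast
  qed
  obtain d :: "nat \<Rightarrow> real \<times> 'v" where d: "\<And>X. open X \<Longrightarrow> X \<noteq> {} \<Longrightarrow> \<exists>i. d i \<in> X"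
    using dense_sequence_exists by blast
  \<comment> \<open>The constants \<open>c\<close> depend on \<open>\<omega>\<close> in an
    uncontrolled way. The least integer that works along a dense sequence is measurable, and
    continuity extends the inequality to all vectors.\<close>
  define k where "k \<omega> = (LEAST k::nat. \<forall>i. q2 \<omega> (d i) \<le> real (Suc k) * q1 \<omega> (d i))" for \<omega>
  have km[measurable]: "k \<in> measurable G (count_space UNIV)" unfolding k_def by measurable
  define \<rho> where "\<rho> \<omega> = 1 / real (Suc (k \<omega>))" for \<omega>
  have rm[measurable]: "\<rho> \<in> borel_measurable G" unfolding \<rho>_def by measurable
  have r01: "0 < \<rho> \<omega> \<and> \<rho> \<omega> \<le> 1" for \<omega> unfolding \<rho>_def by simp
  have rho: "AE \<omega> in M. \<forall>v. \<rho> \<omega> * q2 \<omega> v \<le> q1 \<omega> v"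
    using dom AE_space
  proof eventually_elim
    case (elim \<omega>)
    then obtain c where c: "0 < c" "\<And>v. c * q2 \<omega> v \<le> q1 \<omega> v" by blast
    obtain n :: nat where n: "1 / Suc n < c" using nat_approx_posE[OF c(1)] by blast
    have "q2 \<omega> (d i) \<le> real (Suc n) * q1 \<omega> (d i)" for i
    proof -
      have "1 / Suc n * q2 \<omega> (d i) \<le> c * q2 \<omega> (d i)" using n q2n by (intro mult_right_mono) auto
      also have "\<dots> \<le> q1 \<omega> (d i)" by (rule c(2))
      finally show ?thesis by (simp add: divide_le_eq mult.commute del: of_nat_Suc)
    qed
    then have kd: "q2 \<omega> (d i) \<le> real (Suc (k \<omega>)) * q1 \<omega> (d i)" for i
      unfolding k_def using LeastI[of "\<lambda>k. \<forall>i. q2 \<omega> (d i) \<le> real (Suc k) * q1 \<omega> (d i)" n] by blast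
    have "q2 \<omega> v \<le> real (Suc (k \<omega>)) * q1 \<omega> v" for v
    proof (rule ccontr)
      let ?O = "{v. real (Suc (k \<omega>)) * q1 \<omega> v < q2 \<omega> v}"
      assume "\<not> ?thesis"
      then have "v \<in> ?O" by simp
      moreover have "open ?O"
        using elim by (intro open_Collect_less continuous_intros q1c q2c) auto
      ultimately obtain i where "d i \<in> ?O" using d by blast
      then show False using kd[of i] by simp
    qed
    then show ?case by (simp add: \<rho>_def divide_le_eq mult.commute del: of_nat_Suc)
  qed
  show thesis
  proof
    fix w :: "'w \<Rightarrow> real" and h :: "'w \<Rightarrow> 'v"
    assume w[measurable]: "w \<in> borel_measurable G" and h[measurable]: "h \<in> borel_measurable G"
    have wM[measurable]: "w \<in> borel_measurable M" and hM[measurable]: "h \<in> borel_measurable M"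
      by (rule measurable_from_subalg[OF sub w], rule measurable_from_subalg[OF sub h])
    define v where "v \<omega> = (w \<omega>, h \<omega>)" for \<omega>
    have bM: "(\<lambda>(\<omega>, x). ennreal (\<rho> \<omega> * (\<bar>w \<omega>\<bar> + b (v \<omega>) x))) \<in> borel_measurable (G \<Otimes>\<^sub>M borel)"
      unfolding b_def v_def by measurable
    have aM: "(\<lambda>(\<omega>, x). ennreal (max 0 (w \<omega>) + a (v \<omega>) x)) \<in> borel_measurable (G \<Otimes>\<^sub>M borel)"
      unfolding a_def v_def by measurable
    have "(\<integral>\<^sup>+\<omega>. ennreal (\<rho> \<omega> * (\<bar>w \<omega>\<bar> + \<bar>h \<omega> \<bullet> X \<omega>\<bar> / (1 + norm (X \<omega>)))) \<partial>M)
      = (\<integral>\<^sup>+\<omega>. ennreal (\<rho> \<omega> * (\<bar>w \<omega>\<bar> + b (v \<omega>) (X \<omega>))) \<partial>M)"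
      by (simp add: b_def v_def)
    \<comment> \<open>Under the kernel at \<open>\<omega>\<close> the values of \<open>w\<close> and
      \<open>h\<close> are frozen, so the vector inequality between \<open>q2\<close> and
      \<open>q1\<close> applies inside.\<close>
    also have "\<dots> = (\<integral>\<^sup>+\<omega>. (\<integral>\<^sup>+x. ennreal (\<rho> \<omega> * (\<bar>w \<omega>\<bar> + b (v \<omega>) x)) \<partial>\<kappa> \<omega>) \<partial>M)"
      using is_rcd_nn_integral[OF fin sub ne X rcd bM] by simp
    also have "\<dots> \<le> (\<integral>\<^sup>+\<omega>. (\<integral>\<^sup>+x. ennreal (max 0 (w \<omega>) + a (v \<omega>) x) \<partial>\<kappa> \<omega>) \<partial>M)"
    proof (rule nn_integral_mono_AE)
      show "AE \<omega> in M. (\<integral>\<^sup>+x. ennreal (\<rho> \<omega> * (\<bar>w \<omega>\<bar> + b (v \<omega>) x)) \<partial>\<kappa> \<omega>)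
          \<le> (\<integral>\<^sup>+x. ennreal (max 0 (w \<omega>) + a (v \<omega>) x) \<partial>\<kappa> \<omega>)"
        using rho AE_space
      proof eventually_elim
        case (elim \<omega>)
        interpret prob_space "\<kappa> \<omega>" using elim by (intro ps)
        have i1: "integrable (\<kappa> \<omega>) (\<lambda>x. \<rho> \<omega> * (\<bar>w \<omega>\<bar> + b (v \<omega>) x))"
          and i2: "integrable (\<kappa> \<omega>) (\<lambda>x. max 0 (w \<omega>) + a (v \<omega>) x)"
          using ai bi elim by auto
        have "(\<integral>\<^sup>+x. ennreal (\<rho> \<omega> * (\<bar>w \<omega>\<bar> + b (v \<omega>) x)) \<partial>\<kappa> \<omega>) = ennreal (\<rho> \<omega> * q2 \<omega> (v \<omega>))"
          using nn_integral_eq_integral[OF i1] bi elim r01[of \<omega>]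
          by (simp add: b0 q2_def v_def prob_space distrib_left less_imp_le)
        also have "\<dots> \<le> ennreal (q1 \<omega> (v \<omega>))" using elim by (intro ennreal_leI) blast
        also have "\<dots> = (\<integral>\<^sup>+x. ennreal (max 0 (w \<omega>) + a (v \<omega>) x) \<partial>\<kappa> \<omega>)"
          using nn_integral_eq_integral[OF i2] ai elim
          by (simp add: a0 q1_def v_def prob_space)
        finally show ?case .
      qed
    qed
    also have "\<dots> = (\<integral>\<^sup>+\<omega>. ennreal (max 0 (w \<omega>) + a (v \<omega>) (X \<omega>)) \<partial>M)"
      using is_rcd_nn_integral[OF fin sub ne X rcd aM] by simp
    also have "\<dots> \<le> (\<integral>\<^sup>+\<omega>. ennreal (max 0 (- (w \<omega> + h \<omega> \<bullet> X \<omega>)) + max 0 (w \<omega>)) \<partial>M)"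
    proof (intro nn_integral_mono ennreal_leI)
      fix \<omega>
      have "a (v \<omega>) (X \<omega>) \<le> max 0 (- (w \<omega> + h \<omega> \<bullet> X \<omega>))"
        unfolding a_def v_def by (simp add: divide_le_eq pos mult_le_cancel_left1)
      then show "max 0 (w \<omega>) + a (v \<omega>) (X \<omega>) \<le> max 0 (- (w \<omega> + h \<omega> \<bullet> X \<omega>)) + max 0 (w \<omega>)" by simp
    qed
    finally show "(\<integral>\<^sup>+\<omega>. ennreal (\<rho> \<omega> * (\<bar>w \<omega>\<bar> + \<bar>h \<omega> \<bullet> X \<omega>\<bar> / (1 + norm (X \<omega>)))) \<partial>M)
      \<le> (\<integral>\<^sup>+\<omega>. ennreal (max 0 (- (w \<omega> + h \<omega> \<bullet> X \<omega>)) + max 0 (w \<omega>)) \<partial>M)" .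
  qed (use r01 in auto)
qed

text \<open>\<open>Z'\<close> is the conditional expectation of \<open>Z\<close>, so integrals of
  functions measurable in \<open>G\<close> do not notice the exchange. The event where it vanishes
  lies in \<open>G\<close> and carries no mass of the positive \<open>Z\<close>, hence is null. This
  keeps the weights of a backward induction adapted.\<close>

lemma weight_in_subalgebra:
  fixes Z :: "'w \<Rightarrow> real"
  assumes fin: "finite_measure M" and sub: "subalgebra M G"
    and Z[measurable]: "Z \<in> borel_measurable M" and Z01: "\<And>\<omega>. 0 < Z \<omega> \<and> Z \<omega> \<le> 1"
  obtains Z' :: "'w \<Rightarrow> real" where "Z' \<in> borel_measurable G" "\<And>\<omega>. 0 < Z' \<omega> \<and> Z' \<omega> \<le> 1"
    "\<And>f :: 'w \<Rightarrow> ennreal. f \<in> borel_measurable G \<Longrightarrow> (\<integral>\<^sup>+\<omega>. f \<omega> * ennreal (Z' \<omega>) \<partial>M) = (\<integral>\<^sup>+\<omega>. f \<omega> * ennreal (Z \<omega>) \<partial>M)"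
proof -
  interpret finite_measure M by fact
  interpret finite_measure_subalgebra M G by unfold_locales (rule sub)
  have spG: "space G = space M" and stG: "sets G \<subseteq> sets M" using sub by (auto simp: subalgebra_def)
  define c where "c = nn_cond_exp M G (\<lambda>\<omega>. ennreal (Z \<omega>))"
  have cm[measurable]: "c \<in> borel_measurable G" unfolding c_def by measurable
  have cM[measurable]: "c \<in> borel_measurable M" by (rule measurable_from_subalg[OF sub cm])
  have ci: "(\<integral>\<^sup>+\<omega>. f \<omega> * c \<omega> \<partial>M) = (\<integral>\<^sup>+\<omega>. f \<omega> * ennreal (Z \<omega>) \<partial>M)"
    if "f \<in> borel_measurable G" for f unfolding c_def using that by (rule nn_cond_exp_intg) simp
  have "AE \<omega> in M. c \<omega> \<le> nn_cond_exp M G (\<lambda>_. 1) \<omega>"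
    unfolding c_def by (rule nn_cond_exp_mono) (auto simp: Z01)
  moreover have "AE \<omega> in M. nn_cond_exp M G (\<lambda>_. 1) \<omega> = 1"
    using nn_cond_exp_F_meas[of "\<lambda>_. 1"] by auto
  ultimately have c1: "AE \<omega> in M. c \<omega> \<le> 1" by eventually_elim simp
  have c0: "AE \<omega> in M. 0 < c \<omega>"
  proof -
    let ?f = "\<lambda>\<omega>. indicator {\<omega>. c \<omega> = 0} \<omega> :: ennreal"
    have fm[measurable]: "?f \<in> borel_measurable G" by measurable
    have fM[measurable]: "?f \<in> borel_measurable M" by (rule measurable_from_subalg[OF sub fm])
    have "(\<integral>\<^sup>+\<omega>. ?f \<omega> * ennreal (Z \<omega>) \<partial>M) = (\<integral>\<^sup>+\<omega>. ?f \<omega> * c \<omega> \<partial>M)" using ci[OF fm] by simp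
    also have "\<dots> = (\<integral>\<^sup>+\<omega>. 0 \<partial>M)" by (intro nn_integral_cong) (auto simp: indicator_def)
    finally have "AE \<omega> in M. ?f \<omega> * ennreal (Z \<omega>) = 0"
      by (subst nn_integral_0_iff_AE[symmetric]) auto
    then show ?thesis
    proof eventually_elim
      case (elim \<omega>)
      then have "c \<omega> \<noteq> 0" using Z01[of \<omega>] by (auto simp: indicator_def)
      then show ?case by (simp add: zero_less_iff_neq_zero)
    qed
  qed
  \<comment> \<open>The value 1 on the exceptional null set makes the bounds hold at every
    point.\<close>
  define Z' where "Z' \<omega> = (if 0 < c \<omega> \<and> c \<omega> \<le> 1 then enn2real (c \<omega>) else 1)" for \<omega>
  have fin1: "x < \<top>" if "x \<le> (1::ennreal)" for x using that ennreal_one_less_top order_le_less_trans by blast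
  show thesis
  proof
    show "Z' \<in> borel_measurable G" unfolding Z'_def by measurable
    show "0 < Z' \<omega> \<and> Z' \<omega> \<le> 1" for \<omega>
      unfolding Z'_def using fin1[of "c \<omega>"] by (auto simp: enn2real_positive_iff intro: enn2real_leI)
    fix f :: "'w \<Rightarrow> ennreal" assume f: "f \<in> borel_measurable G"
    have "AE \<omega> in M. ennreal (Z' \<omega>) = c \<omega>"
      using c0 c1 by eventually_elim (simp add: Z'_def fin1)
    then have "(\<integral>\<^sup>+\<omega>. f \<omega> * ennreal (Z' \<omega>) \<partial>M) = (\<integral>\<^sup>+\<omega>. f \<omega> * c \<omega> \<partial>M)"
      by (intro nn_integral_cong_AE) auto
    then show "(\<integral>\<^sup>+\<omega>. f \<omega> * ennreal (Z' \<omega>) \<partial>M) = (\<integral>\<^sup>+\<omega>. f \<omega> * ennreal (Z \<omega>) \<partial>M)"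
      using ci[OF f] by simp
  qed
qed

section \<open>Arbitrage-free markets\<close>

text \<open>Kept apart from no arbitrage because it is also instantiated with the other processes of
  the family, which may admit arbitrage.\<close>

locale adapted_market = prob_space M for M :: "'w measure" +
  fixes F :: "nat \<Rightarrow> 'w measure" and T :: nat and S :: "nat \<Rightarrow> 'w \<Rightarrow> real^'d"
  assumes filt_sub: "\<And>t. t \<le> T \<Longrightarrow> subalgebra M (F t)"
    and filt_mono: "\<And>s t. s \<le> t \<Longrightarrow> t \<le> T \<Longrightarrow> sets (F s) \<subseteq> sets (F t)"
    and adapted: "\<And>t. t \<le> T \<Longrightarrow> S t \<in> borel_measurable (F t)"
begin

lemma space_F: "t \<le> T \<Longrightarrow> space (F t) = space M"
  using filt_sub by (simp add: subalgebra_def)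

lemma measurable_F_mono:
  assumes "s \<le> t" "t \<le> T" "f \<in> measurable (F s) N"
  shows "f \<in> measurable (F t) N"
proof -
  have "subalgebra (F t) (F s)"
    using assms filt_mono[of s t] space_F[of s] space_F[of t] by (simp add: subalgebra_def)
  then show ?thesis using measurable_from_subalg assms(3) by blast
qed

lemma measurable_F_M: "t \<le> T \<Longrightarrow> f \<in> measurable (F t) N \<Longrightarrow> f \<in> measurable M N"
  using measurable_from_subalg filt_sub by blast

lemma measurable_incr:
  assumes "t \<le> T" shows "incr S t \<in> borel_measurable (F t)"
proof -
  have [measurable]: "S t \<in> borel_measurable (F t)" "S (t - 1) \<in> borel_measurable (F t)"
    by (rule adapted[OF assms], rule measurable_F_mono[OF _ assms adapted]) (use assms in auto)
  show ?thesis unfolding incr_def[abs_def] by measurable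
qed

lemma measurable_strategy:
  "\<phi> \<in> strategies F T \<Longrightarrow> Suc t \<le> T \<Longrightarrow> \<phi> (Suc t) \<in> borel_measurable (F t)"
  unfolding strategies_def by force

lemma wealth_0: "wealth 0 S w \<phi> \<omega> = w"
  by (simp add: wealth_def)

lemma wealth_Suc: "wealth (Suc t) S w \<phi> \<omega> = wealth t S w \<phi> \<omega> + \<phi> (Suc t) \<omega> \<bullet> incr S (Suc t) \<omega>"
  by (simp add: wealth_def)

lemma measurable_wealth:
  assumes "\<phi> \<in> strategies F T" "t \<le> T"
  shows "wealth t S w \<phi> \<in> borel_measurable (F t)"
  using assms(2)
proof (induction t)
  case 0
  then show ?case by (simp add: wealth_0[abs_def] wealth_def[abs_def])
next
  case (Suc t)
  have [measurable]: "wealth t S w \<phi> \<in> borel_measurable (F (Suc t))"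
    "\<phi> (Suc t) \<in> borel_measurable (F (Suc t))" "incr S (Suc t) \<in> borel_measurable (F (Suc t))"
    by (rule measurable_F_mono[OF _ Suc.prems Suc.IH],
        use Suc.prems measurable_F_mono[OF _ Suc.prems measurable_strategy[OF assms(1) Suc.prems]]
          measurable_incr[OF Suc.prems] in auto)
  have "wealth (Suc t) S w \<phi> = (\<lambda>\<omega>. wealth t S w \<phi> \<omega> + \<phi> (Suc t) \<omega> \<bullet> incr S (Suc t) \<omega>)"
    by (simp add: fun_eq_iff wealth_Suc)
  then show ?case by simp
qed

end

locale arbitrage_free_market = adapted_market M F T S
  for M :: "'w measure" and F T and S :: "nat \<Rightarrow> 'w \<Rightarrow> real^'d" +
  assumes no_arbitrage: "NA M F T S"
begin

lemma one_period_NA: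
  assumes t: "Suc t \<le> T" and h: "h \<in> borel_measurable (F t)"
    and pos: "AE \<omega> in M. 0 \<le> h \<omega> \<bullet> incr S (Suc t) \<omega>"
  shows "AE \<omega> in M. h \<omega> \<bullet> incr S (Suc t) \<omega> = 0"
proof -
  define \<phi> where "\<phi> s = (if s = Suc t then h else (\<lambda>_. 0))" for s
  have phi: "\<phi> \<in> strategies F T" unfolding strategies_def \<phi>_def using h by auto
  have W: "wealth T S 0 \<phi> \<omega> = h \<omega> \<bullet> incr S (Suc t) \<omega>" for \<omega>
  proof -
    have "wealth T S 0 \<phi> \<omega> = (\<Sum>s\<in>{1..T}. if s = Suc t then h \<omega> \<bullet> incr S (Suc t) \<omega> else 0)"
      unfolding wealth_def add_0 by (rule sum.cong) (auto simp: \<phi>_def)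
    then show ?thesis using t by simp
  qed
  show ?thesis
    using no_arbitrage[unfolded NA_def, rule_format, OF phi, unfolded W, OF pos] .
qed

text \<open>The weight \<open>Z\<close> may depend on information after time \<open>t\<close>, so it
  cannot be absorbed into \<open>w\<close> and \<open>h\<close>. It becomes part of the measure
  instead: a positive density leaves the null sets unchanged, hence also no arbitrage, and the
  one-period bound holds under any finite measure.\<close>

lemma weighted_one_period_bound:
  fixes Z :: "'w \<Rightarrow> real"
  assumes t: "Suc t \<le> T" and Z[measurable]: "Z \<in> borel_measurable M"
    and Z01: "\<And>\<omega>. 0 < Z \<omega> \<and> Z \<omega> \<le> 1"
  obtains \<rho> :: "'w \<Rightarrow> real" where "\<rho> \<in> borel_measurable (F t)" "\<And>\<omega>. 0 < \<rho> \<omega> \<and> \<rho> \<omega> \<le> 1"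
    "\<And>w h. w \<in> borel_measurable (F t) \<Longrightarrow> h \<in> borel_measurable (F t) \<Longrightarrow>
      (\<integral>\<^sup>+\<omega>. ennreal (Z \<omega> * (\<rho> \<omega> * (\<bar>w \<omega>\<bar> + \<bar>h \<omega> \<bullet> incr S (Suc t) \<omega>\<bar> / (1 + norm (incr S (Suc t) \<omega>))))) \<partial>M)
      \<le> (\<integral>\<^sup>+\<omega>. ennreal (Z \<omega> * (max 0 (- (w \<omega> + h \<omega> \<bullet> incr S (Suc t) \<omega>)) + max 0 (w \<omega>))) \<partial>M)"
proof -
  let ?D = "density M (\<lambda>\<omega>. ennreal (Z \<omega>))"
  let ?X = "incr S (Suc t)"
  have tT: "t \<le> T" using t by simp
  have X[measurable]: "?X \<in> borel_measurable M"
    by (rule measurable_F_M[OF t measurable_incr[OF t]])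
  have "(\<integral>\<^sup>+\<omega>. ennreal (Z \<omega>) \<partial>M) \<le> (\<integral>\<^sup>+\<omega>. 1 \<partial>M)"
    by (intro nn_integral_mono) (use Z01 in auto)
  also have "\<dots> = 1" by (simp add: emeasure_space_1)
  finally have "(\<integral>\<^sup>+\<omega>. ennreal (Z \<omega>) \<partial>M) \<noteq> \<infinity>" by (auto simp: top_unique)
  moreover have "emeasure ?D (space ?D) = (\<integral>\<^sup>+\<omega>. ennreal (Z \<omega>) \<partial>M)"
    by (subst emeasure_density) (auto intro!: nn_integral_cong)
  ultimately have fin: "finite_measure ?D" by (intro finite_measureI) simp
  have sub: "subalgebra ?D (F t)" using filt_sub[OF tT] by (simp add: subalgebra_def)
  have ne: "space ?D \<noteq> {}" using not_empty by simp
  have AED: "(AE \<omega> in ?D. P \<omega>) \<longleftrightarrow> (AE \<omega> in M. P \<omega>)" for P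
    by (subst AE_density) (auto simp: Z01)
  obtain \<rho> :: "'w \<Rightarrow> real" where r[measurable]: "\<rho> \<in> borel_measurable (F t)" and r01: "\<And>\<omega>. 0 < \<rho> \<omega> \<and> \<rho> \<omega> \<le> 1"
    and bd: "\<And>w h. w \<in> borel_measurable (F t) \<Longrightarrow> h \<in> borel_measurable (F t) \<Longrightarrow>
      (\<integral>\<^sup>+\<omega>. ennreal (\<rho> \<omega> * (\<bar>w \<omega>\<bar> + \<bar>h \<omega> \<bullet> ?X \<omega>\<bar> / (1 + norm (?X \<omega>)))) \<partial>?D)
      \<le> (\<integral>\<^sup>+\<omega>. ennreal (max 0 (- (w \<omega> + h \<omega> \<bullet> ?X \<omega>)) + max 0 (w \<omega>)) \<partial>?D)"
    using one_period_bound[OF fin sub ne, of ?X] one_period_NA[OF t] X unfolding AED by auto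
  show thesis
  proof (rule that[OF r r01])
    fix w :: "'w \<Rightarrow> real" and h :: "'w \<Rightarrow> real^'d"
    assume w: "w \<in> borel_measurable (F t)" and h: "h \<in> borel_measurable (F t)"
    have [measurable]: "w \<in> borel_measurable M" "h \<in> borel_measurable M" "\<rho> \<in> borel_measurable M"
      by (rule measurable_F_M[OF tT w], rule measurable_F_M[OF tT h], rule measurable_F_M[OF tT r])
    have dens: "(\<integral>\<^sup>+\<omega>. ennreal (f \<omega>) \<partial>?D) = (\<integral>\<^sup>+\<omega>. ennreal (Z \<omega> * f \<omega>) \<partial>M)"
      if [measurable]: "f \<in> borel_measurable M" for f :: "'w \<Rightarrow> real"
      by (subst nn_integral_density) (auto simp: ennreal_mult' Z01 less_imp_le)
    show "(\<integral>\<^sup>+\<omega>. ennreal (Z \<omega> * (\<rho> \<omega> * (\<bar>w \<omega>\<bar> + \<bar>h \<omega> \<bullet> ?X \<omega>\<bar> / (1 + norm (?X \<omega>))))) \<partial>M)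
      \<le> (\<integral>\<^sup>+\<omega>. ennreal (Z \<omega> * (max 0 (- (w \<omega> + h \<omega> \<bullet> ?X \<omega>)) + max 0 (w \<omega>))) \<partial>M)"
      using bd[OF w h] by (subst (asm) (1 2) dens) auto
  qed
qed

text \<open>Backward induction from the terminal date. Without arbitrage a debt at time
  \<open>n\<close> cannot be surely worked off, and \<open>\<rho>\<close> tells which fraction of it
  is still expected to be owed one period later.\<close>

lemma weighted_shortfall_bound:
  assumes "t \<le> T"
  shows "\<exists>Z :: 'w \<Rightarrow> real. Z \<in> borel_measurable (F t) \<and> (\<forall>\<omega>. 0 < Z \<omega> \<and> Z \<omega> \<le> 1) \<and>
    (\<forall>\<phi>\<in>strategies F T. (\<integral>\<^sup>+\<omega>. ennreal (Z \<omega> * max 0 (- wealth t S w0 \<phi> \<omega>)) \<partial>M)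
       \<le> (\<integral>\<^sup>+\<omega>. ennreal (max 0 (- wealth T S w0 \<phi> \<omega>)) \<partial>M))"
  using assms
proof (induction rule: inc_induct)
  case base
  show ?case by (rule exI[of _ "\<lambda>_. 1"]) simp
next
  case (step n)
  then have n: "Suc n \<le> T" and nT: "n \<le> T" by auto
  obtain Z :: "'w \<Rightarrow> real" where Z: "Z \<in> borel_measurable (F (Suc n))" and Z01: "\<And>\<omega>. 0 < Z \<omega> \<and> Z \<omega> \<le> 1"
    and ZB: "\<And>\<phi>. \<phi> \<in> strategies F T \<Longrightarrow> (\<integral>\<^sup>+\<omega>. ennreal (Z \<omega> * max 0 (- wealth (Suc n) S w0 \<phi> \<omega>)) \<partial>M)
       \<le> (\<integral>\<^sup>+\<omega>. ennreal (max 0 (- wealth T S w0 \<phi> \<omega>)) \<partial>M)"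
    using step.IH by blast
  have ZM[measurable]: "Z \<in> borel_measurable M" by (rule measurable_F_M[OF n Z])
  obtain \<rho> :: "'w \<Rightarrow> real" where r: "\<rho> \<in> borel_measurable (F n)" and r01: "\<And>\<omega>. 0 < \<rho> \<omega> \<and> \<rho> \<omega> \<le> 1"
    and bd: "\<And>w h. w \<in> borel_measurable (F n) \<Longrightarrow> h \<in> borel_measurable (F n) \<Longrightarrow>
      (\<integral>\<^sup>+\<omega>. ennreal (Z \<omega> * (\<rho> \<omega> * (\<bar>w \<omega>\<bar> + \<bar>h \<omega> \<bullet> incr S (Suc n) \<omega>\<bar> / (1 + norm (incr S (Suc n) \<omega>))))) \<partial>M)
      \<le> (\<integral>\<^sup>+\<omega>. ennreal (Z \<omega> * (max 0 (- (w \<omega> + h \<omega> \<bullet> incr S (Suc n) \<omega>)) + max 0 (w \<omega>))) \<partial>M)"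
    by (rule weighted_one_period_bound[OF n ZM Z01]) (rule that; assumption)
  have rM[measurable]: "\<rho> \<in> borel_measurable M" by (rule measurable_F_M[OF nT r])
  have Zr01: "0 < Z \<omega> * \<rho> \<omega> \<and> Z \<omega> * \<rho> \<omega> \<le> 1" for \<omega>
    using Z01[of \<omega>] r01[of \<omega>] by (simp add: mult_le_one less_imp_le)
  obtain Z' :: "'w \<Rightarrow> real" where Z': "Z' \<in> borel_measurable (F n)" "\<And>\<omega>. 0 < Z' \<omega> \<and> Z' \<omega> \<le> 1"
    and Zi: "\<And>f :: 'w \<Rightarrow> ennreal. f \<in> borel_measurable (F n) \<Longrightarrow>
      (\<integral>\<^sup>+\<omega>. f \<omega> * ennreal (Z' \<omega>) \<partial>M) = (\<integral>\<^sup>+\<omega>. f \<omega> * ennreal (Z \<omega> * \<rho> \<omega>) \<partial>M)"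
    using weight_in_subalgebra[OF finite_measure_axioms filt_sub[OF nT], of "\<lambda>\<omega>. Z \<omega> * \<rho> \<omega>"] Zr01 by auto
  have "(\<integral>\<^sup>+\<omega>. ennreal (Z' \<omega> * max 0 (- wealth n S w0 \<phi> \<omega>)) \<partial>M)
       \<le> (\<integral>\<^sup>+\<omega>. ennreal (max 0 (- wealth T S w0 \<phi> \<omega>)) \<partial>M)" if phi: "\<phi> \<in> strategies F T" for \<phi>
  proof -
    let ?W = "wealth n S w0 \<phi>" and ?X = "incr S (Suc n)"
    have Wm[measurable]: "?W \<in> borel_measurable (F n)" by (rule measurable_wealth[OF phi nT])
    have pm[measurable]: "\<phi> (Suc n) \<in> borel_measurable (F n)" by (rule measurable_strategy[OF phi n])
    \<comment> \<open>Truncation to the event of debt removes the term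
      \<open>max 0 (w \<omega>)\<close> from the one-period bound; off that event cash and holding
      are both zero and contribute no shortfall.\<close>
    define w where "w \<omega> = min 0 (?W \<omega>)" for \<omega>
    define h where "h \<omega> = (if ?W \<omega> < 0 then \<phi> (Suc n) \<omega> else 0)" for \<omega>
    have wm: "w \<in> borel_measurable (F n)" and hm: "h \<in> borel_measurable (F n)"
      unfolding w_def h_def by measurable
    have "(\<integral>\<^sup>+\<omega>. ennreal (Z' \<omega> * max 0 (- ?W \<omega>)) \<partial>M) = (\<integral>\<^sup>+\<omega>. ennreal (max 0 (- ?W \<omega>)) * ennreal (Z' \<omega>) \<partial>M)"
      using Z'(2) by (intro nn_integral_cong) (simp add: ennreal_mult' mult.commute less_imp_le)
    also have "\<dots> = (\<integral>\<^sup>+\<omega>. ennreal (max 0 (- ?W \<omega>)) * ennreal (Z \<omega> * \<rho> \<omega>) \<partial>M)"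
      by (rule Zi) measurable
    also have "\<dots> \<le> (\<integral>\<^sup>+\<omega>. ennreal (Z \<omega> * (\<rho> \<omega> * (\<bar>w \<omega>\<bar> + \<bar>h \<omega> \<bullet> ?X \<omega>\<bar> / (1 + norm (?X \<omega>))))) \<partial>M)"
    proof (rule nn_integral_mono)
      fix \<omega>
      have "max 0 (- ?W \<omega>) \<le> \<bar>w \<omega>\<bar> + \<bar>h \<omega> \<bullet> ?X \<omega>\<bar> / (1 + norm (?X \<omega>))"
      proof -
        have "max 0 (- ?W \<omega>) \<le> \<bar>w \<omega>\<bar>" by (auto simp: w_def)
        moreover have "0 \<le> \<bar>h \<omega> \<bullet> ?X \<omega>\<bar> / (1 + norm (?X \<omega>))" by (simp add: add_nonneg_nonneg)
        ultimately show ?thesis by linarith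
      qed
      then have "Z \<omega> * \<rho> \<omega> * max 0 (- ?W \<omega>) \<le> Z \<omega> * \<rho> \<omega> * (\<bar>w \<omega>\<bar> + \<bar>h \<omega> \<bullet> ?X \<omega>\<bar> / (1 + norm (?X \<omega>)))"
        using Zr01[of \<omega>] by (intro mult_left_mono) auto
      then show "ennreal (max 0 (- ?W \<omega>)) * ennreal (Z \<omega> * \<rho> \<omega>)
        \<le> ennreal (Z \<omega> * (\<rho> \<omega> * (\<bar>w \<omega>\<bar> + \<bar>h \<omega> \<bullet> ?X \<omega>\<bar> / (1 + norm (?X \<omega>)))))"
        using Zr01[of \<omega>] by (subst ennreal_mult''[symmetric]) (auto simp: mult_ac intro!: ennreal_leI)
    qed
    also have "\<dots> \<le> (\<integral>\<^sup>+\<omega>. ennreal (Z \<omega> * (max 0 (- (w \<omega> + h \<omega> \<bullet> ?X \<omega>)) + max 0 (w \<omega>))) \<partial>M)"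
      by (rule bd[OF wm hm])
    also have "\<dots> \<le> (\<integral>\<^sup>+\<omega>. ennreal (Z \<omega> * max 0 (- wealth (Suc n) S w0 \<phi> \<omega>)) \<partial>M)"
      using Z01 by (intro nn_integral_mono ennreal_leI mult_left_mono)
        (auto simp: w_def h_def wealth_Suc less_imp_le)
    also have "\<dots> \<le> (\<integral>\<^sup>+\<omega>. ennreal (max 0 (- wealth T S w0 \<phi> \<omega>)) \<partial>M)" by (rule ZB[OF phi])
    finally show ?thesis .
  qed
  then show ?case using Z' by blast
qed

text \<open>Forward induction: the wealth at \<open>Suc n\<close> is controlled by the wealth at
  \<open>n\<close> and by the shortfall at \<open>Suc n\<close>, the latter supplied by the backward
  induction. Each step costs one terminal shortfall, hence the factor
  \<open>of_nat t\<close>.\<close>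

lemma weighted_wealth_bound:
  assumes "t \<le> T"
  shows "\<exists>\<eta> :: 'w \<Rightarrow> real. \<eta> \<in> borel_measurable (F t) \<and> (\<forall>\<omega>. 0 < \<eta> \<omega> \<and> \<eta> \<omega> \<le> 1) \<and>
    (\<forall>\<phi>\<in>strategies F T. (\<integral>\<^sup>+\<omega>. ennreal (\<eta> \<omega> * \<bar>wealth t S w0 \<phi> \<omega>\<bar>) \<partial>M)
       \<le> ennreal \<bar>w0\<bar> + of_nat t * (\<integral>\<^sup>+\<omega>. ennreal (max 0 (- wealth T S w0 \<phi> \<omega>)) \<partial>M))"
  using assms
proof (induction t)
  case 0
  show ?case by (rule exI[of _ "\<lambda>_. 1"]) (simp add: wealth_0 emeasure_space_1)
next
  case (Suc n)
  then have n: "Suc n \<le> T" and nT: "n \<le> T" by auto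
  obtain \<eta> :: "'w \<Rightarrow> real" where e: "\<eta> \<in> borel_measurable (F n)" and e01: "\<And>\<omega>. 0 < \<eta> \<omega> \<and> \<eta> \<omega> \<le> 1"
    and eB: "\<And>\<phi>. \<phi> \<in> strategies F T \<Longrightarrow> (\<integral>\<^sup>+\<omega>. ennreal (\<eta> \<omega> * \<bar>wealth n S w0 \<phi> \<omega>\<bar>) \<partial>M)
       \<le> ennreal \<bar>w0\<bar> + of_nat n * (\<integral>\<^sup>+\<omega>. ennreal (max 0 (- wealth T S w0 \<phi> \<omega>)) \<partial>M)"
    using Suc.IH[OF nT] by blast
  obtain Z :: "'w \<Rightarrow> real" where Z: "Z \<in> borel_measurable (F (Suc n))" and Z01: "\<And>\<omega>. 0 < Z \<omega> \<and> Z \<omega> \<le> 1"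
    and ZB: "\<And>\<phi>. \<phi> \<in> strategies F T \<Longrightarrow> (\<integral>\<^sup>+\<omega>. ennreal (Z \<omega> * max 0 (- wealth (Suc n) S w0 \<phi> \<omega>)) \<partial>M)
       \<le> (\<integral>\<^sup>+\<omega>. ennreal (max 0 (- wealth T S w0 \<phi> \<omega>)) \<partial>M)"
    using weighted_shortfall_bound[OF n, of w0] by blast
  have ZM[measurable]: "Z \<in> borel_measurable M" by (rule measurable_F_M[OF n Z])
  obtain \<rho> :: "'w \<Rightarrow> real" where r: "\<rho> \<in> borel_measurable (F n)" and r01: "\<And>\<omega>. 0 < \<rho> \<omega> \<and> \<rho> \<omega> \<le> 1"
    and bd: "\<And>w h. w \<in> borel_measurable (F n) \<Longrightarrow> h \<in> borel_measurable (F n) \<Longrightarrow>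
      (\<integral>\<^sup>+\<omega>. ennreal (Z \<omega> * (\<rho> \<omega> * (\<bar>w \<omega>\<bar> + \<bar>h \<omega> \<bullet> incr S (Suc n) \<omega>\<bar> / (1 + norm (incr S (Suc n) \<omega>))))) \<partial>M)
      \<le> (\<integral>\<^sup>+\<omega>. ennreal (Z \<omega> * (max 0 (- (w \<omega> + h \<omega> \<bullet> incr S (Suc n) \<omega>)) + max 0 (w \<omega>))) \<partial>M)"
    by (rule weighted_one_period_bound[OF n ZM Z01]) (rule that; assumption)
  have eM[measurable]: "\<eta> \<in> borel_measurable M" by (rule measurable_F_M[OF nT e])
  let ?X = "incr S (Suc n)"
  \<comment> \<open>The product collects all weights: \<open>Z\<close> from the shortfall,
    \<open>\<rho>\<close> from the one-period bound, \<open>\<eta>\<close> from the induction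
    hypothesis, and the scaling that tames the increment.\<close>
  define \<theta> where "\<theta> \<omega> = Z \<omega> * \<rho> \<omega> * \<eta> \<omega> / (1 + norm (?X \<omega>))" for \<omega>
  have pos: "0 < 1 + norm (?X \<omega>)" for \<omega> by (simp add: add_pos_nonneg)
  have th_m: "\<theta> \<in> borel_measurable (F (Suc n))"
  proof -
    have [measurable]: "\<rho> \<in> borel_measurable (F (Suc n))" "\<eta> \<in> borel_measurable (F (Suc n))"
      "?X \<in> borel_measurable (F (Suc n))"
      by (rule measurable_F_mono[OF _ n r], simp, rule measurable_F_mono[OF _ n e], simp, rule measurable_incr[OF n])
    note Z[measurable]
    show ?thesis unfolding \<theta>_def by measurable
  qed
  have th01: "0 < \<theta> \<omega> \<and> \<theta> \<omega> \<le> 1" for \<omega>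
  proof -
    have "Z \<omega> * \<rho> \<omega> * \<eta> \<omega> \<le> 1"
      using Z01[of \<omega>] r01[of \<omega>] e01[of \<omega>] by (intro mult_le_one) (auto simp: less_imp_le)
    then have "Z \<omega> * \<rho> \<omega> * \<eta> \<omega> \<le> 1 + norm (?X \<omega>)" using norm_ge_zero[of "?X \<omega>"] by linarith
    then show ?thesis unfolding \<theta>_def using Z01[of \<omega>] r01[of \<omega>] e01[of \<omega>] pos[of \<omega>] by simp
  qed
  have "(\<integral>\<^sup>+\<omega>. ennreal (\<theta> \<omega> * \<bar>wealth (Suc n) S w0 \<phi> \<omega>\<bar>) \<partial>M)
       \<le> ennreal \<bar>w0\<bar> + of_nat (Suc n) * (\<integral>\<^sup>+\<omega>. ennreal (max 0 (- wealth T S w0 \<phi> \<omega>)) \<partial>M)"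
    if phi: "\<phi> \<in> strategies F T" for \<phi>
  proof -
    let ?W = "wealth n S w0 \<phi>"
    have Wm: "?W \<in> borel_measurable (F n)" by (rule measurable_wealth[OF phi nT])
    have pm: "\<phi> (Suc n) \<in> borel_measurable (F n)" by (rule measurable_strategy[OF phi n])
    have W1: "wealth (Suc n) S w0 \<phi> \<in> borel_measurable (F (Suc n))" by (rule measurable_wealth[OF phi n])
    have [measurable]: "?W \<in> borel_measurable M" "wealth (Suc n) S w0 \<phi> \<in> borel_measurable M"
      by (rule measurable_F_M[OF nT Wm], rule measurable_F_M[OF n W1])
    \<comment> \<open>Multiplying by \<open>\<eta>\<close> bounds the term
      \<open>max 0 (w \<omega>)\<close> of the one-period estimate by the integrand of the induction
      hypothesis, while \<open>\<eta> \<omega> \<le> 1\<close> lets the shortfall absorb the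
      factor.\<close>
    define w where "w \<omega> = \<eta> \<omega> * ?W \<omega>" for \<omega>
    define h where "h \<omega> = \<eta> \<omega> *\<^sub>R \<phi> (Suc n) \<omega>" for \<omega>
    have wm: "w \<in> borel_measurable (F n)" and hm: "h \<in> borel_measurable (F n)"
      unfolding w_def h_def using Wm pm e by measurable
    have "(\<integral>\<^sup>+\<omega>. ennreal (\<theta> \<omega> * \<bar>wealth (Suc n) S w0 \<phi> \<omega>\<bar>) \<partial>M)
      \<le> (\<integral>\<^sup>+\<omega>. ennreal (Z \<omega> * (\<rho> \<omega> * (\<bar>w \<omega>\<bar> + \<bar>h \<omega> \<bullet> ?X \<omega>\<bar> / (1 + norm (?X \<omega>))))) \<partial>M)"
    proof (intro nn_integral_mono ennreal_leI)
      fix \<omega>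
      have "\<bar>wealth (Suc n) S w0 \<phi> \<omega>\<bar> / (1 + norm (?X \<omega>))
          \<le> (\<bar>?W \<omega>\<bar> + \<bar>\<phi> (Suc n) \<omega> \<bullet> ?X \<omega>\<bar>) / (1 + norm (?X \<omega>))"
        unfolding wealth_Suc by (intro divide_right_mono) (auto simp: pos less_imp_le)
      also have "\<dots> \<le> \<bar>?W \<omega>\<bar> + \<bar>\<phi> (Suc n) \<omega> \<bullet> ?X \<omega>\<bar> / (1 + norm (?X \<omega>))"
        unfolding add_divide_distrib
        by (intro add_right_mono) (simp add: divide_le_eq pos mult_le_cancel_left1)
      finally have "Z \<omega> * \<rho> \<omega> * \<eta> \<omega> * (\<bar>wealth (Suc n) S w0 \<phi> \<omega>\<bar> / (1 + norm (?X \<omega>)))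
          \<le> Z \<omega> * \<rho> \<omega> * \<eta> \<omega> * (\<bar>?W \<omega>\<bar> + \<bar>\<phi> (Suc n) \<omega> \<bullet> ?X \<omega>\<bar> / (1 + norm (?X \<omega>)))"
        using Z01[of \<omega>] r01[of \<omega>] e01[of \<omega>] by (intro mult_left_mono) auto
      also have "\<dots> = Z \<omega> * (\<rho> \<omega> * (\<bar>w \<omega>\<bar> + \<bar>h \<omega> \<bullet> ?X \<omega>\<bar> / (1 + norm (?X \<omega>))))"
        using e01[of \<omega>] by (simp add: w_def h_def abs_mult distrib_left mult_ac)
      finally show "\<theta> \<omega> * \<bar>wealth (Suc n) S w0 \<phi> \<omega>\<bar>
          \<le> Z \<omega> * (\<rho> \<omega> * (\<bar>w \<omega>\<bar> + \<bar>h \<omega> \<bullet> ?X \<omega>\<bar> / (1 + norm (?X \<omega>))))"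
        by (simp add: \<theta>_def)
    qed
    also have "\<dots> \<le> (\<integral>\<^sup>+\<omega>. ennreal (Z \<omega> * (max 0 (- (w \<omega> + h \<omega> \<bullet> ?X \<omega>)) + max 0 (w \<omega>))) \<partial>M)"
      by (rule bd[OF wm hm])
    also have "\<dots> \<le> (\<integral>\<^sup>+\<omega>. ennreal (Z \<omega> * max 0 (- wealth (Suc n) S w0 \<phi> \<omega>)) + ennreal (\<eta> \<omega> * \<bar>?W \<omega>\<bar>) \<partial>M)"
    proof (rule nn_integral_mono)
      fix \<omega>
      have "w \<omega> + h \<omega> \<bullet> ?X \<omega> = \<eta> \<omega> * wealth (Suc n) S w0 \<phi> \<omega>"
        by (simp add: w_def h_def wealth_Suc distrib_left)
      then have "max 0 (- (w \<omega> + h \<omega> \<bullet> ?X \<omega>)) = \<eta> \<omega> * max 0 (- wealth (Suc n) S w0 \<phi> \<omega>)"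
        using e01[of \<omega>] by (simp add: max_mult_distrib_left)
      also have "\<dots> \<le> 1 * max 0 (- wealth (Suc n) S w0 \<phi> \<omega>)"
        using e01[of \<omega>] by (intro mult_right_mono) auto
      finally have 1: "Z \<omega> * max 0 (- (w \<omega> + h \<omega> \<bullet> ?X \<omega>)) \<le> Z \<omega> * max 0 (- wealth (Suc n) S w0 \<phi> \<omega>)"
        using Z01[of \<omega>] by (intro mult_left_mono) auto
      have "max 0 (w \<omega>) \<le> \<eta> \<omega> * \<bar>?W \<omega>\<bar>"
        using e01[of \<omega>] by (auto simp: w_def max_def intro!: mult_left_mono)
      moreover have "Z \<omega> * max 0 (w \<omega>) \<le> 1 * max 0 (w \<omega>)"
        using Z01[of \<omega>] by (intro mult_right_mono) auto
      ultimately have "Z \<omega> * max 0 (w \<omega>) \<le> \<eta> \<omega> * \<bar>?W \<omega>\<bar>" by linarith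
      with 1 have "Z \<omega> * (max 0 (- (w \<omega> + h \<omega> \<bullet> ?X \<omega>)) + max 0 (w \<omega>))
          \<le> Z \<omega> * max 0 (- wealth (Suc n) S w0 \<phi> \<omega>) + \<eta> \<omega> * \<bar>?W \<omega>\<bar>"
        by (simp add: distrib_left)
      then show "ennreal (Z \<omega> * (max 0 (- (w \<omega> + h \<omega> \<bullet> ?X \<omega>)) + max 0 (w \<omega>)))
          \<le> ennreal (Z \<omega> * max 0 (- wealth (Suc n) S w0 \<phi> \<omega>)) + ennreal (\<eta> \<omega> * \<bar>?W \<omega>\<bar>)"
        using Z01[of \<omega>] e01[of \<omega>]
        by (subst ennreal_plus[symmetric]) (auto intro: ennreal_leI simp del: ennreal_plus)
    qed
    also have "\<dots> = (\<integral>\<^sup>+\<omega>. ennreal (Z \<omega> * max 0 (- wealth (Suc n) S w0 \<phi> \<omega>)) \<partial>M) + (\<integral>\<^sup>+\<omega>. ennreal (\<eta> \<omega> * \<bar>?W \<omega>\<bar>) \<partial>M)"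
      by (rule nn_integral_add) measurable
    also have "\<dots> \<le> (\<integral>\<^sup>+\<omega>. ennreal (max 0 (- wealth T S w0 \<phi> \<omega>)) \<partial>M) +
        (ennreal \<bar>w0\<bar> + of_nat n * (\<integral>\<^sup>+\<omega>. ennreal (max 0 (- wealth T S w0 \<phi> \<omega>)) \<partial>M))"
      by (intro add_mono ZB[OF phi] eB[OF phi])
    also have "\<dots> = ennreal \<bar>w0\<bar> + of_nat (Suc n) * (\<integral>\<^sup>+\<omega>. ennreal (max 0 (- wealth T S w0 \<phi> \<omega>)) \<partial>M)"
      by (simp add: distrib_right ac_simps)
    finally show ?thesis .
  qed
  then show ?case using th_m th01 by blast
qed

end

section \<open>Almost sure convergence of near-minimisers\<close>

text \<open>The infima over the shrinking sets increase and are bounded, hence converge. For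
  \<open>m\<close> beyond \<open>n\<close> the midpoint still lies in the larger set, so its value
  is at least \<open>j n\<close>, while the two end points have values close to \<open>j n\<close>
  and \<open>j m\<close>, which differ little.\<close>

lemma near_minimisers_midpoint_defect:
  fixes \<Phi> :: "nat \<Rightarrow> 'a set" and J :: "'a \<Rightarrow> real"
  assumes ne: "\<And>n. \<Phi> n \<noteq> {}" and dec: "\<And>m n. n \<le> m \<Longrightarrow> \<Phi> m \<subseteq> \<Phi> n"
    and mid: "\<And>n x y. x \<in> \<Phi> n \<Longrightarrow> y \<in> \<Phi> n \<Longrightarrow> mid x y \<in> \<Phi> n"
    and J0: "\<And>x. x \<in> \<Phi> 0 \<Longrightarrow> 0 \<le> J x" and JB: "\<And>x. x \<in> \<Phi> 0 \<Longrightarrow> J x \<le> B"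
  obtains x where "\<And>n. x n \<in> \<Phi> n"
    "\<And>e. 0 < e \<Longrightarrow> \<exists>N. \<forall>n\<ge>N. \<forall>m\<ge>n. (J (x n) + J (x m)) / 2 - J (mid (x n) (x m)) < e"
proof -
  define j where "j n = Inf (J ` \<Phi> n)" for n
  have sub0: "\<Phi> n \<subseteq> \<Phi> 0" for n using dec by simp
  have bdd: "bdd_below (J ` \<Phi> n)" for n
    by (rule bdd_belowI[of _ 0]) (use sub0 J0 in blast)
  have lower: "j n \<le> J x" if "x \<in> \<Phi> n" for n x
    unfolding j_def by (rule cINF_lower[OF bdd that])
  have "j n \<le> j m" if "n \<le> m" for n m
    unfolding j_def by (rule cINF_superset_mono[OF ne bdd dec[OF that]]) simp
  then have "incseq j" by (simp add: incseq_def)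
  moreover have jB: "j n \<le> B" for n
  proof -
    obtain x where "x \<in> \<Phi> n" using ne by blast
    then show ?thesis using lower[of x n] JB[of x] sub0 by force
  qed
  ultimately obtain L where L: "j \<longlonglongrightarrow> L" "\<And>n. j n \<le> L"
    using incseq_convergent[of j B] by blast
  have "\<exists>x\<in>\<Phi> n. J x < j n + 1 / Suc n" for n
    using cINF_less_iff[OF ne bdd, of n "j n + 1 / Suc n"] unfolding j_def by simp
  then obtain x where x: "\<And>n. x n \<in> \<Phi> n" "\<And>n. J (x n) < j n + 1 / Suc n" by metis
  have "\<exists>N. \<forall>n\<ge>N. \<forall>m\<ge>n. (J (x n) + J (x m)) / 2 - J (mid (x n) (x m)) < e" if e: "0 < e" for e
  proof -
    obtain N1 where "\<And>n. n \<ge> N1 \<Longrightarrow> norm (j n - L) < e"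
      using L(1) e unfolding LIMSEQ_iff by blast
    then have N1: "\<And>n. n \<ge> N1 \<Longrightarrow> L - j n < e" by (force simp: abs_less_iff)
    obtain N2 :: nat where N2: "1 / Suc N2 < e / 2" using e by (metis half_gt_zero nat_approx_posE)
    have "(J (x n) + J (x m)) / 2 - J (mid (x n) (x m)) < e" if nm: "n \<ge> max N1 N2" "m \<ge> n" for n m
    proof -
      have "mid (x n) (x m) \<in> \<Phi> n" using x(1) dec[OF nm(2)] by (intro mid) auto
      then have 1: "j n \<le> J (mid (x n) (x m))" by (rule lower)
      have "1 / real (Suc n) \<le> 1 / real (Suc N2)" "1 / real (Suc m) \<le> 1 / real (Suc N2)"
        using nm by (auto intro!: divide_left_mono simp del: of_nat_Suc)
      then have "J (x n) \<le> j n + e / 2" "J (x m) \<le> j m + e / 2"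
        using x(2)[of n] x(2)[of m] N2 by linarith+
      moreover have "j m - j n < e" using N1[of n] nm L(2)[of m] by simp
      ultimately show ?thesis using 1 by argo
    qed
    then show ?thesis by blast
  qed
  with x(1) show thesis by (rule that)
qed

text \<open>Quantitative strict convexity. \<open>sqrt (1 + x\<^sup>2)\<close> is the length of the
  vector (1, x), and its midpoint defect is, up to a factor, the defect in the Cauchy-Schwarz
  inequality for (1, x) and (1, y), which Lagrange's identity expresses by
  \<open>(x - y)\<^sup>2\<close>. The power \<open>R ^ 3\<close> comes from
  \<open>a * b \<le> R * R\<close> and \<open>(a + b) / 2 + m \<le> 2 * R\<close>.\<close>

lemma sqrt_midpoint_defect:
  fixes x y R :: real
  assumes "sqrt (1 + x\<^sup>2) \<le> R" "sqrt (1 + y\<^sup>2) \<le> R"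
  shows "(x - y)\<^sup>2 \<le> 8 * R ^ 3 * ((sqrt (1 + x\<^sup>2) + sqrt (1 + y\<^sup>2)) / 2 - sqrt (1 + ((x + y) / 2)\<^sup>2))"
    and "0 \<le> (sqrt (1 + x\<^sup>2) + sqrt (1 + y\<^sup>2)) / 2 - sqrt (1 + ((x + y) / 2)\<^sup>2)"
proof -
  define a b m where "a = sqrt (1 + x\<^sup>2)" and "b = sqrt (1 + y\<^sup>2)" and "m = sqrt (1 + ((x + y) / 2)\<^sup>2)"
  have sq: "a\<^sup>2 = 1 + x\<^sup>2" "b\<^sup>2 = 1 + y\<^sup>2" "m\<^sup>2 = 1 + ((x + y) / 2)\<^sup>2"
    unfolding a_def b_def m_def by (simp_all add: add_nonneg_nonneg)
  have ge1: "1 \<le> a" "1 \<le> b" "1 \<le> m" unfolding a_def b_def m_def by simp_all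
  have prod: "(a * b)\<^sup>2 = (1 + x * y)\<^sup>2 + (x - y)\<^sup>2"
    unfolding power_mult_distrib sq by (simp add: power2_eq_square algebra_simps)
  then have "(1 + x * y)\<^sup>2 \<le> (a * b)\<^sup>2" by simp
  moreover have "0 \<le> a * b" by (rule mult_nonneg_nonneg) (use ge1 in linarith)+
  ultimately have ab: "1 + x * y \<le> a * b" by (rule power2_le_imp_le)
  define D where "D = (a + b) / 2 - m"
  have D: "D * ((a + b) / 2 + m) = (a * b - (1 + x * y)) / 2"
  proof -
    have "D * ((a + b) / 2 + m) = (a\<^sup>2 + 2 * (a * b) + b\<^sup>2) / 4 - m\<^sup>2"
      unfolding D_def by (simp add: power2_eq_square field_simps)
    also have "\<dots> = (a * b - (1 + x * y)) / 2"
      unfolding sq by (simp add: power2_eq_square field_simps)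
    finally show ?thesis .
  qed
  have p: "0 < (a + b) / 2 + m" using ge1 by argo
  have D0: "0 \<le> D"
  proof (rule ccontr)
    assume "\<not> 0 \<le> D"
    then have "D * ((a + b) / 2 + m) < 0" using p by (simp add: mult_neg_pos)
    then show False using D ab by simp
  qed
  then show "0 \<le> (sqrt (1 + x\<^sup>2) + sqrt (1 + y\<^sup>2)) / 2 - sqrt (1 + ((x + y) / 2)\<^sup>2)"
    unfolding D_def a_def b_def m_def .
  have R: "a \<le> R" "b \<le> R" using assms by (auto simp: a_def b_def)
  have "(x - y)\<^sup>2 = (a * b - (1 + x * y)) * (a * b + (1 + x * y))"
    using prod by (simp add: power2_eq_square algebra_simps)
  also have "\<dots> \<le> (a * b - (1 + x * y)) * (2 * (a * b))"
    using ab by (intro mult_left_mono) auto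
  also have "\<dots> = 4 * (a * b) * (D * ((a + b) / 2 + m))" unfolding D by simp
  also have "\<dots> \<le> 4 * (R * R) * (D * (2 * R))"
  proof (intro mult_mono)
    show "(a + b) / 2 + m \<le> 2 * R" using R D0 unfolding D_def by argo
  qed (use R ge1 D0 p in auto)
  also have "\<dots> = 8 * R ^ 3 * D" by (simp add: power3_eq_cube)
  finally show "(x - y)\<^sup>2 \<le> 8 * R ^ 3 * ((sqrt (1 + x\<^sup>2) + sqrt (1 + y\<^sup>2)) / 2 - sqrt (1 + ((x + y) / 2)\<^sup>2))"
    unfolding D_def a_def b_def m_def .
qed

lemma AE_bounded_of_geometric_integrals:
  fixes f :: "nat \<Rightarrow> 'w \<Rightarrow> real"
  assumes [measurable]: "\<And>k. f k \<in> borel_measurable M" and "0 \<le> B"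
    and bd: "\<And>k. (\<integral>\<^sup>+\<omega>. ennreal (f k \<omega>) \<partial>M) \<le> ennreal (B * (1/2) ^ k)"
  shows "AE \<omega> in M. \<exists>c. \<forall>k. f k \<omega> \<le> c"
proof -
  have "(\<integral>\<^sup>+\<omega>. (\<Sum>k. ennreal (f k \<omega>)) \<partial>M) = (\<Sum>k. \<integral>\<^sup>+\<omega>. ennreal (f k \<omega>) \<partial>M)"
    by (rule nn_integral_suminf) measurable
  also have "\<dots> \<le> (\<Sum>k. ennreal (B * (1/2) ^ k))" by (intro suminf_le bd) auto
  also have "\<dots> = ennreal (\<Sum>k. B * (1/2) ^ k)"
    using \<open>0 \<le> B\<close> by (intro suminf_ennreal2) (auto intro!: summable_mult summable_geometric)
  finally have "(\<integral>\<^sup>+\<omega>. (\<Sum>k. ennreal (f k \<omega>)) \<partial>M) \<noteq> \<infinity>" by (auto simp: top_unique)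
  then have "AE \<omega> in M. (\<Sum>k. ennreal (f k \<omega>)) \<noteq> \<infinity>"
    by (intro nn_integral_noteq_infinite) auto
  then show ?thesis
  proof eventually_elim
    case (elim \<omega>)
    let ?s = "\<Sum>k. ennreal (f k \<omega>)"
    have "f k \<omega> \<le> enn2real ?s" for k
    proof -
      have "ennreal (f k \<omega>) \<le> ?s"
        using sum_le_suminf[of "\<lambda>k. ennreal (f k \<omega>)" "{k}"] by simp
      then show ?thesis using elim
        by (metis enn2real_mono ennreal_enn2real_if enn2real_nonneg ennreal_le_iff infinity_ennreal_def top.not_eq_extremum)
    qed
    then show ?case by blast
  qed
qed

text \<open>The weighted first moments bound a path only up to growth \<open>2 ^ k\<close>, and the
  convexity estimate loses the cube of that, \<open>8 ^ k\<close>. Of the rate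
  \<open>(1/64) ^ k\<close>, a factor \<open>(1/2) ^ k\<close> pays for an almost sure bound; the
  remaining \<open>(1/32) ^ k\<close> against \<open>8 ^ k\<close> leaves \<open>(1/4) ^ k\<close>
  for the squared increments, whose roots are summable.\<close>

lemma AE_convergent_of_small_defects:
  fixes V :: "nat \<Rightarrow> 'w \<Rightarrow> real" and \<eta> :: "'w \<Rightarrow> real"
  defines "s \<equiv> \<lambda>x::real. sqrt (1 + x\<^sup>2)"
  assumes [measurable]: "\<And>k. V k \<in> borel_measurable M" "\<eta> \<in> borel_measurable M"
    and e0: "\<And>\<omega>. 0 < \<eta> \<omega>" and "0 \<le> B"
    and bd: "\<And>k. (\<integral>\<^sup>+\<omega>. ennreal (\<eta> \<omega> * s (V k \<omega>)) \<partial>M) \<le> ennreal B"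
    and def: "\<And>k. (\<integral>\<^sup>+\<omega>. ennreal (\<eta> \<omega> * ((s (V k \<omega>) + s (V (Suc k) \<omega>)) / 2
        - s ((V k \<omega> + V (Suc k) \<omega>) / 2))) \<partial>M) \<le> ennreal ((1/64) ^ k)"
  shows "AE \<omega> in M. convergent (\<lambda>k. V k \<omega>)"
proof -
  let ?D = "\<lambda>k \<omega>. (s (V k \<omega>) + s (V (Suc k) \<omega>)) / 2 - s ((V k \<omega> + V (Suc k) \<omega>) / 2)"
  have [measurable]: "s \<in> borel_measurable borel" unfolding s_def by measurable
  have s1: "1 \<le> s x" for x unfolding s_def by simp
  have scale: "(\<integral>\<^sup>+\<omega>. ennreal (c * f \<omega>) \<partial>M) \<le> ennreal (c * b)"
    if [measurable]: "f \<in> borel_measurable M" and "(\<integral>\<^sup>+\<omega>. ennreal (f \<omega>) \<partial>M) \<le> ennreal b" "0 \<le> c"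
    for f :: "'w \<Rightarrow> real" and b c
    using that by (simp add: ennreal_mult' nn_integral_cmult mult_left_mono)
  have "AE \<omega> in M. \<exists>c. \<forall>k. (1/2) ^ k * (\<eta> \<omega> * s (V k \<omega>)) \<le> c"
    by (rule AE_bounded_of_geometric_integrals[OF _ \<open>0 \<le> B\<close>])
       (use scale[OF _ bd] in \<open>auto simp: mult.commute[of B]\<close>)
  moreover have "AE \<omega> in M. \<exists>c. \<forall>k. 32 ^ k * (\<eta> \<omega> * ?D k \<omega>) \<le> c"
  proof (rule AE_bounded_of_geometric_integrals[where B=1])
    fix k
    have "(32::real) ^ k * (1/64) ^ k = 1 * (1/2) ^ k" by (simp add: power_mult_distrib[symmetric])
    then show "(\<integral>\<^sup>+\<omega>. ennreal (32 ^ k * (\<eta> \<omega> * ?D k \<omega>)) \<partial>M) \<le> ennreal (1 * (1/2) ^ k)"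
      using scale[OF _ def, of k "32 ^ k"] by simp
  qed auto
  ultimately show ?thesis
  proof eventually_elim
    case (elim \<omega>)
    then obtain c1 c2 where c1: "\<And>k. (1/2) ^ k * (\<eta> \<omega> * s (V k \<omega>)) \<le> c1"
      and c2: "\<And>k. 32 ^ k * (\<eta> \<omega> * ?D k \<omega>) \<le> c2" by blast
    define c where "c = c1 / \<eta> \<omega>"
    have sV: "s (V k \<omega>) \<le> c * 2 ^ k" for k
    proof -
      have "\<eta> \<omega> * s (V k \<omega>) \<le> c1 * 2 ^ k"
        using c1[of k] by (simp add: field_simps power_one_over)
      then show ?thesis using e0[of \<omega>] by (simp add: c_def field_simps)
    qed
    have cpos: "0 < c" using sV[of 0] s1[of "V 0 \<omega>"] by simp
    \<comment> \<open>64 is \<open>8 * 2 ^ 3\<close>: the bound belonging to \<open>Suc k\<close>,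
      one doubling later, serves for both end points.\<close>
    define K where "K = 64 * c ^ 3 * (c2 / \<eta> \<omega>)"
    have sq: "(V k \<omega> - V (Suc k) \<omega>)\<^sup>2 \<le> K * (1/4) ^ k" for k
    proof -
      let ?R = "c * 2 ^ Suc k"
      have "s (V k \<omega>) \<le> ?R" 
      proof -
        have "c * 2 ^ k \<le> ?R" by (rule mult_left_mono) (use cpos in auto)
        with sV[of k] show ?thesis by (rule order_trans)
      qed
      moreover have "s (V (Suc k) \<omega>) \<le> ?R" by (rule sV)
      ultimately have "(V k \<omega> - V (Suc k) \<omega>)\<^sup>2 \<le> 8 * ?R ^ 3 * ?D k \<omega>"
        unfolding s_def by (rule sqrt_midpoint_defect(1))
      also have "\<dots> \<le> 8 * ?R ^ 3 * (c2 / \<eta> \<omega> / 32 ^ k)"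
      proof (rule mult_left_mono)
        show "?D k \<omega> \<le> c2 / \<eta> \<omega> / 32 ^ k" using c2[of k] e0[of \<omega>] by (simp add: field_simps)
      qed (use cpos in simp)
      also have "\<dots> = 64 * c ^ 3 * (c2 / \<eta> \<omega>) * ((2 ^ k) ^ 3 / 32 ^ k)"
        by (simp add: power_mult_distrib field_simps)
      also have "((2::real) ^ k) ^ 3 / 32 ^ k = (1/4) ^ k"
      proof -
        have "((2::real) ^ k) ^ 3 = 8 ^ k" by (simp add: power_mult[symmetric] mult.commute[of k 3]) (simp add: power_mult)
        then show ?thesis by (simp add: power_divide[symmetric])
      qed
      finally show ?thesis by (simp add: K_def)
    qed
    have diff: "\<bar>V k \<omega> - V (Suc k) \<omega>\<bar> \<le> sqrt K * (1/2) ^ k" for k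
    proof -
      have "\<bar>V k \<omega> - V (Suc k) \<omega>\<bar> = sqrt ((V k \<omega> - V (Suc k) \<omega>)\<^sup>2)" by simp
      also have "\<dots> \<le> sqrt (K * (1/4) ^ k)" using sq by (intro real_sqrt_le_mono)
      also have "\<dots> = sqrt K * (1/2) ^ k" by (simp add: real_sqrt_mult real_sqrt_power real_sqrt_divide)
      finally show ?thesis .
    qed
    have "summable (\<lambda>k. V (Suc k) \<omega> - V k \<omega>)"
      by (rule summable_comparison_test'[where g="\<lambda>k. sqrt K * (1/2) ^ k" and N=0])
         (use diff in \<open>auto simp: abs_minus_commute intro!: summable_mult summable_geometric\<close>)
    then have "convergent (\<lambda>n. V n \<omega> - V 0 \<omega>)"
      using sum_lessThan_telescope[of "\<lambda>k. V k \<omega>"] by (simp add: summable_iff_convergent)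
    from convergent_add[OF this convergent_const[of "V 0 \<omega>"]]
    show ?case by simp
  qed
qed

section \<open>Sequences of strategies with convergent wealth\<close>

definition strategy_mid :: "(nat \<Rightarrow> 'w \<Rightarrow> real^'d) \<Rightarrow> (nat \<Rightarrow> 'w \<Rightarrow> real^'d) \<Rightarrow> nat \<Rightarrow> 'w \<Rightarrow> real^'d"
  where "strategy_mid \<phi> \<psi> t \<omega> = (1/2) *\<^sub>R (\<phi> t \<omega> + \<psi> t \<omega>)"

lemma wealth_strategy_mid:
  "wealth t S w (strategy_mid \<phi> \<psi>) \<omega> = (wealth t S w \<phi> \<omega> + wealth t S w \<psi> \<omega>) / 2"
  by (simp add: wealth_def strategy_mid_def inner_add_left sum.distrib sum_divide_distrib[symmetric] field_simps)

lemma strategy_mid_in_strategies: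
  assumes "\<phi> \<in> strategies F T" "\<psi> \<in> strategies F T"
  shows "strategy_mid \<phi> \<psi> \<in> strategies F T"
  using assms unfolding strategies_def strategy_mid_def[abs_def]
  by (auto intro!: borel_measurable_scaleR borel_measurable_add borel_measurable_const)

context arbitrage_free_market
begin

text \<open>\<open>J\<close> adds the penalties of all dates, so a single minimisation makes the
  wealth converge at every date. The integrand \<open>s\<close> grows linearly, so the weighted
  first moments keep \<open>J\<close> finite and bounded; it is strictly convex, so small midpoint
  defects force the wealths together.\<close>

lemma convergent_wealth_subsequence:
  fixes \<Phi> :: "nat \<Rightarrow> (nat \<Rightarrow> 'w \<Rightarrow> real^'d) set"
  assumes strat: "\<Phi> 0 \<subseteq> strategies F T"
    and ne: "\<And>n. \<Phi> n \<noteq> {}" and dec: "\<And>m n. n \<le> m \<Longrightarrow> \<Phi> m \<subseteq> \<Phi> n"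
    and mid: "\<And>n \<phi> \<psi>. \<phi> \<in> \<Phi> n \<Longrightarrow> \<psi> \<in> \<Phi> n \<Longrightarrow> strategy_mid \<phi> \<psi> \<in> \<Phi> n"
    and K: "0 \<le> K" "\<And>\<phi>. \<phi> \<in> \<Phi> 0 \<Longrightarrow> (\<integral>\<^sup>+\<omega>. ennreal (max 0 (- wealth T S w0 \<phi> \<omega>)) \<partial>M) \<le> ennreal K"
  obtains \<phi> where "\<And>n. \<phi> n \<in> \<Phi> n"
    "\<And>t. t \<le> T \<Longrightarrow> AE \<omega> in M. convergent (\<lambda>n. wealth t S w0 (\<phi> n) \<omega>)"
proof -
  define s where "s x = sqrt (1 + x\<^sup>2)" for x :: real
  have s_meas[measurable]: "s \<in> borel_measurable borel" unfolding s_def by measurable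
  have s1: "1 \<le> s x" for x unfolding s_def by simp
  have s2: "s x \<le> 1 + \<bar>x\<bar>" for x unfolding s_def by (rule real_le_lsqrt) (auto simp: power2_sum)
  define good where "good t \<eta> \<longleftrightarrow> \<eta> \<in> borel_measurable (F t) \<and> (\<forall>\<omega>. 0 < \<eta> \<omega> \<and> \<eta> \<omega> \<le> 1) \<and>
    (\<forall>\<phi>\<in>strategies F T. (\<integral>\<^sup>+\<omega>. ennreal (\<eta> \<omega> * \<bar>wealth t S w0 \<phi> \<omega>\<bar>) \<partial>M)
       \<le> ennreal \<bar>w0\<bar> + of_nat t * (\<integral>\<^sup>+\<omega>. ennreal (max 0 (- wealth T S w0 \<phi> \<omega>)) \<partial>M))"
    for t and \<eta> :: "'w \<Rightarrow> real"
  have "\<forall>t. \<exists>\<eta>. t \<le> T \<longrightarrow> good t \<eta>"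
    using weighted_wealth_bound unfolding good_def by blast
  then obtain \<eta> :: "nat \<Rightarrow> 'w \<Rightarrow> real" where "\<And>t. t \<le> T \<Longrightarrow> good t (\<eta> t)" by metis
  then have em: "\<And>t. t \<le> T \<Longrightarrow> \<eta> t \<in> borel_measurable (F t)"
    and e01: "\<And>t \<omega>. t \<le> T \<Longrightarrow> 0 < \<eta> t \<omega> \<and> \<eta> t \<omega> \<le> 1"
    and eb: "\<And>t \<phi>. t \<le> T \<Longrightarrow> \<phi> \<in> strategies F T \<Longrightarrow> (\<integral>\<^sup>+\<omega>. ennreal (\<eta> t \<omega> * \<bar>wealth t S w0 \<phi> \<omega>\<bar>) \<partial>M)
       \<le> ennreal \<bar>w0\<bar> + of_nat t * (\<integral>\<^sup>+\<omega>. ennreal (max 0 (- wealth T S w0 \<phi> \<omega>)) \<partial>M)"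
    unfolding good_def by blast+
  have eM[measurable]: "\<eta> t \<in> borel_measurable M" if "t \<le> T" for t
    by (rule measurable_F_M[OF that em[OF that]])
  define W where "W t \<phi> = wealth t S w0 \<phi>" for t \<phi>
  have WM[measurable]: "W t \<phi> \<in> borel_measurable M" if "\<phi> \<in> \<Phi> 0" "t \<le> T" for t \<phi>
    unfolding W_def using that strat by (intro measurable_F_M[OF that(2) measurable_wealth]) auto
  define C where "C = 1 + \<bar>w0\<bar> + T * K"
  have C0: "0 \<le> C" unfolding C_def using K(1) by simp
  have nb: "(\<integral>\<^sup>+\<omega>. ennreal (\<eta> t \<omega> * s (W t \<phi> \<omega>)) \<partial>M) \<le> ennreal C"
    if phi: "\<phi> \<in> \<Phi> 0" and t: "t \<le> T" for t \<phi>
  proof -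
    note [measurable] = eM[OF t] WM[OF phi t]
    have "(\<integral>\<^sup>+\<omega>. ennreal (\<eta> t \<omega> * s (W t \<phi> \<omega>)) \<partial>M) \<le> (\<integral>\<^sup>+\<omega>. 1 + ennreal (\<eta> t \<omega> * \<bar>W t \<phi> \<omega>\<bar>) \<partial>M)"
    proof (rule nn_integral_mono)
      fix \<omega>
      have "\<eta> t \<omega> * s (W t \<phi> \<omega>) \<le> \<eta> t \<omega> * (1 + \<bar>W t \<phi> \<omega>\<bar>)"
        using e01[OF t] s2 by (intro mult_left_mono) (auto simp: less_imp_le)
      also have "\<dots> \<le> 1 + \<eta> t \<omega> * \<bar>W t \<phi> \<omega>\<bar>" using e01[OF t] by (simp add: distrib_left)
      finally have "ennreal (\<eta> t \<omega> * s (W t \<phi> \<omega>)) \<le> ennreal (1 + \<eta> t \<omega> * \<bar>W t \<phi> \<omega>\<bar>)" by (rule ennreal_leI)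
      then show "ennreal (\<eta> t \<omega> * s (W t \<phi> \<omega>)) \<le> 1 + ennreal (\<eta> t \<omega> * \<bar>W t \<phi> \<omega>\<bar>)"
        using e01[OF t, of \<omega>] by (simp add: ennreal_plus)
    qed
    also have "\<dots> = 1 + (\<integral>\<^sup>+\<omega>. ennreal (\<eta> t \<omega> * \<bar>W t \<phi> \<omega>\<bar>) \<partial>M)"
      by (subst nn_integral_add) (auto simp: emeasure_space_1)
    also have "\<dots> \<le> 1 + (ennreal \<bar>w0\<bar> + of_nat t * ennreal K)"
    proof (rule add_left_mono)
      have "(\<integral>\<^sup>+\<omega>. ennreal (\<eta> t \<omega> * \<bar>W t \<phi> \<omega>\<bar>) \<partial>M)
        \<le> ennreal \<bar>w0\<bar> + of_nat t * (\<integral>\<^sup>+\<omega>. ennreal (max 0 (- wealth T S w0 \<phi> \<omega>)) \<partial>M)"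
        unfolding W_def by (rule eb[OF t subsetD[OF strat phi]])
      also have "\<dots> \<le> ennreal \<bar>w0\<bar> + of_nat t * ennreal K"
        by (intro add_left_mono mult_left_mono K(2)[OF phi]) simp
      finally show "(\<integral>\<^sup>+\<omega>. ennreal (\<eta> t \<omega> * \<bar>W t \<phi> \<omega>\<bar>) \<partial>M) \<le> ennreal \<bar>w0\<bar> + of_nat t * ennreal K" .
    qed
    also have "\<dots> \<le> 1 + (ennreal \<bar>w0\<bar> + of_nat T * ennreal K)"
      using t by (intro add_left_mono mult_right_mono) auto
    also have "\<dots> = ennreal C"
      unfolding C_def using K(1) by (simp add: ennreal_of_nat_eq_real_of_nat ennreal_mult'[symmetric] add.assoc)
    finally show ?thesis .
  qed
  have I: "integrable M (\<lambda>\<omega>. \<eta> t \<omega> * s (W t \<phi> \<omega>))"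
    and Ib: "(\<integral>\<omega>. \<eta> t \<omega> * s (W t \<phi> \<omega>) \<partial>M) \<le> C"
    if phi: "\<phi> \<in> \<Phi> 0" and t: "t \<le> T" for t \<phi>
  proof -
    note [measurable] = eM[OF t] WM[OF phi t]
    have pos: "0 \<le> \<eta> t \<omega> * s (W t \<phi> \<omega>)" for \<omega>
      using e01[OF t, of \<omega>] s1[of "W t \<phi> \<omega>"] by simp
    show int: "integrable M (\<lambda>\<omega>. \<eta> t \<omega> * s (W t \<phi> \<omega>))"
      using nb[OF phi t] pos by (intro integrableI_nonneg) (auto simp: le_less_trans)
    show "(\<integral>\<omega>. \<eta> t \<omega> * s (W t \<phi> \<omega>) \<partial>M) \<le> C"
      using nb[OF phi t] nn_integral_eq_integral[OF int] pos C0 by simp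
  qed
  define J where "J \<phi> = (\<Sum>t\<le>T. \<integral>\<omega>. \<eta> t \<omega> * s (W t \<phi> \<omega>) \<partial>M)" for \<phi>
  have J0: "0 \<le> J \<phi>" if "\<phi> \<in> \<Phi> 0" for \<phi>
    unfolding J_def using e01 s1
    by (intro sum_nonneg Bochner_Integration.integral_nonneg mult_nonneg_nonneg) (auto simp: less_imp_le intro: order_trans[OF zero_le_one])
  have JB: "J \<phi> \<le> Suc T * C" if "\<phi> \<in> \<Phi> 0" for \<phi>
    unfolding J_def using sum_bounded_above[of "{..T}" "\<lambda>t. \<integral>\<omega>. \<eta> t \<omega> * s (W t \<phi> \<omega>) \<partial>M" C] Ib[OF that] by simp
  obtain x where x: "\<And>n. x n \<in> \<Phi> n"
    and xd: "\<And>e. 0 < e \<Longrightarrow> \<exists>N. \<forall>n\<ge>N. \<forall>m\<ge>n. (J (x n) + J (x m)) / 2 - J (strategy_mid (x n) (x m)) < e"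
    using near_minimisers_midpoint_defect[of \<Phi> strategy_mid J, OF ne dec mid J0 JB] by metis
  have "\<forall>k. \<exists>N. \<forall>n\<ge>N. \<forall>m\<ge>n. (J (x n) + J (x m)) / 2 - J (strategy_mid (x n) (x m)) < (1/64) ^ k"
    using xd by simp
  then obtain N where N: "\<And>k n m. n \<ge> N k \<Longrightarrow> m \<ge> n \<Longrightarrow>
      (J (x n) + J (x m)) / 2 - J (strategy_mid (x n) (x m)) < (1/64) ^ k" by metis
  \<comment> \<open>The cumulative sum makes \<open>r\<close> nondecreasing and at least
    \<open>N k\<close>; the summand \<open>k\<close> gives \<open>k \<le> r k\<close>, which puts
    \<open>x (r k)\<close> into \<open>\<Phi> k\<close>.\<close>
  define r where "r k = k + (\<Sum>i\<le>k. N i)" for k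
  have rk: "k \<le> r k" "N k \<le> r k" "r k \<le> r (Suc k)" for k
    unfolding r_def using member_le_sum[of k "{..k}" N] by auto
  have x0: "x n \<in> \<Phi> 0" for n using x[of n] dec[of 0 n] by auto
  show thesis
  proof (rule that[of "\<lambda>k. x (r k)"])
    show "x (r k) \<in> \<Phi> k" for k using x[of "r k"] dec[OF rk(1)[of k]] by auto
    fix t assume t: "t \<le> T"
    let ?D = "\<lambda>u k \<omega>. \<eta> u \<omega> * ((s (W u (x (r k)) \<omega>) + s (W u (x (r (Suc k))) \<omega>)) / 2
        - s ((W u (x (r k)) \<omega> + W u (x (r (Suc k))) \<omega>) / 2))"
    have D0: "0 \<le> ?D u k \<omega>" if "u \<le> T" for u k \<omega>
      using e01[OF that, of \<omega>] unfolding s_def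
      by (intro mult_nonneg_nonneg sqrt_midpoint_defect(2)[OF max.cobounded1 max.cobounded2]) simp
    have Dsplit: "?D u k \<omega> = (\<eta> u \<omega> * s (W u (x (r k)) \<omega>) + \<eta> u \<omega> * s (W u (x (r (Suc k))) \<omega>)) / 2
        - \<eta> u \<omega> * s (W u (strategy_mid (x (r k)) (x (r (Suc k)))) \<omega>)" for u k \<omega>
      unfolding W_def wealth_strategy_mid by (simp add: algebra_simps add_divide_distrib)
    have m0: "strategy_mid (x (r k)) (x (r (Suc k))) \<in> \<Phi> 0" for k by (intro mid x0)
    have Di: "integrable M (?D u k)" if "u \<le> T" for u k
      unfolding Dsplit using I[OF x0 that] I[OF m0 that] by auto
    have Dsum: "(\<Sum>u\<le>T. \<integral>\<omega>. ?D u k \<omega> \<partial>M) = (J (x (r k)) + J (x (r (Suc k)))) / 2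
        - J (strategy_mid (x (r k)) (x (r (Suc k))))" for k
    proof -
      have "(\<integral>\<omega>. ?D u k \<omega> \<partial>M) = ((\<integral>\<omega>. \<eta> u \<omega> * s (W u (x (r k)) \<omega>) \<partial>M) + (\<integral>\<omega>. \<eta> u \<omega> * s (W u (x (r (Suc k))) \<omega>) \<partial>M)) / 2
        - (\<integral>\<omega>. \<eta> u \<omega> * s (W u (strategy_mid (x (r k)) (x (r (Suc k)))) \<omega>) \<partial>M)" if "u \<le> T" for u
        unfolding Dsplit using I[OF x0 that] I[OF m0 that] by simp
      then have "(\<Sum>u\<le>T. \<integral>\<omega>. ?D u k \<omega> \<partial>M) = (\<Sum>u\<le>T. ((\<integral>\<omega>. \<eta> u \<omega> * s (W u (x (r k)) \<omega>) \<partial>M) + (\<integral>\<omega>. \<eta> u \<omega> * s (W u (x (r (Suc k))) \<omega>) \<partial>M)) / 2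
        - (\<integral>\<omega>. \<eta> u \<omega> * s (W u (strategy_mid (x (r k)) (x (r (Suc k)))) \<omega>) \<partial>M))"
        by (intro sum.cong) auto
      then show ?thesis unfolding J_def by (simp add: sum_subtractf sum.distrib sum_divide_distrib[symmetric])
    qed
    \<comment> \<open>The defects at the single dates are nonnegative, so each is bounded by their
      sum, which is the defect of \<open>J\<close>.\<close>
    have "(\<integral>\<omega>. ?D t k \<omega> \<partial>M) \<le> (1/64) ^ k" for k
    proof -
      have "(\<integral>\<omega>. ?D t k \<omega> \<partial>M) \<le> (\<Sum>u\<le>T. \<integral>\<omega>. ?D u k \<omega> \<partial>M)"
        using t D0 by (intro member_le_sum Bochner_Integration.integral_nonneg) auto
      also have "\<dots> \<le> (1/64) ^ k" unfolding Dsum by (rule less_imp_le[OF N[OF rk(2,3)]])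
      finally show ?thesis .
    qed
    then have "(\<integral>\<^sup>+\<omega>. ennreal (?D t k \<omega>) \<partial>M) \<le> ennreal ((1/64) ^ k)" for k
      using nn_integral_eq_integral[OF Di[OF t]] D0[OF t] by (simp add: ennreal_leI)
    then have "AE \<omega> in M. convergent (\<lambda>k. W t (x (r k)) \<omega>)"
      using WM[OF x0 t] eM[OF t] e01[OF t] C0 nb[OF x0 t] unfolding s_def
      by (intro AE_convergent_of_small_defects[where \<eta>="\<eta> t" and B=C]) auto
    then show "AE \<omega> in M. convergent (\<lambda>k. wealth t S w0 (x (r k)) \<omega>)" unfolding W_def .
  qed
qed

end

section \<open>Limits of strategies\<close>

lemma measure_support_subset_closed:
  fixes V :: "'v::metric_space set"
  assumes "sets \<mu> = sets borel" "closed V" "AE x in \<mu>. x \<in> V"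
  shows "measure_support \<mu> \<subseteq> V"
proof
  fix x assume x: "x \<in> measure_support \<mu>"
  show "x \<in> V"
  proof (rule ccontr)
    assume "x \<notin> V"
    then obtain e where e: "0 < e" "ball x e \<subseteq> - V"
      using \<open>closed V\<close> open_contains_ball[of "- V"] by (auto simp: open_Compl)
    have "AE y in \<mu>. y \<notin> ball x e" using assms(3) by eventually_elim (use e in auto)
    then have "emeasure \<mu> (ball x e) = 0"
      by (subst (asm) AE_iff_measurable[of "ball x e"])
         (auto simp: assms(1) sets_eq_imp_space_eq[OF assms(1)])
    then show False using x e unfolding measure_support_def by auto
  qed
qed

text \<open>The complement of the support is covered by the null members of a countable
  basis.\<close>

lemma AE_in_measure_support:
  fixes \<mu> :: "'v::{metric_space, second_countable_topology} measure"
  assumes "sets \<mu> = sets borel"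
  shows "AE x in \<mu>. x \<in> measure_support \<mu>"
proof -
  obtain B :: "'v set set" where B: "countable B" "topological_basis B"
    using ex_countable_basis by blast
  have "AE x in \<mu>. \<forall>b\<in>B. emeasure \<mu> b = 0 \<longrightarrow> x \<notin> b"
  proof (subst AE_ball_countable[OF B(1)], rule ballI)
    fix b assume b: "b \<in> B"
    show "AE x in \<mu>. emeasure \<mu> b = 0 \<longrightarrow> x \<notin> b"
    proof (cases "emeasure \<mu> b = 0")
      case True
      then have "b \<in> null_sets \<mu>"
        using topological_basis_open[OF B(2) b] assms by (auto simp: null_sets_def)
      from AE_not_in[OF this] show ?thesis by auto
    qed simp
  qed
  then show ?thesis
  proof eventually_elim
    case (elim x)
    show ?case unfolding measure_support_def
    proof safe
      fix e :: real assume "0 < e"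
      then obtain b where b: "b \<in> B" "x \<in> b" "b \<subseteq> ball x e"
        using topological_basisE[OF B(2) open_ball, of x x e] by auto
      then have "emeasure \<mu> b \<noteq> 0" using elim by blast
      moreover have "emeasure \<mu> b \<le> emeasure \<mu> (ball x e)"
        by (rule emeasure_mono[OF b(3)]) (simp add: assms)
      ultimately show "0 < emeasure \<mu> (ball x e)" by (auto simp: zero_less_iff_neq_zero)
    qed
  qed
qed

text \<open>The vectors \<open>a n\<close> themselves may diverge. A limit functional exists only on
  the subspace where the values converge, and an orthonormal basis of that subspace writes it as an
  inner product.\<close>

lemma limit_functional_representation:
  fixes a :: "nat \<Rightarrow> 'v::euclidean_space"
  obtains h where "\<And>x. convergent (\<lambda>n. a n \<bullet> x) \<Longrightarrow> (\<lambda>n. a n \<bullet> x) \<longlonglongrightarrow> h \<bullet> x"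
proof -
  let ?E = "{x. convergent (\<lambda>n. a n \<bullet> x)}"
  have "subspace ?E"
    unfolding subspace_def
    by (auto simp: inner_add_right convergent_const intro!: convergent_add convergent_mult)
  then obtain B where B: "B \<subseteq> ?E" "pairwise orthogonal B" "\<And>x. x \<in> B \<Longrightarrow> norm x = 1"
    "independent B" "span B = ?E"
    using orthonormal_basis_subspace by metis
  have fB: "finite B" using B(4) by (rule independent_imp_finite)
  define h where "h = (\<Sum>b\<in>B. lim (\<lambda>n. a n \<bullet> b) *\<^sub>R b)"
  show thesis
  proof (rule that[of h])
    fix x assume "convergent (\<lambda>n. a n \<bullet> x)"
    then have "x \<in> span B" using B(5) by simp
    then have x: "(\<Sum>b\<in>B. (x \<bullet> b) *\<^sub>R b) = x"
      using orthonormal_basis_expand[OF B(2,3) _ fB] by blast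
    have "(\<lambda>n. \<Sum>b\<in>B. (x \<bullet> b) * (a n \<bullet> b)) \<longlonglongrightarrow> (\<Sum>b\<in>B. (x \<bullet> b) * lim (\<lambda>n. a n \<bullet> b))"
      using B(1) by (intro tendsto_sum tendsto_mult tendsto_const) (auto simp: convergent_LIMSEQ_iff[symmetric])
    moreover have "(\<Sum>b\<in>B. (x \<bullet> b) * (a n \<bullet> b)) = a n \<bullet> x" for n
      using arg_cong[OF x, of "\<lambda>z. a n \<bullet> z"] by (simp add: inner_sum_right)
    moreover have "(\<Sum>b\<in>B. (x \<bullet> b) * lim (\<lambda>n. a n \<bullet> b)) = h \<bullet> x"
      unfolding h_def by (simp add: inner_sum_right inner_commute[of _ x] mult.commute)
    ultimately show "(\<lambda>n. a n \<bullet> x) \<longlonglongrightarrow> h \<bullet> x" by simp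
  qed
qed

text \<open>The points at which a sequence of linear functionals converges to a given one form a
  closed linear subspace; if it has full conditional measure, it contains the affine hull of the
  conditional support.\<close>

lemma limit_strategy:
  fixes X :: "'w \<Rightarrow> 'v::euclidean_space" and a :: "nat \<Rightarrow> 'w \<Rightarrow> 'v"
  assumes fin: "finite_measure M" and sub: "subalgebra M G" and ne: "space M \<noteq> {}"
    and X[measurable]: "X \<in> borel_measurable M"
    and a[measurable]: "\<And>n. a n \<in> borel_measurable G"
    and conv: "AE \<omega> in M. convergent (\<lambda>n. a n \<omega> \<bullet> X \<omega>)"
  obtains s where "s \<in> borel_measurable G"
    "\<And>Y. Y \<in> borel_measurable M \<Longrightarrow>
      AE \<omega> in M. affine hull measure_support (rcd M G Y \<omega>) \<subseteq> affine hull measure_support (rcd M G X \<omega>) \<Longrightarrow>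
      AE \<omega> in M. (\<lambda>n. a n \<omega> \<bullet> Y \<omega>) \<longlonglongrightarrow> s \<omega> \<bullet> Y \<omega>"
proof -
  have spG: "space G = space M" using sub by (simp add: subalgebra_def)
  define \<kappa> where "\<kappa> = rcd M G X"
  have rcd: "is_rcd M G X \<kappa>" unfolding \<kappa>_def by (rule is_rcd_rcd[OF fin sub ne X])
  note kG[measurable] = is_rcd_kernel[OF sub rcd]
  have ps: "prob_space (\<kappa> \<omega>)" and sk: "sets (\<kappa> \<omega>) = sets borel" if "\<omega> \<in> space M" for \<omega>
    using rcd that by (auto simp: is_rcd_def)
  have "Measurable.pred (G \<Otimes>\<^sub>M borel) (\<lambda>(\<omega>, x). convergent (\<lambda>n. a n \<omega> \<bullet> x))"
    unfolding Cauchy_convergent_iff[symmetric] by measurable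
  from is_rcd_AE_iff[OF fin sub ne X rcd this] conv
  have conv_k: "AE \<omega> in M. AE x in \<kappa> \<omega>. convergent (\<lambda>n. a n \<omega> \<bullet> x)" by simp
  \<comment> \<open>Its integral \<open>Q \<omega> h\<close> below measures how far \<open>h\<close>
    is from representing the limit functional almost everywhere under the kernel; the cut-off at 1
    makes it finite and continuous in \<open>h\<close>. The zeros are the candidates for the limit
    holding, from which a measurable one is selected.\<close>
  define f where "f \<omega> h x = min 1 \<bar>lim (\<lambda>n. a n \<omega> \<bullet> x) - h \<bullet> x\<bar>" for \<omega> h x
  have f0: "0 \<le> f \<omega> h x" and f1: "f \<omega> h x \<le> 1" for \<omega> h x by (auto simp: f_def)
  have fm: "f \<omega> h \<in> borel_measurable (\<kappa> \<omega>)" if w: "\<omega> \<in> space M" for \<omega> h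
    unfolding f_def by (subst measurable_cong_sets[OF sk[OF w] refl]) measurable
  have fi: "integrable (\<kappa> \<omega>) (f \<omega> h)" if w: "\<omega> \<in> space M" for \<omega> h
  proof -
    interpret prob_space "\<kappa> \<omega>" by (rule ps[OF w])
    show ?thesis by (rule integrable_const_bound[where B=1]) (auto simp: f0 f1 fm[OF w])
  qed
  define Q where "Q \<omega> h = enn2real (\<integral>\<^sup>+x. ennreal (f \<omega> h x) \<partial>\<kappa> \<omega>)" for \<omega> h
  have Q_int: "Q \<omega> h = (\<integral>x. f \<omega> h x \<partial>\<kappa> \<omega>)" if w: "\<omega> \<in> space M" for \<omega> h
    unfolding Q_def by (rule integral_eq_nn_integral[symmetric]) (auto simp: f0 fm[OF w])
  have Qm: "(\<lambda>\<omega>. Q \<omega> h) \<in> borel_measurable G" for h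
  proof -
    have "(\<lambda>\<omega>. \<integral>\<^sup>+x. ennreal (f \<omega> h x) \<partial>\<kappa> \<omega>) \<in> borel_measurable G"
      unfolding f_def by (rule nn_integral_measurable_subprob_algebra2[OF _ kG]) measurable
    then show ?thesis unfolding Q_def by measurable
  qed
  have Qc: "continuous_on UNIV (Q \<omega>)" if "\<omega> \<in> space G" for \<omega>
  proof -
    have w: "\<omega> \<in> space M" using that spG by simp
    interpret prob_space "\<kappa> \<omega>" by (rule ps[OF w])
    show ?thesis
      unfolding continuous_on_sequentially
    proof safe
      fix u :: "nat \<Rightarrow> 'v" and h assume u: "u \<longlonglongrightarrow> h"
      have "(\<lambda>i. \<integral>x. f \<omega> (u i) x \<partial>\<kappa> \<omega>) \<longlonglongrightarrow> (\<integral>x. f \<omega> h x \<partial>\<kappa> \<omega>)"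
      proof (rule integral_dominated_convergence[where w="\<lambda>_. 1"])
        show "AE x in \<kappa> \<omega>. (\<lambda>i. f \<omega> (u i) x) \<longlonglongrightarrow> f \<omega> h x"
          unfolding f_def by (intro AE_I2 tendsto_intros u)
      qed (auto simp: f0 f1 fm[OF w])
      then show "(Q \<omega> \<circ> u) \<longlonglongrightarrow> Q \<omega> h" by (simp add: comp_def Q_int[OF w])
    qed
  qed
  obtain s where s[measurable]: "s \<in> borel_measurable G"
    and s0: "\<And>\<omega> v. \<omega> \<in> space G \<Longrightarrow> Q \<omega> v = 0 \<Longrightarrow> Q \<omega> (s \<omega>) = 0"
    using measurable_zero_selection[OF Qm Qc] unfolding Q_def by (metis enn2real_nonneg)
  have f_iff: "f \<omega> h x = 0 \<longleftrightarrow> lim (\<lambda>n. a n \<omega> \<bullet> x) = h \<bullet> x" for \<omega> h x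
    by (auto simp: f_def min_def)
  have Q_iff: "Q \<omega> h = 0 \<longleftrightarrow> (AE x in \<kappa> \<omega>. lim (\<lambda>n. a n \<omega> \<bullet> x) = h \<bullet> x)" if w: "\<omega> \<in> space M" for \<omega> h
    unfolding Q_int[OF w] by (subst integral_nonneg_eq_0_iff_AE[OF fi[OF w]]) (simp_all add: f0 f_iff)
  \<comment> \<open>A candidate exists at almost every \<open>\<omega>\<close> by linear algebra
    alone; it serves to show that the selected \<open>s \<omega>\<close> is a zero as well.\<close>
  have hull: "AE \<omega> in M. affine hull measure_support (\<kappa> \<omega>) \<subseteq> {x. (\<lambda>n. a n \<omega> \<bullet> x) \<longlonglongrightarrow> s \<omega> \<bullet> x}"
    using conv_k AE_space
  proof eventually_elim
    case (elim \<omega>)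
    let ?V = "{x. (\<lambda>n. a n \<omega> \<bullet> x) \<longlonglongrightarrow> s \<omega> \<bullet> x}"
    obtain h where h: "\<And>x. convergent (\<lambda>n. a n \<omega> \<bullet> x) \<Longrightarrow> (\<lambda>n. a n \<omega> \<bullet> x) \<longlonglongrightarrow> h \<bullet> x"
      using limit_functional_representation[of "\<lambda>n. a n \<omega>"] by blast
    have "AE x in \<kappa> \<omega>. lim (\<lambda>n. a n \<omega> \<bullet> x) = h \<bullet> x"
      using elim(1) by eventually_elim (use h limI in blast)
    then have "Q \<omega> h = 0" using Q_iff elim by blast
    then have "Q \<omega> (s \<omega>) = 0" using s0 elim spG by blast
    then have "AE x in \<kappa> \<omega>. lim (\<lambda>n. a n \<omega> \<bullet> x) = s \<omega> \<bullet> x" using Q_iff elim by blast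
    with elim(1) have "AE x in \<kappa> \<omega>. x \<in> ?V"
      by eventually_elim (auto simp: convergent_LIMSEQ_iff)
    moreover have V: "subspace ?V"
      unfolding subspace_def by (auto simp: inner_add_right intro: tendsto_add tendsto_mult_left)
    ultimately have "measure_support (\<kappa> \<omega>) \<subseteq> ?V"
      using elim by (intro measure_support_subset_closed sk closed_subspace) auto
    then show ?case by (rule hull_minimal) (rule subspace_imp_affine[OF V])
  qed
  show thesis
  proof (rule that[OF s])
    fix Y :: "'w \<Rightarrow> 'v" assume Y: "Y \<in> borel_measurable M"
      and sub_hull: "AE \<omega> in M. affine hull measure_support (rcd M G Y \<omega>) \<subseteq> affine hull measure_support (rcd M G X \<omega>)"
    have rcdY: "is_rcd M G Y (rcd M G Y)" by (rule is_rcd_rcd[OF fin sub ne Y])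
    \<comment> \<open>The realised values of \<open>Y\<close> and \<open>X\<close> are unrelated.
      The link is made through the kernel of \<open>Y\<close>: almost every point of it lies in its
      support, hence in the hull for \<open>X\<close>, where convergence is known.\<close>
    have "AE \<omega> in M. AE x in rcd M G Y \<omega>. (\<lambda>n. a n \<omega> \<bullet> x) \<longlonglongrightarrow> s \<omega> \<bullet> x"
      using sub_hull hull AE_space
    proof eventually_elim
      case (elim \<omega>)
      have "sets (rcd M G Y \<omega>) = sets borel" using rcdY elim by (auto simp: is_rcd_def)
      from AE_in_measure_support[OF this] show ?case
      proof eventually_elim
        case (elim x)
        then have "x \<in> affine hull measure_support (rcd M G Y \<omega>)" by (rule hull_inc)
        then show ?case using \<open>affine hull measure_support (rcd M G Y \<omega>) \<subseteq> _\<close>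
            \<open>affine hull measure_support (\<kappa> \<omega>) \<subseteq> _\<close> unfolding \<kappa>_def by blast
      qed
    qed
    moreover have "Measurable.pred (G \<Otimes>\<^sub>M borel) (\<lambda>(\<omega>, x). (\<lambda>n. a n \<omega> \<bullet> x) \<longlonglongrightarrow> s \<omega> \<bullet> x)"
    proof -
      have "u \<longlonglongrightarrow> l \<longleftrightarrow> Cauchy u \<and> lim u = l" for u :: "nat \<Rightarrow> real" and l
        by (metis Cauchy_convergent_iff LIMSEQ_imp_Cauchy convergent_LIMSEQ_iff limI)
      then show ?thesis by simp
    qed
    ultimately show "AE \<omega> in M. (\<lambda>n. a n \<omega> \<bullet> Y \<omega>) \<longlonglongrightarrow> s \<omega> \<bullet> Y \<omega>"
      using is_rcd_AE_iff[OF fin sub ne Y rcdY, of "\<lambda>(\<omega>, x). (\<lambda>n. a n \<omega> \<bullet> x) \<longlonglongrightarrow> s \<omega> \<bullet> x"] by simp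
  qed
qed

section \<open>The robust utility maximisation problem\<close>

text \<open>An upper bound makes the positive part integrable, so the indeterminate case cannot
  occur. The remaining loss lives in \<open>ennreal\<close>, where suprema and Fatou's lemma need no
  integrability; expectation minus infinity corresponds to infinite loss.\<close>

lemma ext_expectation_bounded_above:
  fixes f :: "'w \<Rightarrow> real"
  assumes "prob_space M" and f[measurable]: "f \<in> borel_measurable M" and C: "\<And>\<omega>. f \<omega> \<le> C"
  shows "ext_expectation M f = ereal C - enn2ereal (\<integral>\<^sup>+\<omega>. ennreal (C - f \<omega>) \<partial>M)"
proof -
  interpret prob_space M by fact
  let ?p = "\<integral>\<^sup>+\<omega>. ennreal (max 0 (f \<omega>)) \<partial>M" and ?n = "\<integral>\<^sup>+\<omega>. ennreal (max 0 (- f \<omega>)) \<partial>M"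
  have "?p \<le> (\<integral>\<^sup>+\<omega>. ennreal \<bar>C\<bar> \<partial>M)"
  proof (intro nn_integral_mono ennreal_leI)
    fix \<omega> show "max 0 (f \<omega>) \<le> \<bar>C\<bar>" using C[of \<omega>] by auto
  qed
  also have "\<dots> < \<infinity>" by (simp add: emeasure_space_1)
  finally have p: "?p < \<infinity>" .
  show ?thesis
  proof (cases "?n = \<infinity>")
    case True
    have "?n \<le> (\<integral>\<^sup>+\<omega>. ennreal (C - f \<omega>) + ennreal \<bar>C\<bar> \<partial>M)"
    proof (intro nn_integral_mono)
      fix \<omega>
      have "ennreal (max 0 (- f \<omega>)) \<le> ennreal ((C - f \<omega>) + \<bar>C\<bar>)"
        using C[of \<omega>] by (intro ennreal_leI) auto
      also have "\<dots> = ennreal (C - f \<omega>) + ennreal \<bar>C\<bar>"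
        using C[of \<omega>] by (intro ennreal_plus) auto
      finally show "ennreal (max 0 (- f \<omega>)) \<le> ennreal (C - f \<omega>) + ennreal \<bar>C\<bar>" .
    qed
    also have "\<dots> = (\<integral>\<^sup>+\<omega>. ennreal (C - f \<omega>) \<partial>M) + ennreal \<bar>C\<bar>"
      by (subst nn_integral_add) (auto simp: emeasure_space_1)
    finally have "(\<integral>\<^sup>+\<omega>. ennreal (C - f \<omega>) \<partial>M) = \<infinity>" using True by (auto simp: top_unique)
    moreover have "enn2ereal ?p \<noteq> \<infinity>" using p by (cases ?p) auto
    ultimately show ?thesis using True p by (cases "enn2ereal ?p") (auto simp: ext_expectation_def Let_def)
  next
    case False
    have i1: "integrable M (\<lambda>\<omega>. max 0 (f \<omega>))" using p by (intro integrableI_nonneg) auto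
    have i2: "integrable M (\<lambda>\<omega>. max 0 (- f \<omega>))"
      using False by (intro integrableI_nonneg) (auto simp: top.not_eq_extremum)
    have f_split: "f = (\<lambda>\<omega>. max 0 (f \<omega>) - max 0 (- f \<omega>))" by (auto simp: fun_eq_iff max_def)
    have i: "integrable M f" by (subst f_split) (rule Bochner_Integration.integrable_diff[OF i1 i2])
    have e1: "?p = ennreal (\<integral>\<omega>. max 0 (f \<omega>) \<partial>M)" by (rule nn_integral_eq_integral[OF i1]) simp
    have e2: "?n = ennreal (\<integral>\<omega>. max 0 (- f \<omega>) \<partial>M)" by (rule nn_integral_eq_integral[OF i2]) simp
    have "(\<integral>\<^sup>+\<omega>. ennreal (C - f \<omega>) \<partial>M) = ennreal (\<integral>\<omega>. C - f \<omega> \<partial>M)"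
      by (rule nn_integral_eq_integral) (use i C in auto)
    also have "(\<integral>\<omega>. C - f \<omega> \<partial>M) = C - (\<integral>\<omega>. f \<omega> \<partial>M)" using i by (simp add: prob_space)
    finally have e3: "(\<integral>\<^sup>+\<omega>. ennreal (C - f \<omega>) \<partial>M) = ennreal (C - (\<integral>\<omega>. f \<omega> \<partial>M))" .
    have "(\<integral>\<omega>. f \<omega> \<partial>M) \<le> (\<integral>\<omega>. C \<partial>M)" by (rule integral_mono) (use i C in auto)
    then have le: "0 \<le> C - (\<integral>\<omega>. f \<omega> \<partial>M)" by (simp add: prob_space)
    have "(\<integral>\<omega>. f \<omega> \<partial>M) = (\<integral>\<omega>. max 0 (f \<omega>) \<partial>M) - (\<integral>\<omega>. max 0 (- f \<omega>) \<partial>M)"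
      by (subst f_split) (rule Bochner_Integration.integral_diff[OF i1 i2])
    then show ?thesis
      unfolding ext_expectation_def Let_def e1 e2 e3 using le by (simp add: enn2ereal_ennreal)
  qed
qed

text \<open>\<open>Lim\<close> is defined by choice, so a bound on it carries no information before
  convergence is shown; monotonicity gives convergence to the supremum.\<close>

lemma mono_bounded_above_of_Lim:
  fixes U :: "real \<Rightarrow> real"
  assumes U: "mono U" and top: "Lim at_top (\<lambda>x. ereal (U x)) < \<infinity>"
  obtains C where "\<And>x. U x \<le> C"
proof -
  let ?L = "SUP x. ereal (U x)"
  have "((\<lambda>x. ereal (U x)) \<longlongrightarrow> ?L) at_top"
  proof (rule order_tendstoI)
    fix y assume "y < ?L"
    then obtain x where x: "y < ereal (U x)" by (auto simp: less_SUP_iff)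
    have "y < ereal (U z)" if "x \<le> z" for z
      using x monoD[OF U that] by (meson ereal_less_eq(3) less_le_trans)
    then show "eventually (\<lambda>x. y < ereal (U x)) at_top" by (auto simp: eventually_at_top_linorder)
  next
    fix y assume "?L < y"
    then have "ereal (U x) < y" for x by (meson SUP_upper UNIV_I order_le_less_trans)
    then show "eventually (\<lambda>x. ereal (U x) < y) at_top" by simp
  qed
  then have "Lim at_top (\<lambda>x. ereal (U x)) = ?L" by (intro tendsto_Lim) auto
  then have "?L < \<infinity>" using top by simp
  moreover have le: "ereal (U x) \<le> ?L" for x by (rule SUP_upper) simp
  ultimately obtain C where "?L = ereal C" by (cases ?L) auto
  then show thesis using le that[of C] by simp
qed

text \<open>A nonconstant monotone \<open>U\<close> has a chord of positive slope \<open>k\<close>;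
  by concavity it falls at least at that rate to the left of the chord, so the loss dominates the
  shortfall linearly.\<close>

lemma concave_shortfall_bound:
  fixes U :: "real \<Rightarrow> real"
  assumes conc: "concave_on UNIV U" and U: "mono U" and C: "\<And>x. U x \<le> C" and "U p \<noteq> U q"
  obtains a b where "0 < a" "0 \<le> b" "\<And>x. max 0 (- x) \<le> b + a * (C - U x)"
proof -
  obtain p q where pq: "p < q" "U p < U q"
    using \<open>U p \<noteq> U q\<close> monoD[OF U] by (metis less_eq_real_def linorder_less_linear)
  define k where "k = (U q - U p) / (q - p)"
  have k: "0 < k" unfolding k_def using pq by simp
  have slope: "k * (p - x) \<le> U p - U x" if "x < p" for x
  proof -
    \<comment> \<open>\<open>t\<close> is the weight that writes \<open>p\<close> as a convex
      combination of \<open>x\<close> and \<open>q\<close>.\<close>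
    define t where "t = (p - x) / (q - x)"
    have qx: "0 < q - x" using that pq by simp
    have t: "0 \<le> t" "t \<le> 1" unfolding t_def using that pq by auto
    have tq: "t * (q - x) = p - x" unfolding t_def using qx by simp
    then have "(1 - t) * x + t * q = p" by (simp add: algebra_simps)
    then have "(1 - t) * U x + t * U q \<le> U p"
      using concave_onD[OF conc t, of x q] by simp
    then have "(q - x) * ((1 - t) * U x + t * U q) \<le> (q - x) * U p" using qx by (intro mult_left_mono) auto
    moreover have "(q - x) * ((1 - t) * U x + t * U q) = (q - x) * U x + (t * (q - x)) * (U q - U x)"
      by (simp add: algebra_simps)
    ultimately have "(q - x) * U x + (p - x) * (U q - U x) \<le> (q - x) * U p" unfolding tq by simp
    then have "(U q - U p) * (p - x) \<le> (q - p) * (U p - U x)" by (simp add: algebra_simps)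
    then show ?thesis unfolding k_def using pq by (simp add: field_simps)
  qed
  show thesis
  proof (rule that[of "1 / k" "\<bar>p\<bar>"])
    fix x
    have nn: "0 \<le> 1 / k * (C - U x)" using k C[of x] by simp
    show "max 0 (- x) \<le> \<bar>p\<bar> + 1 / k * (C - U x)"
    proof (cases "x < p")
      case True
      have "k * (p - x) \<le> C - U x" using slope[OF True] C[of p] by linarith
      then have "p - x \<le> 1 / k * (C - U x)" using k by (simp add: field_simps)
      then show ?thesis using nn by linarith
    qed (use nn in linarith)
  qed (use k in auto)
qed

context arbitrage_free_market
begin

text \<open>Compactness comes from \<open>S\<close> alone; the other processes enter only the
  constraint sets \<open>\<Phi> n\<close> and the final passage to the limit. A supremum of convex
  functionals is convex, so these sets are closed under midpoints, and it is lower semicontinuous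
  along the limit because the losses are nonnegative.\<close>

theorem robust_loss_minimiser_exists:
  fixes SS :: "(nat \<Rightarrow> 'w \<Rightarrow> real^'d) set" and l :: "real \<Rightarrow> real"
  assumes S: "S \<in> SS"
    and adapted_SS: "\<And>S' t. S' \<in> SS \<Longrightarrow> t \<le> T \<Longrightarrow> S' t \<in> borel_measurable (F t)"
    and D: "\<And>S' t. S' \<in> SS \<Longrightarrow> t \<in> {1..T} \<Longrightarrow> AE \<omega> in M. Dset M F S' t \<omega> \<subseteq> Dset M F S t \<omega>"
    and l_nonneg: "\<And>x. 0 \<le> l x"
    and l_convex: "convex_on UNIV l"
    and ab: "0 \<le> a" "0 \<le> b" "\<And>x. max 0 (- x) \<le> b + a * l x"
  shows "\<exists>\<phi>\<in>strategies F T. \<forall>\<psi>\<in>strategies F T.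
    (SUP S'\<in>SS. \<integral>\<^sup>+\<omega>. ennreal (l (wealth T S' w0 \<phi> \<omega>)) \<partial>M)
      \<le> (SUP S'\<in>SS. \<integral>\<^sup>+\<omega>. ennreal (l (wealth T S' w0 \<psi> \<omega>)) \<partial>M)"
proof -
  have market: "adapted_market M F T S'" if "S' \<in> SS" for S'
    using that by unfold_locales (auto intro: filt_sub filt_mono[THEN subsetD] adapted_SS)
  have lc: "continuous_on UNIV l" by (rule convex_on_continuous[OF open_UNIV l_convex])
  then have lm[measurable]: "l \<in> borel_measurable borel" by (rule borel_measurable_continuous_onI)
  have WM: "wealth T S' w0 \<phi> \<in> borel_measurable M" if "S' \<in> SS" "\<phi> \<in> strategies F T" for S' \<phi>
    using adapted_market.measurable_wealth[OF market[OF that(1)] that(2) order_refl]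
    by (rule measurable_F_M[OF order_refl])
  define I where "I S' \<phi> = (\<integral>\<^sup>+\<omega>. ennreal (l (wealth T S' w0 \<phi> \<omega>)) \<partial>M)"
    for S' \<phi> :: "nat \<Rightarrow> 'w \<Rightarrow> real^'d"
  define L where "L \<phi> = (SUP S'\<in>SS. I S' \<phi>)" for \<phi>
  have IL: "I S' \<phi> \<le> L \<phi>" if "S' \<in> SS" for S' \<phi> unfolding L_def using that by (rule SUP_upper)
  define v where "v = (INF \<phi>\<in>strategies F T. L \<phi>)"
  have zero: "(\<lambda>t \<omega>. 0) \<in> strategies F T" by (simp add: strategies_def)
  \<comment> \<open>The zero strategy has loss \<open>l w0\<close> under every process, which makes
    the optimal value finite.\<close>
  have "L (\<lambda>t \<omega>. 0) \<le> ennreal (l w0)"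
    unfolding L_def I_def by (rule SUP_least) (simp add: wealth_def emeasure_space_1)
  then have v_fin: "v < \<infinity>"
    unfolding v_def using INF_lower[OF zero, of L] by (metis ennreal_less_top infinity_ennreal_def order_le_less_trans)
  define \<Phi> where "\<Phi> n = {\<phi>\<in>strategies F T. L \<phi> \<le> v + ennreal (1 / Suc n)}" for n
  have ne: "\<Phi> n \<noteq> {}" for n
  proof -
    have "v < v + ennreal (1 / Suc n)" 
      using v_fin ennreal_add_left_cancel_less[of v 0 "ennreal (1 / Suc n)"] by (simp add: ennreal_less_zero_iff)
    then show ?thesis unfolding \<Phi>_def v_def INF_less_iff by (auto intro: less_imp_le)
  qed
  have dec: "\<Phi> m \<subseteq> \<Phi> n" if "n \<le> m" for m n
  proof -
    have "ennreal (1 / Suc m) \<le> ennreal (1 / Suc n)"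
      using that by (intro ennreal_leI divide_left_mono) auto
    then show ?thesis unfolding \<Phi>_def using add_left_mono order_trans by blast
  qed
  have mid: "strategy_mid \<phi> \<psi> \<in> \<Phi> n" if "\<phi> \<in> \<Phi> n" "\<psi> \<in> \<Phi> n" for n \<phi> \<psi>
  proof -
    let ?B = "v + ennreal (1 / Suc n)"
    have st: "\<phi> \<in> strategies F T" "\<psi> \<in> strategies F T" and B: "L \<phi> \<le> ?B" "L \<psi> \<le> ?B"
      using that by (auto simp: \<Phi>_def)
    have "I S' (strategy_mid \<phi> \<psi>) \<le> ?B" if S': "S' \<in> SS" for S'
    proof -
      note [measurable] = WM[OF S' st(1)] WM[OF S' st(2)]
      have "I S' (strategy_mid \<phi> \<psi>) \<le> (\<integral>\<^sup>+\<omega>. ennreal (1/2) * ennreal (l (wealth T S' w0 \<phi> \<omega>))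
          + ennreal (1/2) * ennreal (l (wealth T S' w0 \<psi> \<omega>)) \<partial>M)"
        unfolding I_def
      proof (rule nn_integral_mono)
        fix \<omega>
        let ?x = "wealth T S' w0 \<phi> \<omega>" and ?y = "wealth T S' w0 \<psi> \<omega>"
        have "l (wealth T S' w0 (strategy_mid \<phi> \<psi>) \<omega>) = l ((1 - 1/2) *\<^sub>R ?x + (1/2) *\<^sub>R ?y)"
          by (simp add: wealth_strategy_mid add_divide_distrib)
        also have "\<dots> \<le> (1 - 1/2) * l ?x + 1/2 * l ?y"
          by (rule convex_onD[OF l_convex]) auto
        finally have "ennreal (l (wealth T S' w0 (strategy_mid \<phi> \<psi>) \<omega>)) \<le> ennreal (1/2 * l ?x + 1/2 * l ?y)"
          by (intro ennreal_leI) simp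
        also have "\<dots> = ennreal (1/2) * ennreal (l ?x) + ennreal (1/2) * ennreal (l ?y)"
          by (subst ennreal_plus) (simp_all only: ennreal_mult''[OF l_nonneg], simp_all add: l_nonneg)
        finally show "ennreal (l (wealth T S' w0 (strategy_mid \<phi> \<psi>) \<omega>))
          \<le> ennreal (1/2) * ennreal (l ?x) + ennreal (1/2) * ennreal (l ?y)" .
      qed
      also have "\<dots> = ennreal (1/2) * I S' \<phi> + ennreal (1/2) * I S' \<psi>"
        unfolding I_def by (simp add: nn_integral_add nn_integral_cmult)
      also have "\<dots> \<le> ennreal (1/2) * ?B + ennreal (1/2) * ?B"
        by (intro add_mono mult_left_mono order_trans[OF IL[OF S'] B(1)] order_trans[OF IL[OF S'] B(2)]) auto
      also have "\<dots> = (ennreal (1/2) + ennreal (1/2)) * ?B" by (simp only: distrib_right)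
      also have "ennreal (1/2) + ennreal (1/2) = 1"
        by (subst ennreal_plus[symmetric]) (simp_all del: ennreal_plus)
      finally show ?thesis by simp
    qed
    then show ?thesis unfolding \<Phi>_def L_def using strategy_mid_in_strategies[OF st] by (auto intro: SUP_least)
  qed
  \<comment> \<open>The set \<open>\<Phi> 0\<close> allows a slack of 1, whence
    \<open>v + 1\<close>; through \<open>ab\<close> its members have uniformly bounded shortfall
    under \<open>S\<close>.\<close>
  define K where "K = b + a * enn2real (v + 1)"
  have K0: "0 \<le> K" unfolding K_def using ab by simp
  have K: "(\<integral>\<^sup>+\<omega>. ennreal (max 0 (- wealth T S w0 \<phi> \<omega>)) \<partial>M) \<le> ennreal K" if "\<phi> \<in> \<Phi> 0" for \<phi>
  proof -
    have st: "\<phi> \<in> strategies F T" and B: "L \<phi> \<le> v + 1" using that by (auto simp: \<Phi>_def)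
    note [measurable] = WM[OF S st]
    have "(\<integral>\<^sup>+\<omega>. ennreal (max 0 (- wealth T S w0 \<phi> \<omega>)) \<partial>M)
      \<le> (\<integral>\<^sup>+\<omega>. ennreal b + ennreal a * ennreal (l (wealth T S w0 \<phi> \<omega>)) \<partial>M)"
    proof (rule nn_integral_mono)
      fix \<omega>
      have "ennreal (max 0 (- wealth T S w0 \<phi> \<omega>)) \<le> ennreal (b + a * l (wealth T S w0 \<phi> \<omega>))"
        by (rule ennreal_leI[OF ab(3)])
      then show "ennreal (max 0 (- wealth T S w0 \<phi> \<omega>)) \<le> ennreal b + ennreal a * ennreal (l (wealth T S w0 \<phi> \<omega>))"
        using ab l_nonneg by (simp add: ennreal_mult'[symmetric] ennreal_plus[symmetric] del: ennreal_plus)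
    qed
    also have "\<dots> = ennreal b + ennreal a * I S \<phi>"
      unfolding I_def by (simp add: nn_integral_add nn_integral_cmult emeasure_space_1)
    also have "\<dots> \<le> ennreal b + ennreal a * (v + 1)"
      by (intro add_left_mono mult_left_mono order_trans[OF IL[OF S] B]) simp
    also have "v + 1 = ennreal (enn2real (v + 1))" using v_fin by (intro ennreal_enn2real[symmetric]) simp
    also have "ennreal b + ennreal a * ennreal (enn2real (v + 1)) = ennreal K"
      unfolding K_def using ab by (simp add: ennreal_mult'[symmetric] ennreal_plus[symmetric] del: ennreal_plus)
    finally show ?thesis .
  qed
  obtain \<phi> where phi: "\<And>n. \<phi> n \<in> \<Phi> n"
    and conv: "\<And>t. t \<le> T \<Longrightarrow> AE \<omega> in M. convergent (\<lambda>n. wealth t S w0 (\<phi> n) \<omega>)"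
  proof (rule convergent_wealth_subsequence[of \<Phi>, OF _ ne dec mid K0 K])
    show "\<Phi> 0 \<subseteq> strategies F T" by (auto simp: \<Phi>_def)
  qed (assumption | rule that)+
  have st: "\<phi> n \<in> strategies F T" for n using phi[of n] by (simp add: \<Phi>_def)
  \<comment> \<open>One \<open>s\<close> must serve every process of a possibly uncountable family,
    so it has to be obtained from \<open>S\<close> before any other process is considered.\<close>
  define lim_at where "lim_at t s \<longleftrightarrow> s \<in> borel_measurable (F (t - 1)) \<and>
    (\<forall>S'\<in>SS. AE \<omega> in M. (\<lambda>n. \<phi> n t \<omega> \<bullet> incr S' t \<omega>) \<longlonglongrightarrow> s \<omega> \<bullet> incr S' t \<omega>)" for t s
  have "\<exists>s. lim_at t s" if t: "t \<in> {1..T}" for t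
  proof -
    obtain u where u: "t = Suc u" "Suc u \<le> T" using t by (cases t) auto
    have incrM: "incr S' t \<in> borel_measurable M" if "S' \<in> SS" for S'
      using adapted_market.measurable_incr[OF market[OF that]] t by (intro measurable_F_M[of t]) auto
    have conv_X: "AE \<omega> in M. convergent (\<lambda>n. \<phi> n t \<omega> \<bullet> incr S t \<omega>)"
      using conv[OF u(2)] conv[OF Suc_leD[OF u(2)]]
    proof eventually_elim
      case (elim \<omega>)
      then have "convergent (\<lambda>n. wealth (Suc u) S w0 (\<phi> n) \<omega> - wealth u S w0 (\<phi> n) \<omega>)"
        using u(2) by (intro convergent_diff) auto
      then show ?case by (simp add: wealth_Suc u)
    qed
    have phim: "\<phi> n t \<in> borel_measurable (F (t - 1))" for n
      using st[of n] t by (auto simp: strategies_def)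
    obtain s where "s \<in> borel_measurable (F (t - 1))"
      and "\<And>Y. Y \<in> borel_measurable M \<Longrightarrow>
        AE \<omega> in M. affine hull measure_support (rcd M (F (t - 1)) Y \<omega>)
          \<subseteq> affine hull measure_support (rcd M (F (t - 1)) (incr S t) \<omega>) \<Longrightarrow>
        AE \<omega> in M. (\<lambda>n. \<phi> n t \<omega> \<bullet> Y \<omega>) \<longlonglongrightarrow> s \<omega> \<bullet> Y \<omega>"
      by (rule limit_strategy[OF finite_measure_axioms filt_sub not_empty incrM[OF S] phim conv_X])
         (use t in auto)
    then have "lim_at t s"
      unfolding lim_at_def using incrM D[OF _ t, unfolded Dset_def] by blast
    then show ?thesis by blast
  qed
  then obtain \<phi>' where phi': "\<And>t. t \<in> {1..T} \<Longrightarrow> lim_at t (\<phi>' t)" by metis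
  have st': "\<phi>' \<in> strategies F T" using phi' by (auto simp: strategies_def lim_at_def)
  have "I S' \<phi>' \<le> v" if S': "S' \<in> SS" for S'
  proof -
    \<comment> \<open>The exceptional null set may depend on \<open>S'\<close>. This is harmless,
      because each loss is estimated separately before the supremum is taken.\<close>
    have "AE \<omega> in M. \<forall>t\<in>{1..T}. (\<lambda>n. \<phi> n t \<omega> \<bullet> incr S' t \<omega>) \<longlonglongrightarrow> \<phi>' t \<omega> \<bullet> incr S' t \<omega>"
      using phi' S' by (intro AE_ball_countable[THEN iffD2]) (auto simp: lim_at_def)
    then have "AE \<omega> in M. ennreal (l (wealth T S' w0 \<phi>' \<omega>))
        \<le> liminf (\<lambda>n. ennreal (l (wealth T S' w0 (\<phi> n) \<omega>)))"
    proof eventually_elim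
      case (elim \<omega>)
      then have "(\<lambda>n. wealth T S' w0 (\<phi> n) \<omega>) \<longlonglongrightarrow> wealth T S' w0 \<phi>' \<omega>"
        unfolding wealth_def by (intro tendsto_add tendsto_const tendsto_sum) auto
      then have "(\<lambda>n. l (wealth T S' w0 (\<phi> n) \<omega>)) \<longlonglongrightarrow> l (wealth T S' w0 \<phi>' \<omega>)"
        by (rule continuous_on_tendsto_compose[OF lc]) auto
      then have "(\<lambda>n. ennreal (l (wealth T S' w0 (\<phi> n) \<omega>))) \<longlonglongrightarrow> ennreal (l (wealth T S' w0 \<phi>' \<omega>))"
        by (rule tendsto_ennrealI)
      then show ?case using lim_imp_Liminf[OF sequentially_bot] by (metis order_refl)
    qed
    then have "I S' \<phi>' \<le> (\<integral>\<^sup>+\<omega>. liminf (\<lambda>n. ennreal (l (wealth T S' w0 (\<phi> n) \<omega>))) \<partial>M)"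
      unfolding I_def by (rule nn_integral_mono_AE)
    also have "\<dots> \<le> liminf (\<lambda>n. I S' (\<phi> n))"
      unfolding I_def using WM[OF S' st] by (intro nn_integral_liminf) measurable
    also have "\<dots> \<le> liminf (\<lambda>n. v + ennreal (1 / Suc n))"
    proof (rule Liminf_mono, rule always_eventually, rule allI)
      fix n show "I S' (\<phi> n) \<le> v + ennreal (1 / Suc n)"
        using IL[OF S', of "\<phi> n"] phi[of n] unfolding \<Phi>_def by auto
    qed
    also have "\<dots> = v"
    proof (rule lim_imp_Liminf[OF sequentially_bot])
      have "(\<lambda>n. ennreal (1 / Suc n)) \<longlonglongrightarrow> ennreal 0"
        by (intro tendsto_ennrealI LIMSEQ_Suc lim_1_over_n)
      then have "(\<lambda>n. v + ennreal (1 / Suc n)) \<longlonglongrightarrow> v + ennreal 0" by (intro tendsto_add tendsto_const)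
      then show "(\<lambda>n. v + ennreal (1 / Suc n)) \<longlonglongrightarrow> v" by simp
    qed
    finally show ?thesis .
  qed
  then have "L \<phi>' \<le> v" unfolding L_def by (rule SUP_least)
  then have "L \<phi>' \<le> L \<psi>" if "\<psi> \<in> strategies F T" for \<psi>
    using INF_lower[OF that, of L] unfolding v_def by (rule order_trans)
  then show ?thesis using st' unfolding L_def I_def by blast
qed

end

theorem theorem3p4:
  fixes M :: "'w measure" and F :: "nat \<Rightarrow> 'w measure" and T :: nat
    and SS :: "(nat \<Rightarrow> 'w \<Rightarrow> real^'d) set"
    and U :: "real \<Rightarrow> real" and w0 :: real
  assumes prob: "prob_space M"
    and filt_sub: "\<And>t. t \<le> T \<Longrightarrow> subalgebra M (F t)"
    and filt_mono: "\<And>s t. s \<le> t \<Longrightarrow> t \<le> T \<Longrightarrow> sets (F s) \<subseteq> sets (F t)"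
    and filt_null: "\<And>t N A. t \<le> T \<Longrightarrow> N \<in> null_sets M \<Longrightarrow> A \<subseteq> N \<Longrightarrow> A \<in> sets (F t)"
    and adapted: "\<And>S t. S \<in> SS \<Longrightarrow> t \<le> T \<Longrightarrow> S t \<in> borel_measurable (F t)"
    and Sstar_ne: "Sstar M F T SS \<noteq> {}"
    and U_mono: "mono U"
    and U_concave: "concave_on UNIV U"
    and U_usc: "\<And>x c. U x < c \<Longrightarrow> eventually (\<lambda>y. U y < c) (at x)"
    and U_top: "Lim at_top (\<lambda>x. ereal (U x)) < \<infinity>"
  shows "\<exists>\<phi>\<in>strategies F T.
           value_fn M F T SS U w0 = (INF S\<in>SS. ext_expectation M (\<lambda>\<omega>. U (wealth T S w0 \<phi> \<omega>))) \<and>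
           (INF S\<in>SS. ext_expectation M (\<lambda>\<omega>. U (wealth T S w0 \<phi> \<omega>))) < \<infinity>"
proof -
  interpret prob_space M by (rule prob)
  obtain S where S: "S \<in> SS" "NA M F T S"
    and D: "\<And>S' t. S' \<in> SS \<Longrightarrow> t \<in> {1..T} \<Longrightarrow> AE \<omega> in M. Dset M F S' t \<omega> \<subseteq> Dset M F S t \<omega>"
    using Sstar_ne unfolding Sstar_def by blast
  note adapted_SS = adapted
  have market: "adapted_market M F T S'" if "S' \<in> SS" for S'
    by unfold_locales (use that filt_sub filt_mono adapted_SS in auto)
  interpret arbitrage_free_market M F T S
    using market[OF S(1)] S(2) by (simp add: arbitrage_free_market_def arbitrage_free_market_axioms_def)
  obtain C where C: "\<And>x. U x \<le> C" using mono_bounded_above_of_Lim[OF U_mono U_top] by blast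
  define l where "l x = C - U x" for x
  have l_nonneg: "0 \<le> l x" for x using C[of x] by (simp add: l_def)
  have l_convex: "convex_on UNIV l"
  proof -
    have "convex_on UNIV (\<lambda>x. - U x + C)"
      using U_concave by (intro convex_on_add) (auto simp: concave_on_def convex_on_const)
    then show ?thesis by (simp add: l_def[abs_def])
  qed
  have lm: "l \<in> borel_measurable borel"
    by (intro borel_measurable_continuous_onI convex_on_continuous l_convex open_UNIV)
  then have Um[measurable]: "U \<in> borel_measurable borel"
    using borel_measurable_diff[OF borel_measurable_const[of C] lm] by (simp add: l_def)
  define I where "I S' \<phi> = (\<integral>\<^sup>+\<omega>. ennreal (l (wealth T S' w0 \<phi> \<omega>)) \<partial>M)"
    for S' \<phi> :: "nat \<Rightarrow> 'w \<Rightarrow> real^'d"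
  have E: "ext_expectation M (\<lambda>\<omega>. U (wealth T S' w0 \<phi> \<omega>)) = ereal C - enn2ereal (I S' \<phi>)"
    if "S' \<in> SS" "\<phi> \<in> strategies F T" for S' \<phi>
  proof -
    have [measurable]: "wealth T S' w0 \<phi> \<in> borel_measurable M"
      using adapted_market.measurable_wealth[OF market[OF that(1)] that(2) order_refl]
      by (rule measurable_F_M[OF order_refl])
    show ?thesis
      unfolding I_def l_def by (rule ext_expectation_bounded_above[OF prob _ C]) measurable
  qed
  have "\<exists>\<phi>\<in>strategies F T. \<forall>\<psi>\<in>strategies F T. (SUP S'\<in>SS. I S' \<phi>) \<le> (SUP S'\<in>SS. I S' \<psi>)"
  \<comment> \<open>A constant \<open>U\<close> gives no control of the shortfall, but then every
    strategy has the same losses.\<close>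
  proof (cases "\<exists>p q. U p \<noteq> U q")
    case True
    then obtain p q where "U p \<noteq> U q" by blast
    then obtain a b where ab: "0 < a" "0 \<le> b" "\<And>x. max 0 (- x) \<le> b + a * (C - U x)"
      using concave_shortfall_bound[OF U_concave U_mono C] by blast
    show ?thesis unfolding I_def
    proof (rule robust_loss_minimiser_exists[of SS l a b])
      show "S' t \<in> borel_measurable (F t)" if "S' \<in> SS" "t \<le> T" for S' t
        using that by (rule adapted_SS)
      show "AE \<omega> in M. Dset M F S' t \<omega> \<subseteq> Dset M F S t \<omega>" if "S' \<in> SS" "t \<in> {1..T}" for S' t
        using that by (rule D)
      show "max 0 (- x) \<le> b + a * l x" for x using ab(3)[of x] by (simp add: l_def)
    qed (use S(1) l_nonneg l_convex ab in auto)
  next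
    case False
    then have "l x = l 0" for x by (simp add: l_def)
    then have const: "I S' \<phi> = I S' \<psi>" for S' \<phi> \<psi> unfolding I_def by metis
    show ?thesis
    proof (intro bexI ballI)
      show "(\<lambda>t \<omega>. 0) \<in> strategies F T" by (simp add: strategies_def)
      show "(SUP S'\<in>SS. I S' (\<lambda>t \<omega>. 0)) \<le> (SUP S'\<in>SS. I S' \<psi>)" for \<psi>
        by (intro SUP_mono' eq_refl const)
    qed
  qed
  then obtain \<phi> where phi: "\<phi> \<in> strategies F T"
    and opt: "\<And>\<psi>. \<psi> \<in> strategies F T \<Longrightarrow> (SUP S'\<in>SS. I S' \<phi>) \<le> (SUP S'\<in>SS. I S' \<psi>)" by blast
  let ?J = "\<lambda>\<phi>. INF S'\<in>SS. ext_expectation M (\<lambda>\<omega>. U (wealth T S' w0 \<phi> \<omega>))"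
  \<comment> \<open>Minimal worst-case loss becomes maximal worst-case utility under subtraction
    from \<open>C\<close>. Either side may be infinite, so the two orders are matched by cases on
    the extended values.\<close>
  have "?J \<psi> \<le> ?J \<phi>" if psi: "\<psi> \<in> strategies F T" for \<psi>
  proof (rule INF_greatest)
    fix S' assume S': "S' \<in> SS"
    have up: "enn2ereal (I R \<psi>) \<le> ereal C - ?J \<psi>" if "R \<in> SS" for R
    proof -
      have "?J \<psi> \<le> ereal C - enn2ereal (I R \<psi>)" using INF_lower[OF that] E[OF that psi] by metis
      then show ?thesis
        using enn2ereal_nonneg[of "I R \<psi>"]
        by (cases "?J \<psi>"; cases "enn2ereal (I R \<psi>)") (auto simp: field_simps)
    qed
    then have "I R \<psi> \<le> e2ennreal (ereal C - ?J \<psi>)" if "R \<in> SS" for R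
      using e2ennreal_mono[OF up[OF that]] by simp
    then have "(SUP R\<in>SS. I R \<psi>) \<le> e2ennreal (ereal C - ?J \<psi>)" by (rule SUP_least)
    moreover have "I S' \<phi> \<le> (SUP R\<in>SS. I R \<phi>)" using S' by (rule SUP_upper)
    ultimately have "I S' \<phi> \<le> e2ennreal (ereal C - ?J \<psi>)" using opt[OF psi] by (meson order_trans)
    \<comment> \<open>Nonnegativity makes \<open>e2ennreal\<close> faithful, so the estimate can be
      carried back to \<open>ereal\<close>.\<close>
    moreover have "0 \<le> ereal C - ?J \<psi>" using up[OF S'] enn2ereal_nonneg order_trans by blast
    ultimately have "enn2ereal (I S' \<phi>) \<le> ereal C - ?J \<psi>"
      by (metis enn2ereal_e2ennreal less_eq_ennreal.rep_eq)
    then have "?J \<psi> \<le> ereal C - enn2ereal (I S' \<phi>)"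
      using enn2ereal_nonneg[of "I S' \<phi>"]
      by (cases "?J \<psi>"; cases "enn2ereal (I S' \<phi>)") (auto simp: field_simps)
    then show "?J \<psi> \<le> ext_expectation M (\<lambda>\<omega>. U (wealth T S' w0 \<phi> \<omega>))" unfolding E[OF S' phi] .
  qed
  then have "value_fn M F T SS U w0 = ?J \<phi>"
    unfolding value_fn_def using phi by (intro antisym SUP_least SUP_upper) auto
  moreover have "?J \<phi> < \<infinity>"
  proof -
    have "?J \<phi> \<le> ereal C - enn2ereal (I S \<phi>)" using INF_lower[OF S(1)] E[OF S(1) phi] by metis
    also have "\<dots> < \<infinity>" using enn2ereal_nonneg[of "I S \<phi>"] by (cases "enn2ereal (I S \<phi>)") auto
    finally show ?thesis .
  qed
  ultimately show ?thesis using phi by blast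
qed

end
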